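(* Let $\chi,\mu$ be probability measures on $\mathbb{R}$ and $\ddot\mu$ a symmetrization of $\mu$. Suppose that $\chi$ is absolutely continuous with density $f_\chi$ and that the density $f_{\chi*\ddot\mu}$ of $\chi*\ddot\mu$ is continuous. Let $\iota$ be an absolutely continuous probability measure on $\mathbb{R}$ with $f_\iota(\xi)=\mathcal{O}(\xi^{-2})$ as $\xi\to\pm\infty$ and $\Phi_\iota\in L^1(\mathbb{R})$, such that $\Phi_\iota$ is continuously differentiable for $|t|>0$ and there exists $a>2$ with $\Phi_\iota'(t)=\mathcal{O}(|t|^{-a})$ as $t\to\pm\infty$. Suppose there exist $T_0\ge0$, a finite complex Borel measure $\kappa$ on $\mathbb{R}$ with $|\kappa|(\mathbb{R})=|\kappa|(D_\kappa)$, and a continuous function of bounded variation $\varphi_\chi:[T_0,\infty]\to\mathbb{C}$ with $\lim_{t\to\infty}\varphi_\chi(t)=0$, such that $\Phi_\chi(t)=\Phi_\kappa(t)\varphi_\chi(t)$ for all $t\ge T_0$. Put $\mathcal{P}_{\ddot\mu}(t,m):=(1-\Phi_{\ddot\mu}(t))^{m+1}$, $m\ge0$, and suppose there exist constants $\rho>0$ and $j_{\ddot\mu}\in\mathbb{N}_0$ for which $\mathcal{P}_{\ddot\mu}(t+j\rho,m)$ is non-decreasing or non-increasing with respect to integer $j\ge j_{\ddot\mu}$, for each fixed $0\le t\le\rho$. If $\mathcal{N}_\mu$ is of Lebesgue measure zero, then $$\lim_{m\to\infty}\mathfrak{d}(\xi,m)=\frac{f_\chi(\xi+)+f_\chi(\xi-)}{2}$$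 for every $\xi\in\mathbb{R}$ with $\Delta(\mathcal{H}^\kappa_{\rho,\xi},2\pi\mathbb{Z})>0$, where $\mathcal{H}^\kappa_{\rho,\xi}:=\{(x-\xi)\rho : x\in D_\kappa\}$.
   Context: Measures are finite signed or complex Borel measures on $\mathbb{R}$. $F_\nu(\xi) := \nu((-\infty,\xi])$, $\Phi_\nu(t) := \int e^{itx}\,\nu(dx)$, $D_\nu:=\{x\in\mathbb{R}:\nu(\{x\})\ne0\}$, $|\nu|$ is the total variation measure, and $\mathcal{N}_\nu := \{t \in \mathbb{R}\cup\{\pm\infty\} : \Phi_\nu(t)=0\}$, where $\pm\infty \in \mathcal{N}_\nu$ means $\lim_{t\to\pm\infty}\Phi_\nu(t)=0$. $f_\nu$ is the Lebesgue density of an absolutely continuous $\nu$; $Q(\xi\pm)$ are one-sided limits. $\Delta(A,B):=\inf_{(a,b)\in A\times B}|a-b|$. $\nu^{*0}:=\delta_{\{0\}}$, $\nu^{*k} := \nu * \nu^{*(k-1)}$, and $F_\nu^{*k}$ is the distribution function of $\nu^{*k}$. A symmetrization of $\mu$ is a probability measure $\ddot\mu = \mu*\eta$, with $\eta$ a probability measure, such that $F_{\ddot\mu}(\xi-)=1-F_{\ddot\mu}(-\xi)$ for all $\xi$, $\Phi_{\ddot\mu}=\Phi_\mu\Phi_\eta$ is even with $0\le\Phi_{\ddot\mu}\le1$, and $\mathcal{N}_{\ddot\mu}=\mathcal{N}_\mu$. Put $\pi_{\ddot\mu} := \delta_{\{0\}} - \ddot\mu$, $\mathfrak{K}_{\ddot\mu}(\xi,m)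 := \sum_{\ell=0}^m F_{\pi_{\ddot\mu}}^{*\ell}(\xi)$. The deconvolution density is $\mathfrak{d}(\xi,m) := \int_{-\infty}^\infty f_{\chi*\ddot\mu}(\xi-x)\,\mathfrak{K}_{\ddot\mu}(dx,m)$, for $(\xi,m)\in\mathbb{R}\times\mathbb{N}_0$. *)

theory Defs
  imports "HOL-Probability.Probability"
begin

text \<open>Probability measures on the line are Isabelle measures satisfying \<^const>\<open>real_distribution\<close>, with
  \<^const>\<open>cdf\<close>, \<^const>\<open>char\<close> and \<^const>\<open>convolution\<close> from the library.  Finite signed and complex Borel
  measures are countably additive set functions; they are normalised to vanish outside the Borel
  sets, so that equality of complex measures is equality of functions.\<close>

type_synonym cmeasure = "real set \<Rightarrow> complex"

definition complex_measure :: "cmeasure \<Rightarrow> bool" where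
  "complex_measure \<nu> \<longleftrightarrow>
     (\<forall>A :: nat \<Rightarrow> real set. range A \<subseteq> sets borel \<longrightarrow> disjoint_family A \<longrightarrow>
        (\<lambda>i. \<nu> (A i)) sums \<nu> (\<Union>i. A i)) \<and>
     (\<forall>A. A \<notin> sets borel \<longrightarrow> \<nu> A = 0)"

definition cm_of :: "real measure \<Rightarrow> cmeasure" where
  "cm_of M = (\<lambda>A. complex_of_real (measure M A))"

definition cm_cdf :: "cmeasure \<Rightarrow> real \<Rightarrow> complex" where
  "cm_cdf \<nu> \<xi> = \<nu> {..\<xi>}"

definition atoms :: "cmeasure \<Rightarrow> real set" where
  "atoms \<nu> = {x. \<nu> {x} \<noteq> 0}"

definition total_variation :: "cmeasure \<Rightarrow> real set \<Rightarrow> ennreal" where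
  "total_variation \<nu> A =
     (SUP E \<in> {E :: nat \<Rightarrow> real set. range E \<subseteq> sets borel \<and> disjoint_family E \<and> (\<Union>i. E i) = A}.
        \<Sum>i. ennreal (norm (\<nu> (E i))))"

text \<open>Positive part in the Jordan decomposition of a finite signed measure (the negative part is
  the positive part of the negative).  Sets on which \<open>\<sigma>\<close> is negative are cut off to 0 by
  \<^const>\<open>ennreal\<close>; this is harmless, as the empty set takes part in the supremum.\<close>

definition pos_variation :: "(real set \<Rightarrow> real) \<Rightarrow> real measure" where
  "pos_variation \<sigma> = measure_of UNIV (sets borel)
     (\<lambda>A. SUP B \<in> {B \<in> sets borel. B \<subseteq> A}. ennreal (\<sigma> B))"

definition sm_integral :: "(real set \<Rightarrow> real) \<Rightarrow> (real \<Rightarrow> complex) \<Rightarrow> complex" where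
  "sm_integral \<sigma> f =
     (\<integral>x. f x \<partial>pos_variation \<sigma>) - (\<integral>x. f x \<partial>pos_variation (\<lambda>A. - \<sigma> A))"

definition cm_integral :: "cmeasure \<Rightarrow> (real \<Rightarrow> complex) \<Rightarrow> complex" where
  "cm_integral \<nu> f = sm_integral (\<lambda>A. Re (\<nu> A)) f + \<i> * sm_integral (\<lambda>A. Im (\<nu> A)) f"

definition cm_char :: "cmeasure \<Rightarrow> real \<Rightarrow> complex" where
  "cm_char \<nu> t = cm_integral \<nu> (\<lambda>x. iexp (t * x))"

definition cm_convolution :: "cmeasure \<Rightarrow> cmeasure \<Rightarrow> cmeasure" where
  "cm_convolution \<mu> \<nu> =
     (\<lambda>A. if A \<in> sets borel then cm_integral \<nu> (\<lambda>x. \<mu> {y. x + y \<in> A}) else 0)"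

primrec cm_power :: "cmeasure \<Rightarrow> nat \<Rightarrow> cmeasure" where
  "cm_power \<nu> 0 = cm_of (return borel 0)"
| "cm_power \<nu> (Suc k) = cm_convolution \<nu> (cm_power \<nu> k)"

text \<open>The integral \<open>\<integral> f(x) G(dx)\<close> against a function \<open>G\<close> that is the distribution function of a
  (necessarily unique) complex measure.\<close>

definition stieltjes_integral :: "(real \<Rightarrow> complex) \<Rightarrow> (real \<Rightarrow> complex) \<Rightarrow> complex" where
  "stieltjes_integral G f = cm_integral (THE \<nu>. complex_measure \<nu> \<and> cm_cdf \<nu> = G) f"

text \<open>Densities are determined only almost everywhere: \<open>f\<close> is some version of the density.\<close>

definition lebesgue_density :: "real measure \<Rightarrow> (real \<Rightarrow> real) \<Rightarrow> bool" where
  "lebesgue_density M f \<longleftrightarrow> f \<in> borel_measurable borel \<and> (AE x in lborel. 0 \<le> f x) \<and>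
     M = density lborel (\<lambda>x. ennreal (f x))"

definition char_zeros :: "real measure \<Rightarrow> ereal set" where
  "char_zeros M = {ereal t | t. char M t = 0} \<union>
     {s. s = \<infinity> \<and> (char M \<longlongrightarrow> 0) at_top} \<union> {s. s = - \<infinity> \<and> (char M \<longlongrightarrow> 0) at_bot}"

definition symmetrization :: "real measure \<Rightarrow> real measure \<Rightarrow> bool" where
  "symmetrization \<mu> M \<longleftrightarrow>
     (\<exists>\<eta>. real_distribution \<eta> \<and> M = convolution \<mu> \<eta>) \<and>
     real_distribution M \<and>
     (\<forall>\<xi>. (cdf M \<longlongrightarrow> 1 - cdf M (- \<xi>)) (at_left \<xi>)) \<and>
     (\<forall>t. char M (- t) = char M t) \<and>
     (\<forall>t. \<exists>r. 0 \<le> r \<and> r \<le> 1 \<and> char M t = complex_of_real r) \<and>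
     char_zeros M = char_zeros \<mu>"

text \<open>In the following, \<open>M\<close> is a symmetrization; its characteristic function is then real-valued.\<close>

definition deconv_pi :: "real measure \<Rightarrow> cmeasure" where
  "deconv_pi M = (\<lambda>A. cm_of (return borel 0) A - cm_of M A)"

definition deconv_kernel :: "real measure \<Rightarrow> real \<Rightarrow> nat \<Rightarrow> complex" where
  "deconv_kernel M \<xi> m = (\<Sum>l\<le>m. cm_cdf (cm_power (deconv_pi M) l) \<xi>)"

text \<open>Here \<open>h\<close> is the density of the convolution of the target measure with \<open>M\<close>.\<close>

definition deconv_density :: "(real \<Rightarrow> real) \<Rightarrow> real measure \<Rightarrow> real \<Rightarrow> nat \<Rightarrow> complex" where
  "deconv_density h M \<xi> m =
     stieltjes_integral (\<lambda>x. deconv_kernel M x m) (\<lambda>x. complex_of_real (h (\<xi> - x)))"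

definition deconv_P :: "real measure \<Rightarrow> real \<Rightarrow> nat \<Rightarrow> real" where
  "deconv_P M t m = (1 - Re (char M t)) ^ (m + 1)"

definition bounded_variation_on :: "'a::linorder set \<Rightarrow> ('a \<Rightarrow> 'b::real_normed_vector) \<Rightarrow> bool" where
  "bounded_variation_on S f \<longleftrightarrow>
     (\<exists>V. \<forall>(x :: nat \<Rightarrow> 'a) n. mono x \<longrightarrow> range x \<subseteq> S \<longrightarrow>
        (\<Sum>i<n. norm (f (x (Suc i)) - f (x i))) \<le> V)"

text \<open>Extended-real-valued, so that the distance to the empty set is \<open>\<infinity>\<close> (unlike \<^const>\<open>setdist\<close>).
  This matters when the measure \<open>\<kappa>\<close> below is 0.\<close>

definition set_gap :: "real set \<Rightarrow> real set \<Rightarrow> ereal" where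
  "set_gap A B = (INF (a, b) \<in> A \<times> B. ereal \<bar>a - b\<bar>)"

definition shifted_atoms :: "cmeasure \<Rightarrow> real \<Rightarrow> real \<Rightarrow> real set" where
  "shifted_atoms \<kappa> \<rho> \<xi> = {(x - \<xi>) * \<rho> | x. x \<in> atoms \<kappa>}"

end

theory Submission
  imports Defs
begin

text \<open>Write \<open>r\<close> for the characteristic function of the symmetrization \<open>M\<close>; it is real, lies between 0 and 1,
and is monotone along each progression \<open>t, t + \<rho>, t + 2 \<rho>, \<dots>\<close> from some index on.  Let \<open>y\<close> be a point whose
distance to all atoms of \<open>\<kappa>\<close> is bounded below modulo \<open>2 \<pi> / \<rho>\<close>.

The Fourier integral \<open>\<integral> e^(-ity) \<Phi>(t) b(t) dt\<close>, with \<open>\<Phi> = \<Phi>\<^sub>\<chi>\<close> and a weight \<open>b\<close> with values in \<open>[0,1]\<close> that is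
monotone along these progressions, need not converge absolutely.  It is split into periods of length \<open>\<rho>\<close>.
For fixed \<open>t\<close> the sums over \<open>j\<close> of \<open>e^(-i(t + j\<rho>)y) \<Phi>\<^sub>\<kappa>(t + j\<rho>)\<close> are superpositions of geometric sums with
ratios bounded away from 1, hence bounded (\<open>sum_char_atomic_bounded\<close>).  Since \<open>\<Phi> = \<Phi>\<^sub>\<kappa> \<phi>\<close> far out, where \<open>\<phi>\<close> is of
bounded variation and vanishes at infinity, summation by parts shows that the tails of the integral are
small uniformly in \<open>y\<close> and, decisively, in \<open>b\<close> (\<open>uniform_tail_char\<close>).

Take \<open>b = r^k\<close>.  The integral then converges locally uniformly to a function \<open>G\<^sub>k\<close>, which by Levy's inversion
formula is a continuous density of \<open>\<chi> * M^(*k)\<close> near \<open>y\<close>.  In particular \<open>\<chi>\<close> has the continuous density \<open>G\<^sub>0\<close>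
there, so that one-sided limits of any version of its density agree with \<open>G\<^sub>0\<close>.

The binomial theorem for convolution powers turns the deconvolution density into alternating binomial sums of
\<open>H\<^sub>k(y) = \<integral> h(y - x) M^(*k)(dx)\<close>.  Once \<open>H\<^sub>k(y) = G\<^sub>k\<^sub>+\<^sub>1(y)\<close> is known, these sums telescope to \<open>G\<^sub>0(y)\<close> minus the
Fourier integral with the weight \<open>b = (1 - r)^(m+1)\<close>.  This weight tends to 0 almost everywhere as \<open>m\<close>
grows, because \<open>r\<close> vanishes only on a null set; the tails being uniformly small, the integral tends to 0
(\<open>fourier_inverse_properties\<close>, \<open>deconv_density_tendsto_G\<close>).

The delicate point is the pointwise identity \<open>H\<^sub>k = G\<^sub>k\<^sub>+\<^sub>1\<close> (\<open>convolution_integral_eq_G\<close>).  Both sides are versions of the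
same density and \<open>G\<^sub>k\<^sub>+\<^sub>1\<close> is continuous, so it suffices that \<open>H\<^sub>k\<close> is finite and continuous near \<open>y\<close>; but \<open>h\<close>,
although continuous and integrable, may be unbounded.  The way out is to split the integral according to the
distance of \<open>x\<close> from the lattice \<open>(2 \<pi> / \<rho>) \<int>\<close>.  If \<open>x\<close> is close to the lattice, then \<open>y - x\<close> is as far from
the atoms modulo \<open>2 \<pi> / \<rho>\<close> as \<open>y\<close> is, up to a small error, and on such points \<open>h = G\<^sub>1\<close> is bounded; dominated
convergence applies.  Away from the lattice, the same summation by parts, now for the characteristic function
\<open>r^k\<close> itself, bounds the Fourier integrals of \<open>M^(*k)\<close>, so that \<open>M^(*k)\<close> is at most a multiple of Lebesgue measure
there (\<open>conv_power_le_lborel\<close>), and the continuity of translations in \<open>L\<^sup>1\<close> (Scheffe's lemma) applies.\<close>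

section \<open>Signed measures and their positive variation\<close>

definition sigma_additive :: "(real set \<Rightarrow> 'b::real_normed_vector) \<Rightarrow> bool" where
  "sigma_additive \<sigma> \<longleftrightarrow>
     (\<forall>A :: nat \<Rightarrow> real set. range A \<subseteq> sets borel \<longrightarrow> disjoint_family A \<longrightarrow>
        (\<lambda>i. \<sigma> (A i)) sums \<sigma> (\<Union>i. A i))"

lemma sigma_additive_sums:
  assumes "sigma_additive \<sigma>" "\<And>i. A i \<in> sets borel" "disjoint_family A"
  shows "(\<lambda>i. \<sigma> (A i)) sums \<sigma> (\<Union>i. A i)"
  using assms unfolding sigma_additive_def by blast

lemma complex_measure_sigma_additive: "complex_measure \<nu> \<Longrightarrow> sigma_additive \<nu>"
  unfolding complex_measure_def sigma_additive_def by blast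

lemma sigma_additive_empty:
  assumes "sigma_additive \<sigma>"
  shows "\<sigma> {} = 0"
proof -
  have "(\<lambda>i::nat. \<sigma> {}) sums \<sigma> (\<Union>i::nat. {})"
    by (rule sigma_additive_sums[OF assms, of "\<lambda>_. {}"]) (auto simp: disjoint_family_on_def)
  then have "summable (\<lambda>i::nat. \<sigma> {})"
    by (rule sums_summable)
  then show ?thesis by (simp add: summable_const_iff)
qed

lemma sigma_additive_Un:
  assumes "sigma_additive \<sigma>" "A \<in> sets borel" "B \<in> sets borel" "A \<inter> B = {}"
  shows "\<sigma> (A \<union> B) = \<sigma> A + \<sigma> B"
proof -
  have "(\<lambda>i. \<sigma> (binaryset A B i)) sums \<sigma> (\<Union>i. binaryset A B i)"
    by (rule sigma_additive_sums[OF assms(1)])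
       (use assms in \<open>auto simp: disjoint_family_on_def binaryset_def\<close>)
  moreover have "(\<lambda>i. \<sigma> (binaryset A B i)) sums (\<sigma> A + \<sigma> B)"
    by (rule binaryset_sums) (rule sigma_additive_empty[OF assms(1)])
  ultimately show ?thesis by (simp add: UN_binaryset_eq sums_iff)
qed

lemma sigma_additive_split:
  assumes "sigma_additive \<sigma>" "A \<in> sets borel" "B \<in> sets borel"
  shows "\<sigma> A = \<sigma> (A \<inter> B) + \<sigma> (A - B)"
  using sigma_additive_Un[OF assms(1), of "A \<inter> B" "A - B"] assms
  by (simp add: Int_Diff_Un Int_Diff_disjoint)

lemma sigma_additive_uminus: "sigma_additive \<sigma> \<Longrightarrow> sigma_additive (\<lambda>A. - \<sigma> A)"
  unfolding sigma_additive_def by (auto intro: sums_minus)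

lemma sigma_additive_bounded_linear:
  "bounded_linear T \<Longrightarrow> sigma_additive \<sigma> \<Longrightarrow> sigma_additive (\<lambda>A. T (\<sigma> A))"
  unfolding sigma_additive_def by (auto intro: bounded_linear.sums)

lemma sigma_additive_sum:
  "(\<And>i. i \<in> I \<Longrightarrow> sigma_additive (\<sigma> i)) \<Longrightarrow> sigma_additive (\<lambda>A. \<Sum>i\<in>I. \<sigma> i A)"
  unfolding sigma_additive_def by (auto intro: sums_sum)

lemma sigma_additive_measure:
  assumes "finite_measure M" "sets M = sets borel"
  shows "sigma_additive (measure M)"
  unfolding sigma_additive_def
  using finite_measure.finite_measure_UNION[OF assms(1)] assms(2) by auto

definition hahn_set :: "(real set \<Rightarrow> real) \<Rightarrow> real set \<Rightarrow> bool" where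
  "hahn_set \<sigma> Y \<longleftrightarrow> Y \<in> sets borel \<and>
     (\<forall>B\<in>sets borel. B \<subseteq> Y \<longrightarrow> 0 \<le> \<sigma> B) \<and> (\<forall>B\<in>sets borel. B \<inter> Y = {} \<longrightarrow> \<sigma> B \<le> 0)"

lemma hahn_set_nonneg: "hahn_set \<sigma> Y \<Longrightarrow> B \<in> sets borel \<Longrightarrow> B \<subseteq> Y \<Longrightarrow> 0 \<le> \<sigma> B"
  and hahn_set_nonpos: "hahn_set \<sigma> Y \<Longrightarrow> B \<in> sets borel \<Longrightarrow> B \<inter> Y = {} \<Longrightarrow> \<sigma> B \<le> 0"
  by (simp_all add: hahn_set_def)

lemma hahn_set_uminus: "hahn_set \<sigma> Y \<Longrightarrow> hahn_set (\<lambda>A. - \<sigma> A) (- Y)"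
  unfolding hahn_set_def by (auto simp: disjoint_eq_subset_Compl)

lemma sets_pos_variation [simp, measurable_cong]: "sets (pos_variation \<sigma>) = sets borel"
  unfolding pos_variation_def by (subst sets_measure_of) (auto simp: sets.sigma_sets_eq[of borel, simplified])

lemma space_pos_variation [simp]: "space (pos_variation \<sigma>) = UNIV"
  unfolding pos_variation_def by simp

text \<open>The supremum that defines the positive variation is attained at the intersection with the Hahn set \<open>Y\<close>: passing from
\<open>B\<close> to \<open>B \<inter> Y\<close> discards a part of nonpositive mass, and passing from there to \<open>A \<inter> Y\<close> adds nonnegative mass.\<close>

lemma emeasure_pos_variation:
  assumes \<sigma>: "sigma_additive \<sigma>" and Y: "hahn_set \<sigma> Y" and A: "A \<in> sets borel"
  shows "emeasure (pos_variation \<sigma>) A = ennreal (\<sigma> (A \<inter> Y))"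
proof -
  have Yb: "Y \<in> sets borel" and Yp: "\<And>B. B \<in> sets borel \<Longrightarrow> B \<subseteq> Y \<Longrightarrow> 0 \<le> \<sigma> B"
    and Yn: "\<And>B. B \<in> sets borel \<Longrightarrow> B \<inter> Y = {} \<Longrightarrow> \<sigma> B \<le> 0"
    using Y unfolding hahn_set_def by auto
  have sup: "(SUP B \<in> {B \<in> sets borel. B \<subseteq> A}. ennreal (\<sigma> B)) = ennreal (\<sigma> (A \<inter> Y))"
    if A: "A \<in> sets borel" for A
  proof (rule antisym)
    show "(SUP B \<in> {B \<in> sets borel. B \<subseteq> A}. ennreal (\<sigma> B)) \<le> ennreal (\<sigma> (A \<inter> Y))"
    proof (rule SUP_least)
      fix B assume B: "B \<in> {B \<in> sets borel. B \<subseteq> A}"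
      have "\<sigma> B = \<sigma> (B \<inter> Y) + \<sigma> (B - Y)"
        using sigma_additive_split[OF \<sigma>, of B Y] B Yb by auto
      moreover have "\<sigma> (B - Y) \<le> 0"
        using B Yb by (intro Yn) auto
      moreover have "\<sigma> (A \<inter> Y) = \<sigma> ((A \<inter> Y) \<inter> B) + \<sigma> ((A \<inter> Y) - B)"
        using sigma_additive_split[OF \<sigma>, of "A \<inter> Y" B] A B Yb by auto
      moreover have "0 \<le> \<sigma> ((A \<inter> Y) - B)"
        using A B Yb by (intro Yp) auto
      moreover have "(A \<inter> Y) \<inter> B = B \<inter> Y"
        using B by auto
      ultimately have "\<sigma> B \<le> \<sigma> (A \<inter> Y)"
        by simp
      then show "ennreal (\<sigma> B) \<le> ennreal (\<sigma> (A \<inter> Y))" by (rule ennreal_leI)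
    qed
    show "ennreal (\<sigma> (A \<inter> Y)) \<le> (SUP B \<in> {B \<in> sets borel. B \<subseteq> A}. ennreal (\<sigma> B))"
      using A Yb by (intro SUP_upper) auto
  qed
  have eq: "pos_variation \<sigma> = measure_of UNIV (sets borel) (\<lambda>A. ennreal (\<sigma> (A \<inter> Y)))"
    unfolding pos_variation_def
    by (rule measure_of_eq) (auto simp: sets.sigma_sets_eq[of borel, simplified] sup)
  have pos: "positive (sets borel) (\<lambda>A. ennreal (\<sigma> (A \<inter> Y)))"
    by (auto simp: positive_def sigma_additive_empty[OF \<sigma>])
  have ca: "countably_additive (sets borel) (\<lambda>A. ennreal (\<sigma> (A \<inter> Y)))"
  proof (rule countably_additiveI)
    fix F :: "nat \<Rightarrow> real set"
    assume F: "range F \<subseteq> sets borel" "disjoint_family F"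
    have "(\<lambda>i. \<sigma> (F i \<inter> Y)) sums \<sigma> (\<Union>i. F i \<inter> Y)"
      using F Yb by (intro sigma_additive_sums[OF \<sigma>]) (auto simp: disjoint_family_on_def)
    moreover have "0 \<le> \<sigma> (F i \<inter> Y)" for i
      using F Yb by (intro Yp) auto
    ultimately show "(\<Sum>i. ennreal (\<sigma> (F i \<inter> Y))) = ennreal (\<sigma> (\<Union> (range F) \<inter> Y))"
      by (subst suminf_ennreal2) (auto simp: sums_iff)
  qed
  show ?thesis
    unfolding eq
    by (rule emeasure_measure_of_sigma[OF _ pos ca A])
       (use sets.sigma_algebra_axioms[of "borel :: real measure"] in simp)
qed

lemma finite_measure_pos_variation:
  assumes \<sigma>: "sigma_additive \<sigma>" and Y: "hahn_set \<sigma> Y"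
  shows "finite_measure (pos_variation \<sigma>)"
  by (rule finite_measureI) (simp add: emeasure_pos_variation[OF assms])

text \<open>With the positive and the negative parts of real coefficients as weights, this writes a linear combination of
finite measures as a difference of two finite measures, which is what the Hahn decomposition asks for.\<close>

definition weighted_sum :: "'i set \<Rightarrow> ('i \<Rightarrow> real) \<Rightarrow> ('i \<Rightarrow> real measure) \<Rightarrow> real measure" where
  "weighted_sum I c Q = measure_of UNIV (sets borel) (\<lambda>A. \<Sum>i\<in>I. ennreal (c i) * emeasure (Q i) A)"

lemma sets_weighted_sum [simp, measurable_cong]: "sets (weighted_sum I c Q) = sets borel"
  unfolding weighted_sum_def
  by (subst sets_measure_of) (auto simp: sets.sigma_sets_eq[of borel, simplified])

lemma space_weighted_sum [simp]: "space (weighted_sum I c Q) = UNIV"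
  unfolding weighted_sum_def by simp

lemma emeasure_weighted_sum:
  assumes Q: "\<And>i. i \<in> I \<Longrightarrow> sets (Q i) = sets borel" and A: "A \<in> sets borel"
  shows "emeasure (weighted_sum I c Q) A = (\<Sum>i\<in>I. ennreal (c i) * emeasure (Q i) A)"
proof -
  have "countably_additive (sets borel) (\<lambda>A. \<Sum>i\<in>I. ennreal (c i) * emeasure (Q i) A)"
  proof (rule countably_additiveI)
    fix F :: "nat \<Rightarrow> real set"
    assume F: "range F \<subseteq> sets borel" "disjoint_family F"
    have "(\<Sum>n. \<Sum>i\<in>I. ennreal (c i) * emeasure (Q i) (F n))
        = (\<Sum>i\<in>I. \<Sum>n. ennreal (c i) * emeasure (Q i) (F n))"
      by (rule suminf_sum) simp
    also have "\<dots> = (\<Sum>i\<in>I. ennreal (c i) * emeasure (Q i) (\<Union>n. F n))"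
      using F Q by (intro sum.cong refl) (simp add: ennreal_suminf_cmult suminf_emeasure)
    finally show "(\<Sum>n. \<Sum>i\<in>I. ennreal (c i) * emeasure (Q i) (F n))
        = (\<Sum>i\<in>I. ennreal (c i) * emeasure (Q i) (\<Union>n. F n))" .
  qed
  then show ?thesis
    unfolding weighted_sum_def
    by (intro emeasure_measure_of_sigma A)
       (use sets.sigma_algebra_axioms[of "borel :: real measure"] in \<open>auto simp: positive_def\<close>)
qed

lemma nn_integral_weighted_sum:
  assumes Q: "\<And>i. i \<in> I \<Longrightarrow> sets (Q i) = sets borel" and f: "f \<in> borel_measurable borel"
  shows "(\<integral>\<^sup>+x. f x \<partial>weighted_sum I c Q) = (\<Sum>i\<in>I. ennreal (c i) * (\<integral>\<^sup>+x. f x \<partial>Q i))"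
  using f
proof (induction rule: borel_measurable_induct)
  case (cong f g)
  then have "f = g" by (auto simp: fun_eq_iff)
  then show ?case using cong by simp
next
  case (set A)
  then show ?case using Q by (simp add: emeasure_weighted_sum)
next
  case (mult u c')
  have [measurable]: "u \<in> borel_measurable (Q i)" if "i \<in> I" for i
    using mult Q[OF that] by (simp cong: measurable_cong_sets)
  have [measurable]: "u \<in> borel_measurable (weighted_sum I c Q)"
    using mult by (simp cong: measurable_cong_sets)
  have "(\<integral>\<^sup>+ x. c' * u x \<partial>weighted_sum I c Q) = c' * (\<Sum>i\<in>I. ennreal (c i) * integral\<^sup>N (Q i) u)"
    using mult by (simp add: nn_integral_cmult)
  also have "\<dots> = (\<Sum>i\<in>I. ennreal (c i) * (\<integral>\<^sup>+ x. c' * u x \<partial>Q i))"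
    unfolding sum_distrib_left by (intro sum.cong refl) (simp add: nn_integral_cmult mult_ac)
  finally show ?case .
next
  case (add u v)
  have [measurable]: "u \<in> borel_measurable (Q i)" "v \<in> borel_measurable (Q i)" if "i \<in> I" for i
    using add Q[OF that] by (simp_all cong: measurable_cong_sets)
  have [measurable]: "u \<in> borel_measurable (weighted_sum I c Q)" "v \<in> borel_measurable (weighted_sum I c Q)"
    using add by (simp_all cong: measurable_cong_sets)
  show ?case using add by (simp add: nn_integral_add sum.distrib distrib_left)
next
  case (seq U)
  have m: "U n \<in> borel_measurable (Q i)" if "i \<in> I" for i n
    using seq Q[OF that] by (simp cong: measurable_cong_sets)
  have m': "U n \<in> borel_measurable (weighted_sum I c Q)" for n
    using seq by (simp cong: measurable_cong_sets)
  have sup: "(SUP i. U i) = (\<lambda>x. SUP i. U i x)" by (simp add: fun_eq_iff image_image)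
  have "(\<integral>\<^sup>+ x. (SUP i. U i x) \<partial>weighted_sum I c Q)
      = (SUP n. \<Sum>i\<in>I. ennreal (c i) * (\<integral>\<^sup>+x. U n x \<partial>Q i))"
    using seq m' by (subst nn_integral_monotone_convergence_SUP) auto
  also have "\<dots> = (\<Sum>i\<in>I. SUP n. ennreal (c i) * (\<integral>\<^sup>+x. U n x \<partial>Q i))"
    using seq(3) by (intro ennreal_SUP_sum)
      (auto simp: incseq_def le_fun_def intro!: mult_left_mono nn_integral_mono)
  also have "\<dots> = (\<Sum>i\<in>I. ennreal (c i) * (\<integral>\<^sup>+x. (SUP n. U n x) \<partial>Q i))"
    using seq m by (intro sum.cong refl)
      (simp only: SUP_mult_left_ennreal[symmetric] nn_integral_monotone_convergence_SUP)
  finally show ?case by (simp add: sup)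
qed

section \<open>Integrals against signed combinations of measures\<close>

lemma nn_integral_eq_ennreal_integral:
  fixes f :: "'a \<Rightarrow> real"
  assumes "integrable M f" "\<And>x. 0 \<le> f x"
  shows "(\<integral>\<^sup>+x. ennreal (f x) \<partial>M) = ennreal (\<integral>x. f x \<partial>M)"
  using assms by (intro nn_integral_eq_integral) auto

text \<open>Let \<open>P\<close> and \<open>N\<close> be the positive and the negative variation of the combination \<open>\<sigma>\<close>, and \<open>WP\<close>, \<open>WN\<close> the weighted
sums with the positive and the negative parts of the coefficients.  Then \<open>P \<le> WP\<close> and \<open>N \<le> WN\<close>, which
gives integrability, and \<open>P + WN = N + WP\<close>, which gives the value of the integral.  The integrand may be
unbounded, as the density \<open>h\<close> may be to which this is applied.\<close>

lemma sm_integral_weighted_real: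
  fixes Q :: "'i \<Rightarrow> real measure" and c :: "'i \<Rightarrow> real"
  assumes I: "finite I" and Q: "\<And>i. i \<in> I \<Longrightarrow> sets (Q i) = sets borel"
    and fin: "\<And>i. i \<in> I \<Longrightarrow> finite_measure (Q i)"
  defines "\<sigma> \<equiv> (\<lambda>A. \<Sum>i\<in>I. c i * measure (Q i) A)"
  shows "\<And>f :: real \<Rightarrow> 'b::{banach,second_countable_topology}. f \<in> borel_measurable borel \<Longrightarrow>
        (\<forall>i\<in>I. integrable (Q i) f) \<Longrightarrow>
        integrable (pos_variation \<sigma>) f \<and> integrable (pos_variation (\<lambda>A. - \<sigma> A)) f"
    and "\<And>f :: real \<Rightarrow> real. f \<in> borel_measurable borel \<Longrightarrow> (\<forall>i\<in>I. integrable (Q i) f) \<Longrightarrow>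
        (\<integral>x. f x \<partial>pos_variation \<sigma>) - (\<integral>x. f x \<partial>pos_variation (\<lambda>A. - \<sigma> A))
          = (\<Sum>i\<in>I. c i * (\<integral>x. f x \<partial>Q i))"
proof -
  define cp where "cp = (\<lambda>i. max 0 (c i))"
  define cn where "cn = (\<lambda>i. max 0 (- c i))"
  have c: "c i = cp i - cn i" and cp0: "0 \<le> cp i" and cn0: "0 \<le> cn i" for i
    by (auto simp: cp_def cn_def)
  define WP where "WP = weighted_sum I cp Q"
  define WN where "WN = weighted_sum I cn Q"
  have emW: "emeasure (weighted_sum I d Q) A = ennreal (\<Sum>i\<in>I. d i * measure (Q i) A)"
    if "A \<in> sets borel" "\<And>i. 0 \<le> d i" for A d
  proof -
    have "emeasure (weighted_sum I d Q) A = (\<Sum>i\<in>I. ennreal (d i * measure (Q i) A))"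
      using that Q fin by (simp add: emeasure_weighted_sum ennreal_mult' finite_measure.emeasure_eq_measure)
    also have "\<dots> = ennreal (\<Sum>i\<in>I. d i * measure (Q i) A)"
      using that by (intro sum_ennreal) simp
    finally show ?thesis .
  qed
  have finW: "finite_measure WP" "finite_measure WN"
    unfolding WP_def WN_def using cp0 cn0 by (auto intro!: finite_measureI simp: emW)
  have \<sigma>: "sigma_additive \<sigma>"
    unfolding \<sigma>_def
    by (intro sigma_additive_sum sigma_additive_bounded_linear[OF bounded_linear_mult_right]
        sigma_additive_measure Q fin)
  have \<sigma>eq: "\<sigma> A = (\<Sum>i\<in>I. cp i * measure (Q i) A) - (\<Sum>i\<in>I. cn i * measure (Q i) A)" for A
    unfolding \<sigma>_def sum_subtractf[symmetric] by (intro sum.cong refl) (simp add: c left_diff_distrib)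
  have nn: "0 \<le> (\<Sum>i\<in>I. cp i * measure (Q i) A)" "0 \<le> (\<Sum>i\<in>I. cn i * measure (Q i) A)" for A
    using cp0 cn0 by (auto intro!: sum_nonneg)
  obtain Y where Y0: "Y \<in> sets WP" "\<forall>X\<in>sets WP. X \<subseteq> Y \<longrightarrow> emeasure WN X \<le> emeasure WP X"
      "\<forall>X\<in>sets WP. X \<inter> Y = {} \<longrightarrow> emeasure WP X \<le> emeasure WN X"
    using finite_unsigned_Hahn_decomposition[OF finW] by (auto simp: WP_def WN_def)
  have Y: "hahn_set \<sigma> Y"
    unfolding hahn_set_def
  proof (intro conjI ballI impI)
    show "Y \<in> sets borel" using Y0(1) by (simp add: WP_def)
    fix B :: "real set" assume B: "B \<in> sets borel"
    { assume "B \<subseteq> Y"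
      then have "emeasure WN B \<le> emeasure WP B" using Y0(2) B by (simp add: WP_def)
      then show "0 \<le> \<sigma> B"
        using B cp0 cn0 nn by (simp add: WP_def WN_def emW \<sigma>eq ennreal_le_iff) }
    { assume "B \<inter> Y = {}"
      then have "emeasure WP B \<le> emeasure WN B" using Y0(3) B by (simp add: WP_def)
      then show "\<sigma> B \<le> 0"
        using B cp0 cn0 nn by (simp add: WP_def WN_def emW \<sigma>eq ennreal_le_iff) }
  qed
  have Yb: "Y \<in> sets borel" using Y by (simp add: hahn_set_def)
  define P where "P = pos_variation \<sigma>"
  define N where "N = pos_variation (\<lambda>A. - \<sigma> A)"
  have sPN [measurable_cong, simp]: "sets P = sets borel" "sets N = sets borel" by (auto simp: P_def N_def)
  have emP: "emeasure P A = ennreal (\<sigma> (A \<inter> Y))" if "A \<in> sets borel" for A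
    unfolding P_def by (rule emeasure_pos_variation[OF \<sigma> Y that])
  have emN: "emeasure N A = ennreal (- \<sigma> (A - Y))" if "A \<in> sets borel" for A
    unfolding N_def
    using emeasure_pos_variation[OF sigma_additive_uminus[OF \<sigma>] hahn_set_uminus[OF Y] that]
    by (simp add: Diff_eq)
  have mono: "(\<Sum>i\<in>I. d i * measure (Q i) A) \<le> (\<Sum>i\<in>I. d i * measure (Q i) B)"
    if "A \<subseteq> B" "B \<in> sets borel" "\<And>i. 0 \<le> d i" for A B d
    using that Q fin by (intro sum_mono mult_left_mono finite_measure.finite_measure_mono) auto
  have leP: "emeasure P A \<le> emeasure WP A" if "A \<in> sets borel" for A
    using that nn[of "A \<inter> Y"] mono[of "A \<inter> Y" A cp] cp0 Yb
    by (auto simp: emP emW WP_def \<sigma>eq intro!: ennreal_leI)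
  have leN: "emeasure N A \<le> emeasure WN A" if "A \<in> sets borel" for A
    using that nn[of "A - Y"] mono[of "A - Y" A cn] cn0 Yb
    by (auto simp: emN emW WN_def \<sigma>eq intro!: ennreal_leI)
  have leP': "P \<le> WP" and leN': "N \<le> WN"
    using leP leN by (auto simp: le_measure WP_def WN_def P_def N_def le_fun_def emeasure_notin_sets)
  have bal: "emeasure P A + emeasure WN A = emeasure N A + emeasure WP A" if A: "A \<in> sets borel" for A
  proof -
    have "0 \<le> \<sigma> (A \<inter> Y)" "\<sigma> (A - Y) \<le> 0"
      using Y A unfolding hahn_set_def by auto
    moreover have "\<sigma> A = \<sigma> (A \<inter> Y) + \<sigma> (A - Y)"
      by (rule sigma_additive_split[OF \<sigma> A Yb])
    ultimately show ?thesis
      using A Yb cp0 cn0 nn[of A] \<sigma>eq[of A]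
      by (simp add: emP emN WP_def WN_def emW ennreal_plus[symmetric] del: ennreal_plus)
  qed
  have balI: "(\<integral>\<^sup>+x. f x \<partial>P) + (\<integral>\<^sup>+x. f x \<partial>WN) = (\<integral>\<^sup>+x. f x \<partial>N) + (\<integral>\<^sup>+x. f x \<partial>WP)"
    if f: "f \<in> borel_measurable borel" for f
  proof -
    \<comment> \<open>sums of two measures, indexed by the truth values\<close>
    have "weighted_sum UNIV (\<lambda>_. 1) (\<lambda>b. if b then P else WN)
        = weighted_sum UNIV (\<lambda>_. 1) (\<lambda>b. if b then N else WP)"
      by (rule measure_eqI) (simp_all add: emeasure_weighted_sum UNIV_bool WP_def WN_def bal[unfolded WP_def WN_def] add.commute)
    from arg_cong[OF this, of "\<lambda>M. \<integral>\<^sup>+x. f x \<partial>M"] show ?thesis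
      by (subst (asm) (1 2) nn_integral_weighted_sum)
         (use f in \<open>simp_all add: UNIV_bool WP_def WN_def add.commute\<close>)
  qed
  have finW_nn: "(\<integral>\<^sup>+x. ennreal (f x) \<partial>weighted_sum I d Q) = ennreal (\<Sum>i\<in>I. d i * (\<integral>x. f x \<partial>Q i))"
    if f: "f \<in> borel_measurable borel" "\<And>i. i \<in> I \<Longrightarrow> integrable (Q i) f" "\<And>x. 0 \<le> f x" "\<And>i. 0 \<le> d i"
    for f :: "real \<Rightarrow> real" and d
  proof -
    have "(\<integral>\<^sup>+x. ennreal (f x) \<partial>weighted_sum I d Q) = (\<Sum>i\<in>I. ennreal (d i * (\<integral>x. f x \<partial>Q i)))"
      using f Q by (subst nn_integral_weighted_sum) (auto simp: nn_integral_eq_ennreal_integral ennreal_mult' intro!: sum.cong)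
    also have "\<dots> = ennreal (\<Sum>i\<in>I. d i * (\<integral>x. f x \<partial>Q i))"
      using f by (intro sum_ennreal) simp
    finally show ?thesis .
  qed
  have int: "integrable P f \<and> integrable N f"
    if f: "f \<in> borel_measurable borel" "\<And>i. i \<in> I \<Longrightarrow> integrable (Q i) f"
    for f :: "real \<Rightarrow> 'c::{banach,second_countable_topology}"
  proof -
    have m: "f \<in> borel_measurable P" "f \<in> borel_measurable N"
      using f by (simp_all cong: measurable_cong_sets)
    have "(\<integral>\<^sup>+x. ennreal (norm (f x)) \<partial>P) \<le> (\<integral>\<^sup>+x. ennreal (norm (f x)) \<partial>WP)"
      by (rule nn_integral_mono_measure[OF _ leP']) (simp add: WP_def)
    also have "\<dots> < \<infinity>"
      using f cp0 unfolding WP_def by (subst finW_nn) auto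
    finally have 1: "(\<integral>\<^sup>+x. ennreal (norm (f x)) \<partial>P) < \<infinity>" .
    have "(\<integral>\<^sup>+x. ennreal (norm (f x)) \<partial>N) \<le> (\<integral>\<^sup>+x. ennreal (norm (f x)) \<partial>WN)"
      by (rule nn_integral_mono_measure[OF _ leN']) (simp add: WN_def)
    also have "\<dots> < \<infinity>"
      using f cn0 unfolding WN_def by (subst finW_nn) auto
    finally show ?thesis using 1 m by (simp add: integrable_iff_bounded)
  qed
  have pos: "(\<integral>x. f x \<partial>P) - (\<integral>x. f x \<partial>N) = (\<Sum>i\<in>I. c i * (\<integral>x. f x \<partial>Q i))"
    if f: "f \<in> borel_measurable borel" "\<And>i. i \<in> I \<Longrightarrow> integrable (Q i) f" "\<And>x. 0 \<le> f x"
    for f :: "real \<Rightarrow> real"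
  proof -
    have i: "integrable P f" "integrable N f" using int[OF f(1,2)] by auto
    have n: "0 \<le> (\<Sum>i\<in>I. cp i * (\<integral>x. f x \<partial>Q i))" "0 \<le> (\<Sum>i\<in>I. cn i * (\<integral>x. f x \<partial>Q i))"
      using f cp0 cn0 by (auto intro!: sum_nonneg mult_nonneg_nonneg)
    have n2: "0 \<le> (\<integral>x. f x \<partial>P)" "0 \<le> (\<integral>x. f x \<partial>N)" using f by auto
    have "(\<integral>x. f x \<partial>P) + (\<Sum>i\<in>I. cn i * (\<integral>x. f x \<partial>Q i))
        = (\<integral>x. f x \<partial>N) + (\<Sum>i\<in>I. cp i * (\<integral>x. f x \<partial>Q i))"
      using balI[of "\<lambda>x. ennreal (f x)"] f i cp0 cn0 n n2
      by (simp add: finW_nn WP_def WN_def nn_integral_eq_ennreal_integral ennreal_plus[symmetric] del: ennreal_plus)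
    then have "(\<integral>x. f x \<partial>P) - (\<integral>x. f x \<partial>N)
        = (\<Sum>i\<in>I. cp i * (\<integral>x. f x \<partial>Q i)) - (\<Sum>i\<in>I. cn i * (\<integral>x. f x \<partial>Q i))"
      by simp
    then show ?thesis
      unfolding sum_subtractf[symmetric] c by (simp add: left_diff_distrib)
  qed
  have all: "(\<integral>x. f x \<partial>P) - (\<integral>x. f x \<partial>N) = (\<Sum>i\<in>I. c i * (\<integral>x. f x \<partial>Q i))"
    if f: "f \<in> borel_measurable borel" "\<And>i. i \<in> I \<Longrightarrow> integrable (Q i) f"
    for f :: "real \<Rightarrow> real"
  proof -
    have i: "integrable P f" "integrable N f" using int[OF f(1,2)] by auto
    define u v where "u = (\<lambda>x. max 0 (f x))" and "v = (\<lambda>x. max 0 (- f x))"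
    have fuv: "f = (\<lambda>x. u x - v x)" by (auto simp: u_def v_def fun_eq_iff)
    have m: "u \<in> borel_measurable borel" "v \<in> borel_measurable borel"
      using f unfolding u_def v_def by measurable
    have iu: "integrable (Q i) u" "integrable (Q i) v" if "i \<in> I" for i
      using f(2)[OF that] unfolding u_def v_def by auto
    have iu2: "integrable P u" "integrable P v" "integrable N u" "integrable N v"
      using int[OF m(1)] int[OF m(2)] iu by auto
    have "(\<integral>x. f x \<partial>P) - (\<integral>x. f x \<partial>N)
        = ((\<integral>x. u x \<partial>P) - (\<integral>x. u x \<partial>N)) - ((\<integral>x. v x \<partial>P) - (\<integral>x. v x \<partial>N))"
      using iu2 unfolding fuv by simp
    also have "\<dots> = (\<Sum>i\<in>I. c i * (\<integral>x. u x \<partial>Q i)) - (\<Sum>i\<in>I. c i * (\<integral>x. v x \<partial>Q i))"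
      using pos[OF m(1) iu(1)] pos[OF m(2) iu(2)] by (simp add: u_def v_def)
    also have "\<dots> = (\<Sum>i\<in>I. c i * (\<integral>x. f x \<partial>Q i))"
      unfolding sum_subtractf[symmetric] using iu unfolding fuv
      by (intro sum.cong refl) (simp add: right_diff_distrib)
    finally show ?thesis .
  qed
  show "\<And>f :: real \<Rightarrow> 'b. f \<in> borel_measurable borel \<Longrightarrow> (\<forall>i\<in>I. integrable (Q i) f) \<Longrightarrow>
        integrable (pos_variation \<sigma>) f \<and> integrable (pos_variation (\<lambda>A. - \<sigma> A)) f"
    by (rule int[unfolded P_def N_def]) auto
  show "\<And>f :: real \<Rightarrow> real. f \<in> borel_measurable borel \<Longrightarrow> (\<forall>i\<in>I. integrable (Q i) f) \<Longrightarrow>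
        (\<integral>x. f x \<partial>pos_variation \<sigma>) - (\<integral>x. f x \<partial>pos_variation (\<lambda>A. - \<sigma> A))
          = (\<Sum>i\<in>I. c i * (\<integral>x. f x \<partial>Q i))"
    by (rule all[unfolded P_def N_def]) auto
qed

lemma sm_integral_weighted:
  fixes Q :: "'i \<Rightarrow> real measure" and f :: "real \<Rightarrow> complex"
  assumes I: "finite I" and Q: "\<And>i. i \<in> I \<Longrightarrow> sets (Q i) = sets borel"
    and fin: "\<And>i. i \<in> I \<Longrightarrow> finite_measure (Q i)"
    and f: "f \<in> borel_measurable borel" "\<And>i. i \<in> I \<Longrightarrow> integrable (Q i) f"
  shows "sm_integral (\<lambda>A. \<Sum>i\<in>I. c i * measure (Q i) A) f = (\<Sum>i\<in>I. complex_of_real (c i) * (\<integral>x. f x \<partial>Q i))"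
proof -
  define \<sigma> where "\<sigma> = (\<lambda>A. \<Sum>i\<in>I. c i * measure (Q i) A)"
  define P where "P = pos_variation \<sigma>"
  define N where "N = pos_variation (\<lambda>A. - \<sigma> A)"
  have i: "integrable P f" "integrable N f"
    using sm_integral_weighted_real(1)[of I Q f c] I Q fin f by (auto simp: P_def N_def \<sigma>_def)
  have W: "(\<integral>x. g x \<partial>P) - (\<integral>x. g x \<partial>N) = (\<Sum>i\<in>I. c i * (\<integral>x. g x \<partial>Q i))"
    if "g \<in> borel_measurable borel" "\<forall>i\<in>I. integrable (Q i) g" for g :: "real \<Rightarrow> real"
    unfolding P_def N_def \<sigma>_def by (rule sm_integral_weighted_real(2)) (use I Q fin that in auto)
  have m: "(\<lambda>x. Re (f x)) \<in> borel_measurable borel" "(\<lambda>x. Im (f x)) \<in> borel_measurable borel"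
    using f(1) by measurable
  have re: "(\<integral>x. Re (f x) \<partial>P) - (\<integral>x. Re (f x) \<partial>N) = (\<Sum>i\<in>I. c i * (\<integral>x. Re (f x) \<partial>Q i))"
    by (rule W[OF m(1)]) (use f in auto)
  have im: "(\<integral>x. Im (f x) \<partial>P) - (\<integral>x. Im (f x) \<partial>N) = (\<Sum>i\<in>I. c i * (\<integral>x. Im (f x) \<partial>Q i))"
    by (rule W[OF m(2)]) (use f in auto)
  have "(\<integral>x. f x \<partial>P) - (\<integral>x. f x \<partial>N) = (\<Sum>i\<in>I. complex_of_real (c i) * (\<integral>x. f x \<partial>Q i))"
    using re im i f by (intro complex_eqI) simp_all
  then show ?thesis unfolding sm_integral_def P_def N_def by (simp add: \<sigma>_def)
qed

lemma sm_integral_zero: "sm_integral (\<lambda>A. 0) f = 0"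
  by (simp add: sm_integral_def)

lemma cm_integral_weighted:
  fixes Q :: "'i \<Rightarrow> real measure" and f :: "real \<Rightarrow> complex"
  assumes "finite I" "\<And>i. i \<in> I \<Longrightarrow> sets (Q i) = sets borel" "\<And>i. i \<in> I \<Longrightarrow> finite_measure (Q i)"
    "f \<in> borel_measurable borel" "\<And>i. i \<in> I \<Longrightarrow> integrable (Q i) f"
  shows "cm_integral (\<lambda>A. complex_of_real (\<Sum>i\<in>I. c i * measure (Q i) A)) f
      = (\<Sum>i\<in>I. complex_of_real (c i) * (\<integral>x. f x \<partial>Q i))"
  using sm_integral_weighted[where Q = Q and c = c, OF assms]
  by (simp add: cm_integral_def sm_integral_zero)

lemma complex_measure_weighted:
  assumes "\<And>i. i \<in> I \<Longrightarrow> sets (Q i) = sets borel" "\<And>i. i \<in> I \<Longrightarrow> finite_measure (Q i)"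
  shows "complex_measure (\<lambda>A. complex_of_real (\<Sum>i\<in>I. c i * measure (Q i) A))"
proof -
  have "sigma_additive (\<lambda>A. complex_of_real (\<Sum>i\<in>I. c i * measure (Q i) A))"
    by (intro sigma_additive_bounded_linear[OF bounded_linear_of_real] sigma_additive_sum
        sigma_additive_bounded_linear[OF bounded_linear_mult_right] sigma_additive_measure assms)
  then show ?thesis
    unfolding complex_measure_def sigma_additive_def
    using assms by (auto simp: measure_notin_sets intro!: sum.neutral)
qed

text \<open>The half-lines generate the Borel sets and are closed under intersection, so Dynkin's lemma applies as soon as
the total masses agree; the line is the union of a half-line and countably many half-open intervals.  This is the
uniqueness that gives meaning to the definite description in the Stieltjes integral.\<close>

lemma complex_measure_eqI:
  assumes c: "complex_measure \<mu>" "complex_measure \<nu>" and eq: "cm_cdf \<mu> = cm_cdf \<nu>"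
  shows "\<mu> = \<nu>"
proof
  fix A
  note s = c[THEN complex_measure_sigma_additive]
  have half: "\<mu> {..x} = \<nu> {..x}" for x
    using eq by (simp add: cm_cdf_def fun_eq_iff)
  have ivl: "\<mu> {x<..y} = \<nu> {x<..y}" if "x \<le> y" for x y :: real
  proof -
    have "{..y} = {..x} \<union> {x<..y}" using that by auto
    then have "\<rho> {..y} = \<rho> {..x} + \<rho> {x<..y}" if "sigma_additive \<rho>" for \<rho> :: cmeasure
      using sigma_additive_Un[OF that, of "{..x}" "{x<..y}"] by (simp add: disjoint_iff)
    from this[OF s(1)] this[OF s(2)] half[of x] half[of y] show ?thesis by simp
  qed
  have U: "\<mu> UNIV = \<nu> UNIV"
  proof -
    define B where "B = (\<lambda>n::nat. if n = 0 then {..0::real} else {real (n-1)<..real n})"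
    have d: "disjoint_family B"
    proof -
      have "B m \<inter> B n = {}" if "m < n" for m n
        using that by (auto simp: B_def not_le of_nat_diff split: if_splits)
          (meson dual_order.strict_trans2 less_le_not_le of_nat_0_le_iff, linarith)?
      then show ?thesis
        unfolding disjoint_family_on_def by (metis inf_commute linorder_neqE_nat)
    qed
    have un: "(\<Union>n. B n) = UNIV"
    proof (intro equalityI subsetI UNIV_I)
      fix x :: real
      show "x \<in> (\<Union>n. B n)"
      proof (cases "x \<le> 0")
        case True then show ?thesis by (auto simp: B_def intro!: exI[of _ 0])
      next
        case False
        define n where "n = nat \<lceil>x\<rceil>"
        have "x \<le> real n" "real n < x + 1" "n \<noteq> 0" using False unfolding n_def by linarith+
        then have "x \<in> B n" by (auto simp: B_def of_nat_diff)
        then show ?thesis by blast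
      qed
    qed
    have e: "\<mu> (B n) = \<nu> (B n)" for n
      using ivl[of "real (n-1)" "real n"] half[of 0] by (auto simp: B_def)
    have b: "B n \<in> sets borel" for n by (simp add: B_def)
    have "(\<lambda>n. \<mu> (B n)) sums \<mu> UNIV" "(\<lambda>n. \<nu> (B n)) sums \<nu> UNIV"
      using sigma_additive_sums[OF s(1) b d] sigma_additive_sums[OF s(2) b d] un by auto
    then show ?thesis using e by (simp add: sums_iff)
  qed
  show "\<mu> A = \<nu> A"
  proof (cases "A \<in> sets borel")
    case False
    then show ?thesis using c by (simp add: complex_measure_def)
  next
    case True
    let ?G = "range (\<lambda>x::real. {..x})"
    have sb: "sets borel = sigma_sets UNIV ?G"
      by (subst borel_eq_atMost) simp
    have "Int_stable ?G"
      by (auto simp: Int_stable_def intro!: image_eqI[of _ _ "min _ _"])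
    moreover have "?G \<subseteq> Pow UNIV" by simp
    moreover have "A \<in> sigma_sets UNIV ?G" using True sb by simp
    ultimately show ?thesis
    proof (induction rule: sigma_sets_induct_disjoint)
      case (basic A) then show ?case using half by auto
    next
      case empty then show ?case using s by (simp add: sigma_additive_empty)
    next
      case (compl A)
      then have A: "A \<in> sets borel" by (simp add: sb)
      have "\<rho> UNIV = \<rho> A + \<rho> (UNIV - A)" if "sigma_additive \<rho>" for \<rho> :: cmeasure
        using sigma_additive_split[OF that, of UNIV A] A by simp
      from this[OF s(1)] this[OF s(2)] U compl show ?case by simp
    next
      case (union B)
      then have B: "B n \<in> sets borel" for n by (auto simp: sb)
      have "(\<lambda>n. \<mu> (B n)) sums \<mu> (\<Union>n. B n)" "(\<lambda>n. \<nu> (B n)) sums \<nu> (\<Union>n. B n)"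
        using sigma_additive_sums[OF s(1) B] sigma_additive_sums[OF s(2) B] union by auto
      then show ?case using union by (simp add: sums_iff)
    qed
  qed
qed

lemma stieltjes_integral_cm_cdf:
  assumes "complex_measure \<nu>"
  shows "stieltjes_integral (cm_cdf \<nu>) f = cm_integral \<nu> f"
proof -
  have "(THE \<nu>'. complex_measure \<nu>' \<and> cm_cdf \<nu>' = cm_cdf \<nu>) = \<nu>"
    using assms by (intro the_equality) (auto intro: complex_measure_eqI)
  then show ?thesis by (simp add: stieltjes_integral_def)
qed

section \<open>Purely atomic complex measures\<close>

text \<open>Along any sequence of distinct points the point masses are summable and hence tend to 0; so only finitely
many of them exceed a given positive bound.\<close>

lemma countable_atoms_complex:
  assumes "complex_measure \<kappa>"
  shows "countable (atoms \<kappa>)"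
proof -
  have fin: "finite {x. 1 / real (Suc n) < norm (\<kappa> {x})}" for n
  proof (rule ccontr)
    assume "infinite {x. 1 / real (Suc n) < norm (\<kappa> {x})}"
    then obtain f :: "nat \<Rightarrow> real" where f: "inj f" "range f \<subseteq> {x. 1 / real (Suc n) < norm (\<kappa> {x})}"
      using infinite_countable_subset by blast
    have "(\<lambda>i. \<kappa> {f i}) sums \<kappa> (\<Union>i. {f i})"
      by (rule sigma_additive_sums[OF complex_measure_sigma_additive[OF assms]])
         (use f(1) in \<open>auto simp: disjoint_family_on_def inj_def\<close>)
    then have "(\<lambda>i. \<kappa> {f i}) \<longlonglongrightarrow> 0"
      by (intro summable_LIMSEQ_zero) (simp add: sums_iff)
    then obtain i where "norm (\<kappa> {f i}) < 1 / real (Suc n)"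
      using LIMSEQ_D[of "\<lambda>i. \<kappa> {f i}" 0 "1 / real (Suc n)"] by auto
    moreover have "1 / real (Suc n) < norm (\<kappa> {f i})" using f(2) by blast
    ultimately show False by linarith
  qed
  have "atoms \<kappa> \<subseteq> (\<Union>n. {x. 1 / real (Suc n) < norm (\<kappa> {x})})"
  proof
    fix x assume "x \<in> atoms \<kappa>"
    then have "0 < norm (\<kappa> {x})" by (simp add: atoms_def)
    then obtain n where "inverse (real (Suc n)) < norm (\<kappa> {x})"
      using reals_Archimedean by blast
    then show "x \<in> (\<Union>n. {x. 1 / real (Suc n) < norm (\<kappa> {x})})" by (auto simp: inverse_eq_divide)
  qed
  then show ?thesis
    using fin by (meson countable_UN countable_finite countable_subset countableI_type)
qed

lemma sigma_additive_countable_nonneg: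
  fixes \<sigma> :: "real set \<Rightarrow> real"
  assumes \<sigma>: "sigma_additive \<sigma>" and S: "countable S" and nn: "\<And>x. x \<in> S \<Longrightarrow> 0 \<le> \<sigma> {x}"
  shows "0 \<le> \<sigma> S"
proof -
  define E where "E = (\<lambda>i. {x\<in>S. to_nat_on S x = i})"
  have E: "E i = {} \<or> (\<exists>x\<in>S. E i = {x})" for i
  proof (cases "E i = {}")
    case False
    then obtain x where x: "x \<in> S" "to_nat_on S x = i" by (auto simp: E_def)
    then have "E i = {x}" using inj_on_to_nat_on[OF S] by (auto simp: E_def inj_on_def)
    then show ?thesis using x by blast
  qed simp
  have "(\<lambda>i. \<sigma> (E i)) sums \<sigma> (\<Union>i. E i)"
  proof (rule sigma_additive_sums[OF \<sigma>])
    show "E i \<in> sets borel" for i using E[of i] by auto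
    show "disjoint_family E" by (auto simp: disjoint_family_on_def E_def)
  qed
  moreover have "(\<Union>i. E i) = S" by (auto simp: E_def)
  moreover have "0 \<le> \<sigma> (E i)" for i
    using E[of i] nn sigma_additive_empty[OF \<sigma>] by auto
  ultimately show ?thesis by (metis sums_iff suminf_nonneg)
qed

text \<open>A measure carried by a countable set is determined by its point masses, so the points of positive mass form a Hahn set.\<close>

lemma hahn_set_atomic:
  fixes \<sigma> :: "real set \<Rightarrow> real"
  assumes \<sigma>: "sigma_additive \<sigma>" and D: "countable D" and conc: "\<And>B. B \<in> sets borel \<Longrightarrow> \<sigma> B = \<sigma> (B \<inter> D)"
  shows "hahn_set \<sigma> {x\<in>D. 0 < \<sigma> {x}}"
  unfolding hahn_set_def
proof (intro conjI ballI impI)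
  have c: "countable {x\<in>D. 0 < \<sigma> {x}}" using D by (rule countable_subset[rotated]) auto
  then show "{x\<in>D. 0 < \<sigma> {x}} \<in> sets borel" by (rule sets.countable[rotated]) auto
  fix B :: "real set" assume B: "B \<in> sets borel"
  show "0 \<le> \<sigma> B" if "B \<subseteq> {x\<in>D. 0 < \<sigma> {x}}"
  proof (rule sigma_additive_countable_nonneg[OF \<sigma>])
    show "countable B" by (rule countable_subset[OF that c])
    show "0 \<le> \<sigma> {x}" if "x \<in> B" for x
      using that \<open>B \<subseteq> _\<close> by (auto intro: less_imp_le)
  qed
  show "\<sigma> B \<le> 0" if disj: "B \<inter> {x\<in>D. 0 < \<sigma> {x}} = {}"
  proof -
    have "0 \<le> - \<sigma> (B \<inter> D)"
    proof (rule sigma_additive_countable_nonneg[OF sigma_additive_uminus[OF \<sigma>]])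
      show "countable (B \<inter> D)" using D by simp
      show "0 \<le> - \<sigma> {x}" if "x \<in> B \<inter> D" for x
        using that disj by (auto simp: not_less)
    qed
    then show ?thesis using conc[OF B] by simp
  qed
qed

lemma sigma_additive_restrict:
  "sigma_additive \<sigma> \<Longrightarrow> D \<in> sets borel \<Longrightarrow> sigma_additive (\<lambda>A. \<sigma> (A \<inter> D))"
  unfolding sigma_additive_def
proof (intro allI impI)
  fix A :: "nat \<Rightarrow> real set"
  assume *: "\<forall>A::nat \<Rightarrow> real set. range A \<subseteq> sets borel \<longrightarrow> disjoint_family A \<longrightarrow> (\<lambda>i. \<sigma> (A i)) sums \<sigma> (\<Union> (range A))"
    and D: "D \<in> sets borel" and A: "range A \<subseteq> sets borel" "disjoint_family A"
  have "(\<lambda>i. \<sigma> (A i \<inter> D)) sums \<sigma> (\<Union>i. A i \<inter> D)"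
    using A D by (intro *[rule_format]) (auto simp: disjoint_family_on_def)
  then show "(\<lambda>i. \<sigma> (A i \<inter> D)) sums \<sigma> (\<Union> (range A) \<inter> D)" by simp
qed

lemma sum_variation_bounded:
  fixes \<sigma> :: "real set \<Rightarrow> real"
  assumes \<sigma>: "sigma_additive \<sigma>" and Y: "hahn_set \<sigma> Y"
  obtains C where "\<And>E :: nat \<Rightarrow> real set. range E \<subseteq> sets borel \<Longrightarrow> disjoint_family E \<Longrightarrow>
      (\<Sum>i. ennreal \<bar>\<sigma> (E i)\<bar>) \<le> ennreal C"
proof -
  have Yb: "Y \<in> sets borel" using Y by (simp add: hahn_set_def)
  have "(\<Sum>i. ennreal \<bar>\<sigma> (E i)\<bar>) \<le> ennreal (\<sigma> Y - \<sigma> (- Y))"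
    if E: "range E \<subseteq> sets borel" "disjoint_family E" for E :: "nat \<Rightarrow> real set"
  proof -
    have EY: "0 \<le> \<sigma> (E i \<inter> Y)" "\<sigma> (E i - Y) \<le> 0" for i
      using hahn_set_nonneg[OF Y, of "E i \<inter> Y"] hahn_set_nonpos[OF Y, of "E i - Y"] E Yb by auto
    define U where "U = (\<Union>i. E i)"
    have U: "U \<in> sets borel" using E by (auto simp: U_def)
    have "(\<lambda>i. \<sigma> (E i \<inter> Y)) sums \<sigma> (\<Union>i. E i \<inter> Y)"
      by (rule sigma_additive_sums[OF \<sigma>]) (use E Yb in \<open>auto simp: disjoint_family_on_def\<close>)
    moreover have "(\<lambda>i. \<sigma> (E i - Y)) sums \<sigma> (\<Union>i. E i - Y)"
      by (rule sigma_additive_sums[OF \<sigma>]) (use E Yb in \<open>auto simp: disjoint_family_on_def\<close>)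
    ultimately have s: "(\<lambda>i. \<sigma> (E i \<inter> Y) - \<sigma> (E i - Y)) sums (\<sigma> (U \<inter> Y) - \<sigma> (U - Y))"
      by (auto simp: U_def intro: sums_diff)
    have "(\<Sum>i. ennreal \<bar>\<sigma> (E i)\<bar>) \<le> (\<Sum>i. ennreal (\<sigma> (E i \<inter> Y) - \<sigma> (E i - Y)))"
    proof (intro suminf_le ennreal_leI)
      fix i
      have "\<sigma> (E i) = \<sigma> (E i \<inter> Y) + \<sigma> (E i - Y)"
        using sigma_additive_split[OF \<sigma>, of "E i" Y] E Yb by auto
      then show "\<bar>\<sigma> (E i)\<bar> \<le> \<sigma> (E i \<inter> Y) - \<sigma> (E i - Y)" using EY[of i] by linarith
    qed auto
    also have "\<dots> = ennreal (\<sigma> (U \<inter> Y) - \<sigma> (U - Y))"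
      using s EY by (subst suminf_ennreal2) (auto simp: sums_iff intro: order_trans)
    also have "\<dots> \<le> ennreal (\<sigma> Y - \<sigma> (- Y))"
    proof (rule ennreal_leI)
      have 1: "\<sigma> Y = \<sigma> (Y \<inter> U) + \<sigma> (Y - U)"
        by (rule sigma_additive_split[OF \<sigma> Yb U])
      have 2: "\<sigma> (- Y) = \<sigma> (- Y \<inter> U) + \<sigma> (- Y - U)"
        by (rule sigma_additive_split[OF \<sigma> _ U]) (use Yb in simp)
      have 3: "0 \<le> \<sigma> (Y - U)"
        by (rule hahn_set_nonneg[OF Y]) (use Yb U in auto)
      have 4: "\<sigma> (- Y - U) \<le> 0"
        by (rule hahn_set_nonpos[OF Y]) (use Yb U in auto)
      have "\<sigma> (U \<inter> Y) = \<sigma> (Y \<inter> U)" "\<sigma> (U - Y) = \<sigma> (- Y \<inter> U)"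
        by (simp_all only: Int_commute Diff_eq)
      with 1 2 3 4 show "\<sigma> (U \<inter> Y) - \<sigma> (U - Y) \<le> \<sigma> Y - \<sigma> (- Y)" by linarith
    qed
    finally show ?thesis .
  qed
  then show thesis by (rule that)
qed

text \<open>A partition of the set of atoms together with \<open>B\<close> and the remaining points partitions the line; hence
\<open>\<bar>\<kappa> B\<bar>\<close> plus the total variation on the atoms is at most the total variation on the line.  The two variations are equal,
and they are finite because the real and the imaginary part have Hahn sets on the atoms; so \<open>\<kappa> B\<close> vanishes.\<close>

lemma complex_measure_eq_0_outside_atoms:
  assumes \<kappa>: "complex_measure \<kappa>"
    and TV: "total_variation \<kappa> UNIV = total_variation \<kappa> (atoms \<kappa>)"
    and B: "B \<in> sets borel" "B \<inter> atoms \<kappa> = {}"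
  shows "\<kappa> B = 0"
proof -
  define D where "D = atoms \<kappa>"
  note sa = complex_measure_sigma_additive[OF \<kappa>]
  have Dc: "countable D" unfolding D_def by (rule countable_atoms_complex[OF \<kappa>])
  then have Db: "D \<in> sets borel" by (rule sets.countable[rotated]) auto
  have "sigma_additive (\<lambda>A. T (\<kappa> (A \<inter> D)))" if "bounded_linear T" for T :: "complex \<Rightarrow> real"
    by (rule sigma_additive_bounded_linear[OF that sigma_additive_restrict[OF sa Db]])
  from this[OF bounded_linear_Re] this[OF bounded_linear_Im]
  have s: "sigma_additive (\<lambda>A. Re (\<kappa> (A \<inter> D)))" "sigma_additive (\<lambda>A. Im (\<kappa> (A \<inter> D)))" .
  have h1: "hahn_set (\<lambda>A. Re (\<kappa> (A \<inter> D))) {x\<in>D. 0 < Re (\<kappa> ({x} \<inter> D))}"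
    by (rule hahn_set_atomic[OF s(1) Dc]) (simp add: Int_assoc)
  obtain C1 where C1: "\<And>E :: nat \<Rightarrow> real set. range E \<subseteq> sets borel \<Longrightarrow> disjoint_family E \<Longrightarrow>
      (\<Sum>i. ennreal \<bar>Re (\<kappa> (E i \<inter> D))\<bar>) \<le> ennreal C1"
    by (rule sum_variation_bounded[OF s(1) h1]) (rule that, blast)
  have h2: "hahn_set (\<lambda>A. Im (\<kappa> (A \<inter> D))) {x\<in>D. 0 < Im (\<kappa> ({x} \<inter> D))}"
    by (rule hahn_set_atomic[OF s(2) Dc]) (simp add: Int_assoc)
  obtain C2 where C2: "\<And>E :: nat \<Rightarrow> real set. range E \<subseteq> sets borel \<Longrightarrow> disjoint_family E \<Longrightarrow>
      (\<Sum>i. ennreal \<bar>Im (\<kappa> (E i \<inter> D))\<bar>) \<le> ennreal C2"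
    by (rule sum_variation_bounded[OF s(2) h2]) (rule that, blast)
  have fin: "total_variation \<kappa> D \<le> ennreal C1 + ennreal C2"
    unfolding total_variation_def
  proof (rule SUP_least)
    fix E :: "nat \<Rightarrow> real set"
    assume "E \<in> {E. range E \<subseteq> sets borel \<and> disjoint_family E \<and> \<Union> (range E) = D}"
    then have E: "range E \<subseteq> sets borel" "disjoint_family E" "\<Union> (range E) = D" by auto
    have "E i \<inter> D = E i" for i using E(3) by auto
    then have e: "(\<Sum>i. ennreal \<bar>Re (\<kappa> (E i))\<bar>) \<le> ennreal C1" "(\<Sum>i. ennreal \<bar>Im (\<kappa> (E i))\<bar>) \<le> ennreal C2"
      using C1[OF E(1,2)] C2[OF E(1,2)] by auto
    have "(\<Sum>i. ennreal (norm (\<kappa> (E i)))) \<le> (\<Sum>i. ennreal \<bar>Re (\<kappa> (E i))\<bar> + ennreal \<bar>Im (\<kappa> (E i))\<bar>)"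
      by (intro suminf_le) (auto simp: ennreal_plus[symmetric] simp del: ennreal_plus intro!: ennreal_leI cmod_le)
    also have "\<dots> = (\<Sum>i. ennreal \<bar>Re (\<kappa> (E i))\<bar>) + (\<Sum>i. ennreal \<bar>Im (\<kappa> (E i))\<bar>)"
      by (rule suminf_add[symmetric]) auto
    also have "\<dots> \<le> ennreal C1 + ennreal C2" using e by (rule add_mono)
    finally show "(\<Sum>i. ennreal (norm (\<kappa> (E i)))) \<le> ennreal C1 + ennreal C2" .
  qed
  have "ennreal (norm (\<kappa> B)) + total_variation \<kappa> D \<le> total_variation \<kappa> UNIV"
  proof -
    have "ennreal (norm (\<kappa> B)) + (\<Sum>i. ennreal (norm (\<kappa> (E i)))) \<le> total_variation \<kappa> UNIV"
      if E: "range E \<subseteq> sets borel" "disjoint_family E" "\<Union> (range E) = D" for E :: "nat \<Rightarrow> real set"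
    proof -
      \<comment> \<open>the partition \<open>E\<close> of the atoms, extended to a partition of the line that contains \<open>B\<close>\<close>
      define F where "F = (\<lambda>i. case i of 0 \<Rightarrow> B | Suc 0 \<Rightarrow> - D - B | Suc (Suc n) \<Rightarrow> E n)"
      have BD: "B \<inter> D = {}" using B(2) by (simp add: D_def)
      have ED: "E n \<subseteq> D" for n using E(3) by auto
      have "range F \<subseteq> sets borel"
        using B(1) Db E(1) by (auto simp: F_def split: nat.splits)
      moreover have "disjoint_family F"
        using E(2) ED BD unfolding disjoint_family_on_def F_def by (auto split: nat.splits) blast+
      moreover have "(\<Union>i. F i) = UNIV"
      proof -
        have "x \<in> (\<Union>i. F i)" for x
        proof -
          consider "x \<in> B" | "x \<in> - D - B" | n where "x \<in> E n" using E(3) by blast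
          then show ?thesis
          proof cases
            case 1 then have "x \<in> F 0" by (simp add: F_def) then show ?thesis by blast
          next
            case 2 then have "x \<in> F (Suc 0)" by (simp add: F_def) then show ?thesis by blast
          next
            case 3 then have "x \<in> F (Suc (Suc n))" by (simp add: F_def) then show ?thesis by blast
          qed
        qed
        then show ?thesis by blast
      qed
      ultimately have "(\<Sum>i. ennreal (norm (\<kappa> (F i)))) \<le> total_variation \<kappa> UNIV"
        unfolding total_variation_def by (intro SUP_upper) auto
      moreover have "(\<Sum>i. ennreal (norm (\<kappa> (F i)))) =
          (\<Sum>i. ennreal (norm (\<kappa> (E i)))) + (\<Sum>i<2. ennreal (norm (\<kappa> (F i))))"
        by (subst suminf_offset[of _ 2]) (auto simp: F_def numeral_2_eq_2 add.commute)
      moreover have "ennreal (norm (\<kappa> B)) \<le> (\<Sum>i<2. ennreal (norm (\<kappa> (F i))))"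
        by (simp add: numeral_2_eq_2 F_def)
      ultimately show ?thesis
        by (metis (no_types, lifting) add.commute add_left_mono order_trans)
    qed
    then have "(SUP E \<in> {E :: nat \<Rightarrow> real set. range E \<subseteq> sets borel \<and> disjoint_family E \<and> (\<Union>i. E i) = D}.
        ennreal (norm (\<kappa> B)) + (\<Sum>i. ennreal (norm (\<kappa> (E i))))) \<le> total_variation \<kappa> UNIV"
      by (intro SUP_least) auto
    moreover have "{E :: nat \<Rightarrow> real set. range E \<subseteq> sets borel \<and> disjoint_family E \<and> (\<Union>i. E i) = D} \<noteq> {}"
    proof -
      have "(\<lambda>i. if i = 0 then D else {}) \<in> {E :: nat \<Rightarrow> real set. range E \<subseteq> sets borel \<and> disjoint_family E \<and> (\<Union>i. E i) = D}"
        using Db by (auto simp: disjoint_family_on_def)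
      then show ?thesis by blast
    qed
    ultimately show ?thesis
      unfolding total_variation_def[of \<kappa> D] by (subst ennreal_SUP_add_right) auto
  qed
  then have "total_variation \<kappa> D + ennreal (norm (\<kappa> B)) \<le> total_variation \<kappa> D + 0"
    using TV by (simp add: D_def add.commute)
  moreover have "total_variation \<kappa> D \<noteq> \<infinity>"
    using fin by (auto simp: top_unique)
  ultimately have "ennreal (norm (\<kappa> B)) \<le> 0"
    unfolding ennreal_add_left_cancel_le by blast
  then show ?thesis by simp
qed

text \<open>The representing measures are the positive and the negative variations of the real and the imaginary part.\<close>

lemma cm_integral_atomic:
  assumes \<kappa>: "complex_measure \<kappa>"
    and TV: "total_variation \<kappa> UNIV = total_variation \<kappa> (atoms \<kappa>)"
  obtains P1 N1 P2 N2 :: "real measure" where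
    "\<And>M. M \<in> {P1, N1, P2, N2} \<Longrightarrow> finite_measure M \<and> sets M = sets borel \<and> (AE x in M. x \<in> atoms \<kappa>)"
    "\<And>g. cm_integral \<kappa> g = ((\<integral>x. g x \<partial>P1) - (\<integral>x. g x \<partial>N1)) + \<i> * ((\<integral>x. g x \<partial>P2) - (\<integral>x. g x \<partial>N2))"
proof -
  define D where "D = atoms \<kappa>"
  note sa = complex_measure_sigma_additive[OF \<kappa>]
  have Dc: "countable D" unfolding D_def by (rule countable_atoms_complex[OF \<kappa>])
  then have Db: "D \<in> sets borel" by (rule sets.countable[rotated]) auto
  have conc: "\<kappa> B = \<kappa> (B \<inter> D)" if "B \<in> sets borel" for B
    using sigma_additive_split[OF sa that Db] complex_measure_eq_0_outside_atoms[OF \<kappa> TV, of "B - D"] that Db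
    by (auto simp: D_def)
  have ok: "finite_measure (pos_variation (\<lambda>A. T (\<kappa> A))) \<and> sets (pos_variation (\<lambda>A. T (\<kappa> A))) = sets borel
      \<and> (AE x in pos_variation (\<lambda>A. T (\<kappa> A)). x \<in> atoms \<kappa>)"
    if "bounded_linear T" for T :: "complex \<Rightarrow> real"
  proof -
    have s: "sigma_additive (\<lambda>A. T (\<kappa> A))"
      by (rule sigma_additive_bounded_linear[OF that sa])
    have h: "hahn_set (\<lambda>A. T (\<kappa> A)) {x\<in>D. 0 < T (\<kappa> {x})}"
      using hahn_set_atomic[OF s Dc] conc by auto
    have e: "- D \<inter> {x\<in>D. 0 < T (\<kappa> {x})} = {}" by auto
    have "emeasure (pos_variation (\<lambda>A. T (\<kappa> A))) (- D) = 0"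
      using Db by (subst emeasure_pos_variation[OF s h]) (auto simp: e sigma_additive_empty[OF s])
    then have "AE x in pos_variation (\<lambda>A. T (\<kappa> A)). x \<in> D"
      using Db by (intro AE_I[of _ _ "- D"]) auto
    then show ?thesis
      using finite_measure_pos_variation[OF s h] by (simp add: D_def)
  qed
  have "bounded_linear (\<lambda>z. - Re z)" "bounded_linear (\<lambda>z. - Im z)"
    by (auto intro: bounded_linear_minus bounded_linear_Re bounded_linear_Im)
  then show thesis
    by (intro that[of "pos_variation (\<lambda>A. Re (\<kappa> A))" "pos_variation (\<lambda>A. - Re (\<kappa> A))"
          "pos_variation (\<lambda>A. Im (\<kappa> A))" "pos_variation (\<lambda>A. - Im (\<kappa> A))"])
       (auto simp: cm_integral_def sm_integral_def ok bounded_linear_Re bounded_linear_Im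
         ok[of "\<lambda>z. - Re z", simplified] ok[of "\<lambda>z. - Im z", simplified])
qed

lemma norm_geometric_sum_le:
  fixes z :: complex
  assumes "norm z = 1" "0 < d" "d \<le> norm (z - 1)"
  shows "norm (\<Sum>j=J..<n. z ^ j) \<le> 2 / d"
proof (cases "J \<le> n")
  case True
  have "(z - 1) * (\<Sum>j=J..<n. z ^ j) = z ^ n - z ^ J"
    using True by (induction n rule: dec_induct) (auto simp: algebra_simps)
  then have "norm (z - 1) * norm (\<Sum>j=J..<n. z ^ j) = norm (z ^ n - z ^ J)"
    by (metis norm_mult)
  also have "\<dots> \<le> 2"
    using norm_triangle_ineq4[of "z ^ n" "z ^ J"] assms(1) by (simp add: norm_power)
  finally have "d * norm (\<Sum>j=J..<n. z ^ j) \<le> 2"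
    using assms mult_right_mono[OF assms(3), of "norm (\<Sum>j=J..<n. z ^ j)"] by simp
  then show ?thesis using assms by (simp add: field_simps)
qed (use assms in simp)

text \<open>The sum over \<open>j\<close> is the integral of \<open>e^(it(x - y))\<close> times a geometric sum with ratio \<open>e^(i(x - y)\<rho>)\<close> against \<open>\<kappa>\<close>.
On the atoms this ratio keeps the distance \<open>d\<close> from 1, so the integrand is at most \<open>2 / d\<close> there, whatever \<open>t\<close>
and the number of terms are.\<close>

lemma sum_char_atomic_bounded:
  assumes \<kappa>: "complex_measure \<kappa>"
    and TV: "total_variation \<kappa> UNIV = total_variation \<kappa> (atoms \<kappa>)" and d: "0 < d"
  obtains C where "0 \<le> C"
    "\<And>y t J n. (\<And>x. x \<in> atoms \<kappa> \<Longrightarrow> d \<le> norm (iexp ((x - y) * \<rho>) - 1)) \<Longrightarrow>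
      norm (\<Sum>j=J..<n. iexp (- ((t + real j * \<rho>) * y)) * cm_char \<kappa> (t + real j * \<rho>)) \<le> C"
proof -
  obtain P1 N1 P2 N2 :: "real measure" where
    M: "\<And>M. M \<in> {P1, N1, P2, N2} \<Longrightarrow> finite_measure M \<and> sets M = sets borel \<and> (AE x in M. x \<in> atoms \<kappa>)"
    and I: "\<And>g. cm_integral \<kappa> g = ((\<integral>x. g x \<partial>P1) - (\<integral>x. g x \<partial>N1)) + \<i> * ((\<integral>x. g x \<partial>P2) - (\<integral>x. g x \<partial>N2))"
    using cm_integral_atomic[OF \<kappa> TV] by blast
  define C where "C = 2 / d * (measure P1 UNIV + measure N1 UNIV + measure P2 UNIV + measure N2 UNIV)"
  show thesis
  proof (rule that[of C])
    show "0 \<le> C" using d by (auto simp: C_def)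
    fix y t :: real and J n :: nat
    assume gap: "\<And>x. x \<in> atoms \<kappa> \<Longrightarrow> d \<le> norm (iexp ((x - y) * \<rho>) - 1)"
    define w where "w = (\<lambda>j x. iexp (- ((t + real j * \<rho>) * y)) * iexp ((t + real j * \<rho>) * x))"
    define g where "g = (\<lambda>x. \<Sum>j=J..<n. w j x)"
    have wm: "w j \<in> borel_measurable borel" for j unfolding w_def by measurable
    have wi: "integrable M (w j)" and gi: "integrable M g"
      and wI: "(\<integral>x. w j x \<partial>M) = iexp (- ((t + real j * \<rho>) * y)) * (\<integral>x. iexp ((t + real j * \<rho>) * x) \<partial>M)"
      if MM: "M \<in> {P1, N1, P2, N2}" for M j
    proof -
      interpret finite_measure M using M[OF MM] by simp
      have m: "w j \<in> borel_measurable M" for j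
        using wm M[OF MM] by (simp cong: measurable_cong_sets)
      show 1: "integrable M (w j)" for j
      proof (rule integrable_const_bound[where B = 1])
        have "norm (w j x) \<le> 1" for x by (simp add: w_def norm_mult)
        then show "AE x in M. norm (w j x) \<le> 1" by simp
      qed (rule m)
      show "integrable M g" unfolding g_def by (intro Bochner_Integration.integrable_sum 1)
      show "(\<integral>x. w j x \<partial>M) = iexp (- ((t + real j * \<rho>) * y)) * (\<integral>x. iexp ((t + real j * \<rho>) * x) \<partial>M)"
        unfolding w_def by simp
    qed
    have gb: "norm (g x) \<le> 2 / d" if x: "x \<in> atoms \<kappa>" for x
    proof -
      have "w j x = iexp (t * (x - y)) * iexp ((x - y) * \<rho>) ^ j" for j
      proof -
        have "iexp ((x - y) * \<rho>) ^ j = exp (of_nat j * (\<i> * complex_of_real ((x - y) * \<rho>)))"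
          by (rule exp_of_nat_mult[symmetric])
        then show ?thesis
          unfolding w_def exp_add[symmetric] by (simp add: exp_add[symmetric] algebra_simps)
      qed
      then have "g x = iexp (t * (x - y)) * (\<Sum>j=J..<n. iexp ((x - y) * \<rho>) ^ j)"
        unfolding g_def by (simp add: sum_distrib_left)
      then have "norm (g x) = norm (\<Sum>j=J..<n. iexp ((x - y) * \<rho>) ^ j)"
        by (simp add: norm_mult)
      also have "\<dots> \<le> 2 / d"
        by (rule norm_geometric_sum_le) (use d gap[OF x] in auto)
      finally show ?thesis .
    qed
    have bound: "norm (\<integral>x. g x \<partial>M) \<le> 2 / d * measure M UNIV" if MM: "M \<in> {P1, N1, P2, N2}" for M
    proof -
      interpret finite_measure M using M[OF MM] by simp
      have sp: "space M = UNIV" using M[OF MM] sets_eq_imp_space_eq[of M borel] by simp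
      have "norm (\<integral>x. g x \<partial>M) \<le> (\<integral>x. norm (g x) \<partial>M)" by (rule integral_norm_bound)
      also have "\<dots> \<le> (\<integral>x. 2 / d \<partial>M)"
      proof (rule integral_mono_AE)
        show "AE x in M. norm (g x) \<le> 2 / d" using M[OF MM] gb by auto
      qed (use gi[OF MM] in auto)
      finally show ?thesis by (simp add: sp mult.commute)
    qed
    have term_eq: "iexp (- ((t + real j * \<rho>) * y)) * cm_char \<kappa> (t + real j * \<rho>)
        = ((\<integral>x. w j x \<partial>P1) - (\<integral>x. w j x \<partial>N1)) + \<i> * ((\<integral>x. w j x \<partial>P2) - (\<integral>x. w j x \<partial>N2))" for j
      unfolding cm_char_def I
      by (subst (1 2 3 4) wI) (simp_all only: insertI1 insertI2 ring_distribs mult_ac)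
    have "(\<Sum>j=J..<n. iexp (- ((t + real j * \<rho>) * y)) * cm_char \<kappa> (t + real j * \<rho>)) = cm_integral \<kappa> g"
      unfolding term_eq I g_def using wi
      by (simp add: Bochner_Integration.integral_sum sum.distrib sum_subtractf sum_distrib_left[symmetric])
    also have "norm \<dots> \<le> (norm (\<integral>x. g x \<partial>P1) + norm (\<integral>x. g x \<partial>N1)) + (norm (\<integral>x. g x \<partial>P2) + norm (\<integral>x. g x \<partial>N2))"
      unfolding I
      by (rule norm_triangle_le, rule add_mono, rule norm_triangle_ineq4)
         (simp only: norm_mult norm_ii mult_1, rule norm_triangle_ineq4)
    also have "\<dots> \<le> C"
      using bound[of P1] bound[of N1] bound[of P2] bound[of N2] by (simp add: C_def distrib_left)
    finally show "norm (\<Sum>j=J..<n. iexp (- ((t + real j * \<rho>) * y)) * cm_char \<kappa> (t + real j * \<rho>)) \<le> C" .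
  qed
qed

section \<open>Summation by parts over the residue classes modulo a period\<close>

text \<open>Summation by parts: bounded partial sums are weighted by the increments of \<open>w\<close>.\<close>

lemma norm_sum_mult_le_variation:
  fixes s w :: "nat \<Rightarrow> complex"
  assumes S: "\<And>n. norm (\<Sum>j=J..<n. s j) \<le> B" and n: "J \<le> n"
  shows "norm (\<Sum>j=J..<n. s j * w j) \<le> B * (norm (w n) + (\<Sum>j=J..<n. norm (w (Suc j) - w j)))"
proof -
  define S where "S = (\<lambda>n. \<Sum>j=J..<n. s j)"
  have SB: "norm (S n) \<le> B" for n unfolding S_def by (rule assms)
  have "(\<Sum>j=J..<n. s j * w j) = S n * w n - (\<Sum>j=J..<n. S (Suc j) * (w (Suc j) - w j))"
    using n
  proof (induction n rule: dec_induct)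
    case (step n)
    then show ?case by (simp add: S_def algebra_simps)
  qed (simp add: S_def)
  also have "norm \<dots> \<le> norm (S n * w n) + norm (\<Sum>j=J..<n. S (Suc j) * (w (Suc j) - w j))"
    by (rule norm_triangle_ineq4)
  also have "\<dots> \<le> B * norm (w n) + (\<Sum>j=J..<n. B * norm (w (Suc j) - w j))"
  proof (rule add_mono)
    show "norm (S n * w n) \<le> B * norm (w n)"
      using SB[of n] by (simp add: norm_mult mult_right_mono)
    show "norm (\<Sum>j=J..<n. S (Suc j) * (w (Suc j) - w j)) \<le> (\<Sum>j=J..<n. B * norm (w (Suc j) - w j))"
      using SB by (intro sum_norm_le) (simp add: norm_mult mult_right_mono)
  qed
  also have "\<dots> = B * (norm (w n) + (\<Sum>j=J..<n. norm (w (Suc j) - w j)))"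
    by (simp add: distrib_left sum_distrib_left)
  finally show ?thesis .
qed

lemma sum_abs_diff_monotone_le:
  fixes b :: "nat \<Rightarrow> real"
  assumes b: "\<And>j. 0 \<le> b j" "\<And>j. b j \<le> 1" and m: "mono_on {J..} b \<or> antimono_on {J..} b" and n: "J \<le> n"
  shows "(\<Sum>j=J..<n. \<bar>b (Suc j) - b j\<bar>) \<le> 1"
proof -
  have "(\<Sum>j=J..<n. \<bar>b (Suc j) - b j\<bar>) = \<bar>b n - b J\<bar>"
    using m
  proof
    assume m: "mono_on {J..} b"
    have "(\<Sum>j=J..<n. \<bar>b (Suc j) - b j\<bar>) = (\<Sum>j=J..<n. b (Suc j) - b j)"
      using m by (intro sum.cong refl) (auto simp: monotone_on_def)
    also have "\<dots> = b n - b J" using n by (rule sum_Suc_diff')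
    also have "\<dots> = \<bar>b n - b J\<bar>" using m n by (auto simp: monotone_on_def)
    finally show ?thesis .
  next
    assume m: "antimono_on {J..} b"
    have "(\<Sum>j=J..<n. \<bar>b (Suc j) - b j\<bar>) = (\<Sum>j=J..<n. - (b (Suc j) - b j))"
      using m by (intro sum.cong refl) (auto simp: monotone_on_def)
    also have "\<dots> = - (b n - b J)" unfolding sum_negf using n by (simp add: sum_Suc_diff')
    also have "\<dots> = \<bar>b n - b J\<bar>" using m n by (auto simp: monotone_on_def)
    finally show ?thesis .
  qed
  also have "\<dots> \<le> 1" using b[of n] b[of J] by linarith
  finally show ?thesis .
qed

text \<open>The variation of a product is controlled by \<open>\<bar>\<Delta>a\<bar> \<cdot> \<bar>b\<bar> + \<bar>a\<bar> \<cdot> \<bar>\<Delta>b\<bar>\<close>; a monotone sequence in \<open>[0,1]\<close> has variation at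
most 1.  The bound does not depend on \<open>b\<close>, which is where the uniformity in the weights comes from.\<close>

lemma norm_sum_bv_monotone_le:
  fixes s a :: "nat \<Rightarrow> complex" and b :: "nat \<Rightarrow> real"
  assumes S: "\<And>n. norm (\<Sum>j=J..<n. s j) \<le> B"
    and b: "\<And>j. 0 \<le> b j" "\<And>j. b j \<le> 1" "mono_on {J..} b \<or> antimono_on {J..} b"
    and a: "\<And>j. J \<le> j \<Longrightarrow> norm (a j) \<le> \<tau>" "\<And>n. (\<Sum>j=J..<n. norm (a (Suc j) - a j)) \<le> \<tau>"
  shows "norm (\<Sum>j=J..<n. s j * (a j * complex_of_real (b j))) \<le> 3 * B * \<tau>"
proof (cases "J \<le> n")
  case True
  have B: "0 \<le> B" using S[of 0] norm_ge_zero order_trans by blast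
  have \<tau>: "0 \<le> \<tau>" using a(1)[of J] norm_ge_zero order_trans by blast
  define w where "w = (\<lambda>j. a j * complex_of_real (b j))"
  have "norm (w (Suc j) - w j) \<le> norm (a (Suc j) - a j) + \<tau> * \<bar>b (Suc j) - b j\<bar>" if "J \<le> j" for j
  proof -
    have "w (Suc j) - w j = (a (Suc j) - a j) * complex_of_real (b (Suc j))
        + a j * complex_of_real (b (Suc j) - b j)"
      by (simp add: w_def algebra_simps)
    also have "norm \<dots> \<le> norm (a (Suc j) - a j) * \<bar>b (Suc j)\<bar> + norm (a j) * \<bar>b (Suc j) - b j\<bar>"
      by (rule order_trans[OF norm_triangle_ineq]) (simp only: norm_mult norm_of_real order_refl)
    also have "\<dots> \<le> norm (a (Suc j) - a j) * 1 + \<tau> * \<bar>b (Suc j) - b j\<bar>"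
      using b a(1)[OF that] \<tau> by (intro add_mono mult_mono) auto
    finally show ?thesis by simp
  qed
  then have "(\<Sum>j=J..<n. norm (w (Suc j) - w j))
      \<le> (\<Sum>j=J..<n. norm (a (Suc j) - a j) + \<tau> * \<bar>b (Suc j) - b j\<bar>)"
    by (intro sum_mono) auto
  also have "\<dots> = (\<Sum>j=J..<n. norm (a (Suc j) - a j)) + \<tau> * (\<Sum>j=J..<n. \<bar>b (Suc j) - b j\<bar>)"
    by (simp add: sum.distrib sum_distrib_left)
  also have "\<dots> \<le> \<tau> + \<tau> * 1"
    using a(2) sum_abs_diff_monotone_le[OF b True] \<tau> by (intro add_mono mult_left_mono) auto
  finally have v: "(\<Sum>j=J..<n. norm (w (Suc j) - w j)) \<le> 2 * \<tau>" by simp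
  have wn: "norm (w n) \<le> \<tau>"
    using mult_mono[OF a(1)[OF True] b(2)[of n]] b(1)[of n] \<tau> by (simp add: w_def norm_mult)
  have "norm (\<Sum>j=J..<n. s j * w j) \<le> B * (norm (w n) + (\<Sum>j=J..<n. norm (w (Suc j) - w j)))"
    by (rule norm_sum_mult_le_variation[OF S True])
  also have "\<dots> \<le> B * (3 * \<tau>)"
    using v wn B by (intro mult_left_mono) auto
  finally show ?thesis by (simp add: w_def)
next
  case False
  have "0 \<le> B" "0 \<le> \<tau>" using S[of 0] a(1)[of J] norm_ge_zero order_trans by blast+
  then show ?thesis using False by simp
qed

lemma integral_over_periods:
  fixes f :: "real \<Rightarrow> complex"
  assumes f: "continuous_on {0..} f" and \<rho>: "0 < \<rho>" and N: "J \<le> N"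
  shows "integral {real J * \<rho>..real N * \<rho>} f = integral {0..\<rho>} (\<lambda>t. \<Sum>j=J..<N. f (t + real j * \<rho>))"
  using N
proof (induction N rule: dec_induct)
  case (step N)
  have c: "continuous_on {0..\<rho>} (\<lambda>t. f (t + real j * \<rho>))" for j
    using \<rho> by (intro continuous_on_compose2[OF f] continuous_intros) auto
  have i: "f integrable_on {real J * \<rho>..real (Suc N) * \<rho>}"
    using \<rho> by (intro integrable_continuous_real continuous_on_subset[OF f]) (auto intro: order_trans[rotated])
  have "integral {real J * \<rho>..real (Suc N) * \<rho>} f
      = integral {real J * \<rho>..real N * \<rho>} f + integral {real N * \<rho>..real (Suc N) * \<rho>} f"
    using step \<rho> i by (intro Henstock_Kurzweil_Integration.integral_combine[symmetric]) (auto intro: mult_right_mono)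
  also have "integral {real N * \<rho>..real (Suc N) * \<rho>} f = integral {0..\<rho>} (\<lambda>t. f (t + real N * \<rho>))"
    using integral_shift_Icc_real[of 0 \<rho> f "real N * \<rho>"]
    by (simp add: o_def algebra_simps)
  finally show ?case
    using step c by (simp add: integral_add integrable_continuous_real continuous_on_sum)
qed simp

text \<open>The whole periods contribute the integral over one period of the sums over the residue classes.  The incomplete
last period is bounded by the integral of the norm, that is, by sums with a single term; hence the factor 2.\<close>

lemma norm_integral_tail_le:
  fixes f :: "real \<Rightarrow> complex"
  assumes f: "continuous_on {0..} f" and \<rho>: "0 < \<rho>" and G: "G integrable_on {0..\<rho>}"
    and bd: "\<And>t J' n. t \<in> {0..\<rho>} \<Longrightarrow> J \<le> J' \<Longrightarrow> norm (\<Sum>j=J'..<n. f (t + real j * \<rho>)) \<le> G t"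
    and T: "real J * \<rho> \<le> T"
  shows "norm (integral {real J * \<rho>..T} f) \<le> 2 * integral {0..\<rho>} G"
proof -
  define N where "N = nat \<lfloor>T / \<rho>\<rfloor>"
  have T0: "0 \<le> T" using T \<rho> by (smt (verit) of_nat_0_le_iff mult_nonneg_nonneg)
  have "real N \<le> T / \<rho>" "T / \<rho> < real N + 1"
    using T0 \<rho> unfolding N_def by auto
  then have N: "real N * \<rho> \<le> T" "T \<le> real (Suc N) * \<rho>"
    using \<rho> by (auto simp: field_simps)
  have JN: "J \<le> N"
  proof -
    have "real J \<le> T / \<rho>" using T \<rho> by (simp add: field_simps)
    then show ?thesis unfolding N_def by (simp add: le_nat_floor)
  qed
  have c: "continuous_on {0..\<rho>} (\<lambda>t. f (t + real j * \<rho>))" for j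
    using \<rho> by (intro continuous_on_compose2[OF f] continuous_intros) auto
  have i: "f integrable_on {real J * \<rho>..T}" "f integrable_on {real N * \<rho>..T}"
      "f integrable_on {real N * \<rho>..real (Suc N) * \<rho>}"
    using \<rho> by (auto intro!: integrable_continuous_real continuous_on_subset[OF f] intro: order_trans[rotated])
  have n: "(\<lambda>t. norm (f t)) integrable_on {real N * \<rho>..real (Suc N) * \<rho>}"
      "(\<lambda>t. norm (f t)) integrable_on {real N * \<rho>..T}"
    using \<rho> by (auto intro!: integrable_continuous_real continuous_on_norm continuous_on_subset[OF f] intro: order_trans[rotated])
  have "integral {real J * \<rho>..T} f = integral {real J * \<rho>..real N * \<rho>} f + integral {real N * \<rho>..T} f"
    using JN N \<rho> i by (intro Henstock_Kurzweil_Integration.integral_combine[symmetric]) (auto intro: mult_right_mono)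
  also have "norm \<dots> \<le> norm (integral {real J * \<rho>..real N * \<rho>} f) + norm (integral {real N * \<rho>..T} f)"
    by (rule norm_triangle_ineq)
  also have "norm (integral {real J * \<rho>..real N * \<rho>} f) \<le> integral {0..\<rho>} G"
    unfolding integral_over_periods[OF f \<rho> JN]
    using bd by (intro integral_norm_bound_integral[OF integrable_continuous_real[OF continuous_on_sum[OF c]] G]) auto
  also have "norm (integral {real N * \<rho>..T} f) \<le> integral {real N * \<rho>..T} (\<lambda>t. norm (f t))"
    using i n by (intro integral_norm_bound_integral) auto
  also have "\<dots> \<le> integral {real N * \<rho>..real (Suc N) * \<rho>} (\<lambda>t. norm (f t))"
    using n N by (intro integral_subset_le) auto
  also have "\<dots> = integral {0..\<rho>} (\<lambda>t. norm (f (t + real N * \<rho>)))"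
    using integral_shift_Icc_real[of 0 \<rho> "\<lambda>t. norm (f t)" "real N * \<rho>"]
    by (simp add: o_def algebra_simps)
  also have "\<dots> \<le> integral {0..\<rho>} G"
    using bd[OF _ JN, of _ "Suc N"]
    by (intro integral_le[OF integrable_continuous_real[OF continuous_on_norm[OF c]] G]) auto
  finally show ?thesis by simp
qed

text \<open>Here \<open>\<tau> J t\<close> is the variation of \<open>\<psi>\<close> along the progression \<open>t + j \<rho>\<close>, \<open>j \<ge> J\<close>.  It tends to 0 with \<open>J\<close> for each
\<open>t\<close>, being the tail of a convergent series, and is dominated by \<open>V\<close>; so its integral over a period tends to 0.
It also bounds the values of \<open>\<psi>\<close> because \<open>\<psi>\<close> vanishes at infinity.\<close>

lemma tail_variation_integral:
  fixes \<psi> :: "real \<Rightarrow> complex"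
  assumes \<rho>: "0 < \<rho>" and cont: "continuous_on {real J1 * \<rho>..} \<psi>" and lim: "(\<psi> \<longlongrightarrow> 0) at_top"
    and V: "\<And>t n. t \<in> {0..\<rho>} \<Longrightarrow>
        (\<Sum>i<n. norm (\<psi> (t + real (J1 + Suc i) * \<rho>) - \<psi> (t + real (J1 + i) * \<rho>))) \<le> V"
  obtains \<tau> where "\<And>J. J1 \<le> J \<Longrightarrow> \<tau> J integrable_on {0..\<rho>}"
    "(\<lambda>J. integral {0..\<rho>} (\<tau> J)) \<longlonglongrightarrow> 0"
    "\<And>J j t. J1 \<le> J \<Longrightarrow> J \<le> j \<Longrightarrow> t \<in> {0..\<rho>} \<Longrightarrow> norm (\<psi> (t + real j * \<rho>)) \<le> \<tau> J t"
    "\<And>J J' n t. J1 \<le> J \<Longrightarrow> J \<le> J' \<Longrightarrow> t \<in> {0..\<rho>} \<Longrightarrow>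
       (\<Sum>j=J'..<n. norm (\<psi> (t + real (Suc j) * \<rho>) - \<psi> (t + real j * \<rho>))) \<le> \<tau> J t"
proof -
  define v where "v = (\<lambda>t j. norm (\<psi> (t + real (Suc j) * \<rho>) - \<psi> (t + real j * \<rho>)))"
  have v0: "0 \<le> v t j" for t j by (simp add: v_def)
  define \<tau> where "\<tau> = (\<lambda>J t. \<Sum>i. v t (J + i))"
  have \<tau>_eq: "\<tau> J t = (\<Sum>i. v t (J + i))" for J t by (simp add: \<tau>_def)
  have sm1: "summable (\<lambda>i. v t (i + J1))" if "t \<in> {0..\<rho>}" for t
  proof (rule bounded_imp_summable[where B = V])
    fix n
    show "(\<Sum>i\<le>n. v t (i + J1)) \<le> V"
      using V[OF that, of "Suc n"]
      by (simp only: v_def lessThan_Suc_atMost add.commute[of _ J1] add_Suc_right)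
  qed (rule v0)
  have sm0: "summable (v t)" if "t \<in> {0..\<rho>}" for t
    using sm1[OF that] by (simp only: summable_iff_shift)
  have sm: "summable (\<lambda>i. v t (J + i))" if "t \<in> {0..\<rho>}" for t J
    using sm0[OF that] summable_iff_shift[of "v t" J] by (simp add: add.commute)
  have part: "(\<Sum>j=J'..<n. v t j) \<le> \<tau> J t" if "J \<le> J'" "t \<in> {0..\<rho>}" for J J' n t
  proof -
    have "(\<Sum>j=J'..<n. v t j) \<le> (\<Sum>j=J..<J+n. v t j)"
      using that v0 by (intro sum_mono2) auto
    also have "\<dots> = (\<Sum>i<n. v t (J + i))"
      by (simp add: sum.atLeastLessThan_shift_0[of _ J "J+n"] lessThan_atLeast0)
    also have "\<dots> \<le> \<tau> J t"
      unfolding \<tau>_def using sm[OF that(2)] v0 by (intro sum_le_suminf) auto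
    finally show ?thesis .
  qed
  have cv: "continuous_on {0..\<rho>} (\<lambda>t. v t j)" if "J1 \<le> j" for j
  proof -
    have ge: "real J1 * \<rho> \<le> x + real j * \<rho>" "real J1 * \<rho> \<le> x + real (Suc j) * \<rho>" if "0 \<le> x" for x
    proof -
      have "real J1 * \<rho> \<le> real j * \<rho>" using \<open>J1 \<le> j\<close> \<rho> by (intro mult_right_mono) auto
      moreover have "real (Suc j) * \<rho> = real j * \<rho> + \<rho>" by (simp add: algebra_simps)
      ultimately show "real J1 * \<rho> \<le> x + real j * \<rho>" "real J1 * \<rho> \<le> x + real (Suc j) * \<rho>"
        using that \<rho> by linarith+
    qed
    have im: "(\<lambda>t. t + real j * \<rho>) ` {0..\<rho>} \<subseteq> {real J1 * \<rho>..}"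
        "(\<lambda>t. t + real (Suc j) * \<rho>) ` {0..\<rho>} \<subseteq> {real J1 * \<rho>..}"
      using ge by (fastforce simp del: of_nat_Suc)+
    show ?thesis
      unfolding v_def by (intro continuous_intros continuous_on_compose2[OF cont _ im(1)]
          continuous_on_compose2[OF cont _ im(2)])
  qed
  have \<tau>le: "\<tau> J t \<le> \<tau> J1 t" if "J1 \<le> J" "t \<in> {0..\<rho>}" for J t
  proof -
    have "(\<Sum>i<n. v t (J + i)) \<le> \<tau> J1 t" for n
      using part[OF that(1,2), of "J + n"]
      by (simp add: sum.atLeastLessThan_shift_0[of _ J "J+n"] lessThan_atLeast0)
    then show ?thesis unfolding \<tau>_eq[of J] using sm[OF that(2)]
      by (intro suminf_le_const) auto
  qed
  have \<tau>0: "0 \<le> \<tau> J t" if "t \<in> {0..\<rho>}" for J t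
    unfolding \<tau>_def using sm[OF that] v0 by (intro suminf_nonneg)
  have \<tau>V: "\<tau> J1 t \<le> V" if "t \<in> {0..\<rho>}" for t
    unfolding \<tau>_def using V[OF that] sm[OF that]
    by (intro suminf_le_const) (auto simp: v_def simp del: of_nat_Suc of_nat_add)
  have lim\<tau>: "(\<lambda>J. \<tau> J t) \<longlonglongrightarrow> 0" if "t \<in> {0..\<rho>}" for t
  proof -
    have "(\<lambda>J. (\<Sum>i. v t (i + J))) \<longlonglongrightarrow> 0"
      by (rule suminf_exist_split2[OF sm0[OF that]])
    then show ?thesis by (simp add: \<tau>_def add.commute)
  qed
  have int: "\<tau> J integrable_on {0..\<rho>}" if "J1 \<le> J" for J
  proof (rule dominated_convergence(1))
    show "(\<lambda>t. \<Sum>i<n. v t (J + i)) integrable_on {0..\<rho>}" for n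
      using that by (intro integrable_continuous_real continuous_on_sum cv) auto
    show "(\<lambda>_. V) integrable_on {0..\<rho>}" by (rule integrable_const_ivl)
    show "norm (\<Sum>i<n. v t (J + i)) \<le> V" if "t \<in> {0..\<rho>}" for n t
    proof -
      have "(\<Sum>i<n. v t (J + i)) \<le> V"
        using part[OF \<open>J1 \<le> J\<close> that, of "J + n"] \<tau>V[OF that]
        by (simp add: sum.atLeastLessThan_shift_0[of _ J "J+n"] lessThan_atLeast0)
      then show ?thesis using v0 by (simp add: sum_nonneg)
    qed
    show "(\<lambda>n. \<Sum>i<n. v t (J + i)) \<longlonglongrightarrow> \<tau> J t" if "t \<in> {0..\<rho>}" for t
      unfolding \<tau>_def using sm[OF that] by (rule summable_LIMSEQ)
  qed
  show thesis
  proof (rule that[of \<tau>])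
    show "\<And>J. J1 \<le> J \<Longrightarrow> \<tau> J integrable_on {0..\<rho>}" by (rule int)
    have "(\<lambda>k. integral {0..\<rho>} (\<tau> (k + J1))) \<longlonglongrightarrow> integral {0..\<rho>} (\<lambda>t. 0 :: real)"
    proof (rule dominated_convergence(2))
      show "\<tau> (k + J1) integrable_on {0..\<rho>}" for k by (rule int) simp
      show "(\<lambda>_. V) integrable_on {0..\<rho>}" by (rule integrable_const_ivl)
      show "norm (\<tau> (k + J1) t) \<le> V" if "t \<in> {0..\<rho>}" for k t
        using \<tau>0[OF that, of "k + J1"] \<tau>le[of "k + J1", OF _ that] \<tau>V[OF that] by simp
      show "(\<lambda>k. \<tau> (k + J1) t) \<longlonglongrightarrow> 0" if "t \<in> {0..\<rho>}" for t
        using lim\<tau>[OF that] by (rule LIMSEQ_ignore_initial_segment)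
    qed
    then show "(\<lambda>J. integral {0..\<rho>} (\<tau> J)) \<longlonglongrightarrow> 0"
      using LIMSEQ_offset[of "\<lambda>J. integral {0..\<rho>} (\<tau> J)" J1 0] by simp
    show "(\<Sum>j=J'..<n. norm (\<psi> (t + real (Suc j) * \<rho>) - \<psi> (t + real j * \<rho>))) \<le> \<tau> J t"
      if "J1 \<le> J" "J \<le> J'" "t \<in> {0..\<rho>}" for J J' n t
      using part[OF that(2,3), of n] by (simp only: v_def)
    show "norm (\<psi> (t + real j * \<rho>)) \<le> \<tau> J t" if "J1 \<le> J" "J \<le> j" "t \<in> {0..\<rho>}" for J j t
    proof -
      have "filterlim (\<lambda>n. t + real n * \<rho>) at_top sequentially"
        using \<rho> by (intro filterlim_tendsto_add_at_top[OF tendsto_const]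
            filterlim_at_top_mult_tendsto_pos[OF tendsto_const] filterlim_real_sequentially)
      then have "(\<lambda>n. \<psi> (t + real n * \<rho>)) \<longlonglongrightarrow> 0"
        using lim filterlim_compose by blast
      then have "(\<lambda>n. norm (\<psi> (t + real n * \<rho>) - \<psi> (t + real j * \<rho>))) \<longlonglongrightarrow> norm (0 - \<psi> (t + real j * \<rho>))"
        by (intro tendsto_intros)
      moreover have "\<forall>\<^sub>F n in sequentially. norm (\<psi> (t + real n * \<rho>) - \<psi> (t + real j * \<rho>)) \<le> \<tau> J t"
        using eventually_ge_at_top[of j]
      proof eventually_elim
        case (elim n)
        have "\<psi> (t + real n * \<rho>) - \<psi> (t + real j * \<rho>)
            = (\<Sum>i=j..<n. \<psi> (t + real (Suc i) * \<rho>) - \<psi> (t + real i * \<rho>))"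
          using sum_Suc_diff'[OF elim, of "\<lambda>i. \<psi> (t + real i * \<rho>)"] by simp
        also have "norm \<dots> \<le> (\<Sum>i=j..<n. v t i)"
          unfolding v_def by (rule norm_sum)
        also have "\<dots> \<le> \<tau> J t" by (rule part[OF that(2,3)])
        finally show ?case .
      qed
      ultimately have "norm (0 - \<psi> (t + real j * \<rho>)) \<le> \<tau> J t"
        by (rule tendsto_upperbound) simp
      then show ?thesis by simp
    qed
  qed
qed

section \<open>Inversion of characteristic functions on intervals\<close>

text \<open>For \<open>\<Phi> (-t) = cnj (\<Phi> t)\<close> this is the symmetric inversion integral \<open>1 / (2 \<pi>) \<integral> e^(-ity) \<Phi>(t) dt\<close> over
\<open>[-T, T]\<close>; only nonnegative arguments of \<open>\<Phi>\<close> occur in it.\<close>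

definition fourier_partial :: "(real \<Rightarrow> complex) \<Rightarrow> real \<Rightarrow> real \<Rightarrow> real" where
  "fourier_partial \<Phi> T y = Re (integral {0..T} (\<lambda>t. iexp (- (t * y)) * \<Phi> t)) / pi"

lemma continuous_on_char_real:
  assumes "real_distribution M"
  shows "continuous_on A (char M)"
  using real_distribution.isCont_char[OF assms] continuous_at_imp_continuous_on by blast

lemma char_uminus_eq_cnj:
  assumes "real_distribution M"
  shows "char M (- t) = cnj (char M t)"
proof -
  interpret real_distribution M by fact
  have "cnj (char M t) = (\<integral>x. cnj (iexp (t * x)) \<partial>M)"
    unfolding char_def
    by (rule integral_bounded_linear[OF bounded_linear_cnj, symmetric]) (auto intro!: integrable_iexp)
  also have "\<dots> = char M (- t)"
    unfolding char_def by (simp add: exp_cnj)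
  finally show ?thesis by simp
qed

lemma fourier_partial_symmetric:
  fixes \<Phi> :: "real \<Rightarrow> complex"
  assumes c: "continuous_on UNIV \<Phi>" and h: "\<And>t. \<Phi> (- t) = cnj (\<Phi> t)" and T: "0 \<le> T"
  shows "integral {-T..T} (\<lambda>t. iexp (- (t * y)) * \<Phi> t) = complex_of_real (2 * pi * fourier_partial \<Phi> T y)"
proof -
  define f where "f = (\<lambda>t. iexp (- (t * y)) * \<Phi> t)"
  have cf: "continuous_on A f" for A
    unfolding f_def by (intro continuous_intros continuous_on_subset[OF c]) auto
  have fm: "f (- t) = cnj (f t)" for t
    unfolding f_def by (simp add: h exp_cnj)
  have i: "f integrable_on {a..b}" for a b by (intro integrable_continuous_real cf)
  have "integral {-T..T} f = integral {-T..0} f + integral {0..T} f"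
    using T by (intro Henstock_Kurzweil_Integration.integral_combine[symmetric] i) auto
  also have "integral {-T..0} f = integral {0..T} (\<lambda>t. f (- t))"
    using Henstock_Kurzweil_Integration.integral_reflect_real[of T 0 "\<lambda>t. f (- t)"] by simp
  also have "\<dots> = cnj (integral {0..T} f)"
    unfolding fm by (rule integral_cnj[symmetric])
  also have "\<dots> + integral {0..T} f = complex_of_real (2 * Re (integral {0..T} f))"
    by (simp add: complex_eq_iff)
  finally show ?thesis by (simp add: fourier_partial_def f_def)
qed

lemma continuous_fourier_partial:
  fixes \<Phi> :: "real \<Rightarrow> complex"
  assumes c: "continuous_on UNIV \<Phi>"
  shows "continuous_on A (fourier_partial \<Phi> T)"
proof -
  have "continuous_on (UNIV :: real set) (\<lambda>y. integral (cbox 0 T) (\<lambda>t. iexp (- (t * y)) * \<Phi> t))"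
  proof (rule integral_continuous_on_param)
    show "continuous_on (UNIV \<times> cbox 0 T) (\<lambda>(y, t). iexp (- (t * y)) * \<Phi> t)"
      unfolding case_prod_beta
      by (intro continuous_intros continuous_on_compose2[OF c]) auto
  qed
  then have "continuous_on UNIV (fourier_partial \<Phi> T)"
    unfolding fourier_partial_def cbox_interval[symmetric]
    by (intro continuous_intros) (auto simp: o_def)
  then show ?thesis by (rule continuous_on_subset) simp
qed

lemma integral_iexp_interval:
  fixes t :: real
  assumes "a \<le> b" "t \<noteq> 0"
  shows "integral {a..b} (\<lambda>y. iexp (- (t * y))) = (iexp (- (t * a)) - iexp (- (t * b))) / (\<i> * t)"
proof -
  have "((\<lambda>y. iexp (- (t * y))) has_integral
      ((- (iexp (- (t * b)) / (\<i> * t))) - (- (iexp (- (t * a)) / (\<i> * t))))) {a..b}"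
  proof (rule fundamental_theorem_of_calculus[OF assms(1)])
    fix y assume "y \<in> {a..b}"
    have "((\<lambda>z. exp (- (\<i> * t) * z)) has_field_derivative (- (\<i> * t)) * exp (- (\<i> * t) * y)) (at (of_real y))"
      by (auto intro!: derivative_eq_intros)
    from has_vector_derivative_real_field[OF this, of "{a..b}"]
    have "((\<lambda>y. iexp (- (t * y))) has_vector_derivative (- (\<i> * t)) * iexp (- (t * y))) (at y within {a..b})"
      by (simp add: mult_ac)
    then have "((\<lambda>y. - (1 / (\<i> * t)) * iexp (- (t * y))) has_vector_derivative
        - (1 / (\<i> * t)) * ((- (\<i> * t)) * iexp (- (t * y)))) (at y within {a..b})"
      by (rule has_vector_derivative_mult_right)
    then show "((\<lambda>y. - (iexp (- (t * y)) / (\<i> * t))) has_vector_derivative iexp (- (t * y))) (at y within {a..b})"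
      using assms(2) by simp
  qed
  then show ?thesis by (simp add: integral_unique diff_divide_distrib)
qed

text \<open>Levy's inversion formula with the kernel \<open>(e^(-ita) - e^(-itb)) / (it)\<close> written as an integral over \<open>[a, b]\<close> and
the order of integration exchanged.\<close>

lemma fourier_inversion_interval:
  assumes M: "real_distribution M" and ab: "a \<le> b"
    and at: "measure M {a} = 0" "measure M {b} = 0"
  shows "(\<lambda>n. integral {a..b} (fourier_partial (char M) (real n))) \<longlonglongrightarrow> measure M {a<..b}"
proof -
  interpret real_distribution M by fact
  note c = continuous_on_char_real[OF M]
  have eq: "1 / (2 * pi) * (CLBINT t=-real n..real n. (iexp (-(t * a)) - iexp (-(t * b))) / (\<i> * t) * char M t)
      = complex_of_real (integral {a..b} (fourier_partial (char M) (real n)))" for n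
  proof -
    define T where "T = real n"
    have T: "0 \<le> T" by (simp add: T_def)
    define K where "K = (\<lambda>t. integral {a..b} (\<lambda>y. iexp (- (t * y)) * char M t))"
    have K: "K t = (iexp (-(t * a)) - iexp (-(t * b))) / (\<i> * t) * char M t" if "t \<noteq> 0" for t
      unfolding K_def using integral_iexp_interval[OF ab that] by simp
    have c2: "continuous_on (cbox (-T, a) (T, b)) (\<lambda>(t, y). iexp (- (t * y)) * char M t)"
      unfolding case_prod_beta
      by (intro continuous_intros continuous_on_compose2[OF c[of UNIV]]) auto
    have cK: "continuous_on {-T..T} K"
      unfolding K_def cbox_interval[symmetric]
    proof (rule integral_continuous_on_param)
      show "continuous_on (cbox (-T) T \<times> cbox a b) (\<lambda>(t, y). iexp (- (t * y)) * char M t)"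
        using c2 by (simp add: cbox_Pair_eq)
    qed
    have "(CLBINT t=-T..T. (iexp (-(t * a)) - iexp (-(t * b))) / (\<i> * t) * char M t) = (CLBINT t=-T..T. K t)"
      using K by (intro interval_integral_discrete_difference[of "{0}"]) auto
    also have "\<dots> = integral {-T..T} K"
      using T cK by (intro interval_integral_eq_integral borel_integrable_atLeastAtMost') auto
    also have "\<dots> = integral {a..b} (\<lambda>y. integral {-T..T} (\<lambda>t. iexp (- (t * y)) * char M t))"
      unfolding K_def using integral_swap_continuous[OF c2] by simp
    also have "\<dots> = integral {a..b} (\<lambda>y. complex_of_real (2 * pi * fourier_partial (char M) T y))"
      using fourier_partial_symmetric[OF c char_uminus_eq_cnj[OF M] T] by simp
    also have "\<dots> = complex_of_real (integral {a..b} (\<lambda>y. 2 * pi * fourier_partial (char M) T y))"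
      using integral_linear[OF _ bounded_linear_of_real[where 'a = complex], of "\<lambda>y. 2 * pi * fourier_partial (char M) T y" "{a..b}"]
      by (simp add: o_def integrable_continuous_real continuous_intros continuous_fourier_partial[OF c])
    also have "\<dots> = complex_of_real (2 * pi * integral {a..b} (fourier_partial (char M) T))"
      by simp
    finally show ?thesis unfolding T_def[symmetric] by simp
  qed
  have "(\<lambda>n. 1 / (2 * pi) * (CLBINT t=-real n..real n. (iexp (-(t * a)) - iexp (-(t * b))) / (\<i> * t) * char M t))
      \<longlonglongrightarrow> complex_of_real (measure M {a<..b})"
    using Levy_Inversion[OF ab at] by simp
  then show ?thesis unfolding eq by (simp add: tendsto_of_real_iff)
qed

lemma measure_interval_le_of_fourier_bound:
  assumes M: "real_distribution M" and ab: "a \<le> b"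
    and at: "measure M {a} = 0" "measure M {b} = 0"
    and C: "\<And>n y. y \<in> {a..b} \<Longrightarrow> \<bar>fourier_partial (char M) (real n) y\<bar> \<le> C"
  shows "measure M {a<..b} \<le> C * (b - a)"
proof (rule tendsto_upperbound[OF fourier_inversion_interval[OF M ab at]])
  show "\<forall>\<^sub>F n in sequentially. integral {a..b} (fourier_partial (char M) (real n)) \<le> C * (b - a)"
  proof (rule always_eventually, rule allI)
    fix n
    have "integral {a..b} (fourier_partial (char M) (real n)) \<le> integral {a..b} (\<lambda>y. C)"
      using C by (intro integral_le integrable_continuous_real continuous_fourier_partial
          continuous_on_char_real[OF M] continuous_on_const) (auto simp: abs_le_iff)
    then show "integral {a..b} (fourier_partial (char M) (real n)) \<le> C * (b - a)"
      using ab by (simp add: mult.commute)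
  qed
qed simp

lemma measure_interval_eq_of_fourier_uniform_limit:
  assumes M: "real_distribution M" and ab: "a \<le> b"
    and at: "measure M {a} = 0" "measure M {b} = 0"
    and u: "uniform_limit {a..b} (\<lambda>n. fourier_partial (char M) (real n)) G sequentially"
  shows "measure M {a<..b} = integral {a..b} G"
proof -
  have "continuous_on {a..b} (fourier_partial (char M) (real n))" for n
    by (intro continuous_fourier_partial continuous_on_char_real[OF M])
  then obtain I J where I: "\<And>n. ((fourier_partial (char M) (real n)) has_integral I n) {a..b}"
    and J: "(G has_integral J) {a..b}" "I \<longlonglongrightarrow> J"
    using uniform_limit_integral[OF u] by auto
  have "I = (\<lambda>n. integral {a..b} (fourier_partial (char M) (real n)))" "J = integral {a..b} G"
    using integral_unique[OF I] integral_unique[OF J(1)] by (simp_all add: fun_eq_iff)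
  then show ?thesis
    using J(2) fourier_inversion_interval[OF M ab at] LIMSEQ_unique by blast
qed

section \<open>Convolution powers and the deconvolution kernel\<close>

lemma real_distribution_convolution:
  assumes "real_distribution M" "real_distribution N"
  shows "real_distribution (convolution M N)"
proof -
  interpret M: real_distribution M by fact
  interpret N: real_distribution N by fact
  interpret pair_prob_space M N ..
  have "prob_space (convolution M N)"
    unfolding convolution_def by (rule prob_space_distr) simp
  then show ?thesis
    by (simp add: real_distribution_def real_distribution_axioms_def)
qed

lemma integral_convolution:
  fixes f :: "real \<Rightarrow> complex"
  assumes M: "real_distribution M" and N: "real_distribution N"
    and f: "f \<in> borel_measurable borel" "\<And>x. norm (f x) \<le> B"
  shows "(\<integral>x. f x \<partial>convolution M N) = (\<integral>x. \<integral>y. f (x + y) \<partial>N \<partial>M)"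
proof -
  interpret M: real_distribution M by fact
  interpret N: real_distribution N by fact
  interpret P: pair_prob_space M N ..
  have m: "(\<lambda>p. f (fst p + snd p)) \<in> borel_measurable (M \<Otimes>\<^sub>M N)"
    by (rule measurable_compose[OF _ f(1)]) simp
  have "(\<integral>x. f x \<partial>convolution M N) = (\<integral>p. f (fst p + snd p) \<partial>(M \<Otimes>\<^sub>M N))"
    unfolding convolution_def using f(1) by (subst integral_distr) (auto simp: case_prod_beta)
  also have "\<dots> = (\<integral>x. \<integral>y. f (x + y) \<partial>N \<partial>M)"
  proof -
    have "integrable (M \<Otimes>\<^sub>M N) (\<lambda>p. f (fst p + snd p))"
      using m f(2) by (intro P.integrable_const_bound[where B = B]) auto
    from P.integral_fst'[OF this] show ?thesis by simp
  qed
  finally show ?thesis .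
qed

lemma char_convolution:
  assumes M: "real_distribution M" and N: "real_distribution N"
  shows "char (convolution M N) t = char M t * char N t"
proof -
  have "char (convolution M N) t = (\<integral>x. \<integral>y. iexp (t * (x + y)) \<partial>N \<partial>M)"
    unfolding char_def by (rule integral_convolution[OF M N, where B = 1]) auto
  also have "\<dots> = (\<integral>x. \<integral>y. iexp (t * x) * iexp (t * y) \<partial>N \<partial>M)"
    by (simp add: exp_add[symmetric] algebra_simps)
  also have "\<dots> = char M t * char N t"
    unfolding char_def by simp
  finally show ?thesis .
qed

text \<open>The convolution of complex measures integrates translates of its first argument, while the convolution of measures
is the image of the product measure; this identifies the two.\<close>

lemma measure_convolution:
  assumes M: "real_distribution M" and N: "real_distribution N" and A: "A \<in> sets borel"
  shows "(\<lambda>x. measure M {y. x + y \<in> A}) \<in> borel_measurable borel"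
    and "measure (convolution M N) A = (\<integral>x. measure M {y. x + y \<in> A} \<partial>N)"
proof -
  interpret M: real_distribution M by fact
  interpret N: real_distribution N by fact
  have Q: "{p \<in> space (borel \<Otimes>\<^sub>M M). fst p + snd p \<in> A} \<in> sets ((borel :: real measure) \<Otimes>\<^sub>M M)"
    using A by measurable
  have "(\<lambda>x. emeasure M (Pair x -` {p \<in> space (borel \<Otimes>\<^sub>M M). fst p + snd p \<in> A})) \<in> borel_measurable borel"
    by (rule M.measurable_emeasure_Pair[OF Q])
  then have m: "(\<lambda>x. emeasure M {y. x + y \<in> A}) \<in> borel_measurable borel"
    by (simp add: space_pair_measure vimage_def)
  then show m': "(\<lambda>x. measure M {y. x + y \<in> A}) \<in> borel_measurable borel"
    unfolding measure_def by simp
  have "emeasure (convolution M N) A = emeasure (convolution N M) A"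
    by (subst convolution_commutative) (auto simp: M.finite_measure_axioms N.finite_measure_axioms)
  also have "\<dots> = (\<integral>\<^sup>+x. emeasure M {a. a + x \<in> A} \<partial>N)"
    using A by (intro convolution_emeasure) (auto simp: M.finite_measure_axioms N.finite_measure_axioms)
  also have "\<dots> = (\<integral>\<^sup>+x. ennreal (measure M {y. x + y \<in> A}) \<partial>N)"
    by (simp add: M.emeasure_eq_measure add.commute)
  finally have "measure (convolution M N) A = enn2real (\<integral>\<^sup>+x. ennreal (measure M {y. x + y \<in> A}) \<partial>N)"
    by (simp add: measure_def)
  also have "\<dots> = (\<integral>x. measure M {y. x + y \<in> A} \<partial>N)"
    using m' by (intro integral_eq_nn_integral[symmetric]) (simp_all cong: measurable_cong_sets)
  finally show "measure (convolution M N) A = (\<integral>x. measure M {y. x + y \<in> A} \<partial>N)" .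
qed

primrec conv_power :: "real measure \<Rightarrow> nat \<Rightarrow> real measure" where
  "conv_power M 0 = return borel 0"
| "conv_power M (Suc k) = convolution M (conv_power M k)"

lemma real_distribution_return: "real_distribution (return borel (x :: real))"
  by (simp add: real_distribution_def real_distribution_axioms_def prob_space_return)

lemma real_distribution_conv_power:
  "real_distribution M \<Longrightarrow> real_distribution (conv_power M k)"
  by (induction k) (simp_all add: real_distribution_return real_distribution_convolution)

lemma char_conv_power:
  assumes "real_distribution M"
  shows "char (conv_power M k) t = char M t ^ k"
proof (induction k)
  case 0
  then show ?case by (simp add: char_def integral_return)
next
  case (Suc k)
  then show ?case
    using assms by (simp add: char_convolution real_distribution_conv_power)
qed

text \<open>The \<open>l\<close>-th power of the operator that subtracts from a sequence its shift, evaluated at index 0; with \<open>a k\<close> the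
\<open>k\<close>-th convolution power of \<open>M\<close> it is the \<open>l\<close>-th power of \<open>\<delta>\<^sub>0 - M\<close>.\<close>

definition alternating_sum :: "nat \<Rightarrow> (nat \<Rightarrow> real) \<Rightarrow> real" where
  "alternating_sum l a = (\<Sum>k\<le>l. ((-1) ^ k * real (l choose k)) * a k)"

lemma alternating_sum_diff:
  "alternating_sum l (\<lambda>k. a k - b k) = alternating_sum l a - alternating_sum l b"
  by (simp add: alternating_sum_def right_diff_distrib sum_subtractf)

lemma alternating_sum_Suc:
  "alternating_sum (Suc l) a = alternating_sum l a - alternating_sum l (\<lambda>k. a (Suc k))"
proof -
  have "alternating_sum (Suc l) a
      = a 0 + (\<Sum>k\<le>l. ((-1) ^ Suc k * real (Suc l choose Suc k)) * a (Suc k))"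
    unfolding alternating_sum_def by (subst sum.atMost_Suc_shift) simp
  also have "\<dots> = a 0 + (\<Sum>k\<le>l. ((-1) ^ Suc k * real (l choose Suc k)) * a (Suc k))
      - alternating_sum l (\<lambda>k. a (Suc k))"
    unfolding alternating_sum_def add_diff_eq[symmetric] sum_subtractf[symmetric]
    by (intro arg_cong2[where f = "(+)"] sum.cong refl) (simp add: algebra_simps)
  also have "a 0 + (\<Sum>k\<le>l. ((-1) ^ Suc k * real (l choose Suc k)) * a (Suc k))
      = (\<Sum>k\<le>Suc l. ((-1) ^ k * real (l choose k)) * a k)"
    by (subst sum.atMost_Suc_shift) simp
  also have "\<dots> = alternating_sum l a"
    by (simp add: alternating_sum_def)
  finally show ?thesis .
qed

lemma alternating_sum_power: "alternating_sum l (\<lambda>k. q ^ k) = (1 - q) ^ l"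
proof (induction l)
  case (Suc l)
  have "alternating_sum l (\<lambda>k. q ^ Suc k) = q * alternating_sum l (\<lambda>k. q ^ k)"
    by (simp add: alternating_sum_def sum_distrib_left mult_ac)
  then show ?case by (simp add: alternating_sum_Suc Suc algebra_simps)
qed (simp add: alternating_sum_def)

text \<open>The geometric series of the deconvolution kernel in telescoped form: multiplying the kernel by \<open>M\<close>, which
shifts the index, leaves the unit minus the next power of \<open>\<delta>\<^sub>0 - M\<close>.\<close>

lemma sum_alternating_sum_shift:
  "(\<Sum>l\<le>m. alternating_sum l (\<lambda>k. a (Suc k))) = a 0 - alternating_sum (Suc m) a"
proof -
  have "(\<Sum>l\<le>m. alternating_sum l (\<lambda>k. a (Suc k)))
      = (\<Sum>l\<le>m. alternating_sum l a - alternating_sum (Suc l) a)"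
    by (simp add: alternating_sum_Suc)
  also have "\<dots> = alternating_sum 0 a - alternating_sum (Suc m) a"
    by (rule sum_telescope)
  finally show ?thesis by (simp add: alternating_sum_def)
qed

lemma cm_power_deconv_pi:
  assumes M: "real_distribution M"
  shows "cm_power (deconv_pi M) l
    = (\<lambda>A. complex_of_real (alternating_sum l (\<lambda>k. measure (conv_power M k) A)))"
proof (induction l)
  case 0
  then show ?case by (simp add: alternating_sum_def cm_of_def)
next
  case (Suc l)
  show ?case
  proof
    fix A :: "real set"
    have d: "real_distribution (conv_power M k)" for k
      by (rule real_distribution_conv_power[OF M])
    interpret M: real_distribution M by fact
    show "cm_power (deconv_pi M) (Suc l) A
        = complex_of_real (alternating_sum (Suc l) (\<lambda>k. measure (conv_power M k) A))"
    proof (cases "A \<in> sets borel")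
      case False
      then have "measure (conv_power M k) A = 0" for k
        using real_distribution.events_eq_borel[OF d] by (intro measure_notin_sets) simp
      then show ?thesis using False by (simp add: cm_convolution_def alternating_sum_def)
    next
      case True
      define f where "f = (\<lambda>x. deconv_pi M {y. x + y \<in> A})"
      have f: "f x = complex_of_real (indicator A x - measure M {y. x + y \<in> A})" for x
        using True unfolding f_def deconv_pi_def cm_of_def
        by (subst measure_return) (auto split: split_indicator)
      have fm: "f \<in> borel_measurable borel"
        unfolding f using measure_convolution(1)[OF M M True] True by measurable
      have fb: "norm (f x) \<le> 1" for x
      proof -
        have *: "\<bar>i - p\<bar> \<le> 1" if "i = 0 \<or> i = 1" "0 \<le> p" "p \<le> 1" for i p :: real
          using that by auto
        show ?thesis
          unfolding f norm_of_real by (rule *) (auto split: split_indicator)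
      qed
      have int: "integrable (conv_power M k) f"
        and val: "(\<integral>x. f x \<partial>conv_power M k)
          = complex_of_real (measure (conv_power M k) A - measure (conv_power M (Suc k)) A)" for k
      proof -
        interpret K: real_distribution "conv_power M k" by (rule d)
        have m: "f \<in> borel_measurable (conv_power M k)"
          using fm by (simp cong: measurable_cong_sets)
        show "integrable (conv_power M k) f"
          using m fb by (intro K.integrable_const_bound[where B = 1]) auto
        have mm: "(\<lambda>x. measure M {y. x + y \<in> A}) \<in> borel_measurable (conv_power M k)"
          using measure_convolution(1)[OF M M True] by (simp cong: measurable_cong_sets)
        have i: "integrable (conv_power M k) (\<lambda>x. measure M {y. x + y \<in> A})"
          using mm by (intro K.integrable_const_bound[where B = 1]) auto
        have i2: "integrable (conv_power M k) (indicator A :: real \<Rightarrow> real)"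
          using True by (intro K.integrable_const_bound[where B = 1]) auto
        have "(\<integral>x. f x \<partial>conv_power M k) = complex_of_real (\<integral>x. indicator A x - measure M {y. x + y \<in> A} \<partial>conv_power M k)"
          unfolding f by (rule integral_complex_of_real)
        also have "(\<integral>x. indicator A x - measure M {y. x + y \<in> A} \<partial>conv_power M k)
            = measure (conv_power M k) A - measure (conv_power M (Suc k)) A"
          using i i2 True measure_convolution(2)[OF M d True, of k] by simp
        finally show "(\<integral>x. f x \<partial>conv_power M k)
          = complex_of_real (measure (conv_power M k) A - measure (conv_power M (Suc k)) A)" .
      qed
      have "cm_power (deconv_pi M) (Suc l) A = cm_integral (cm_power (deconv_pi M) l) f"
        using True by (simp add: cm_convolution_def f_def)
      also have "\<dots> = (\<Sum>k\<le>l. complex_of_real ((-1) ^ k * real (l choose k)) * (\<integral>x. f x \<partial>conv_power M k))"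
        unfolding Suc alternating_sum_def
        by (rule cm_integral_weighted)
           (auto simp: fm int real_distribution.events_eq_borel[OF d]
              prob_space.finite_measure real_distribution.axioms(1)[OF d])
      also have "\<dots> = complex_of_real (alternating_sum l
          (\<lambda>k. measure (conv_power M k) A - measure (conv_power M (Suc k)) A))"
        unfolding val alternating_sum_def by simp
      also have "\<dots> = complex_of_real (alternating_sum (Suc l) (\<lambda>k. measure (conv_power M k) A))"
        by (simp only: alternating_sum_diff alternating_sum_Suc)
      finally show ?thesis .
    qed
  qed
qed

text \<open>The kernel is the distribution function of a linear combination of convolution powers, so the Stieltjes integral
becomes the same combination of ordinary integrals.\<close>

lemma deconv_density_eq_alternating_sums:
  assumes M: "real_distribution M" and h: "h \<in> borel_measurable borel"
    and int: "\<And>k. integrable (conv_power M k) (\<lambda>x. h (\<xi> - x))"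
  shows "deconv_density h M \<xi> m
    = complex_of_real (\<Sum>l\<le>m. alternating_sum l (\<lambda>k. \<integral>x. h (\<xi> - x) \<partial>conv_power M k))"
proof -
  have d: "real_distribution (conv_power M k)" for k
    by (rule real_distribution_conv_power[OF M])
  define I where "I = Sigma {..m} (\<lambda>l. {..l})"
  define c where "c = (\<lambda>(l, k). (-1) ^ k * real (l choose k))"
  define Q where "Q = (\<lambda>(l :: nat, k). conv_power M k)"
  have fI: "finite I" by (simp add: I_def)
  have Q: "sets (Q i) = sets borel" "finite_measure (Q i)" for i
    unfolding Q_def
    by (auto simp: real_distribution.events_eq_borel[OF d] case_prod_beta
              prob_space.finite_measure real_distribution.axioms(1)[OF d])
  have sums: "(\<Sum>i\<in>I. c i * g (snd i)) = (\<Sum>l\<le>m. alternating_sum l g)" for g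
    unfolding I_def alternating_sum_def
    by (subst sum.Sigma) (auto simp: c_def case_prod_beta)
  define \<nu> where "\<nu> = (\<lambda>A. complex_of_real (\<Sum>i\<in>I. c i * measure (Q i) A))"
  have \<nu>: "complex_measure \<nu>"
    unfolding \<nu>_def by (rule complex_measure_weighted) (auto simp: Q)
  have "deconv_kernel M x m = cm_cdf \<nu> x" for x
    using arg_cong[OF sums[of "\<lambda>k. measure (conv_power M k) {..x}"], of complex_of_real]
    by (simp add: deconv_kernel_def cm_cdf_def cm_power_deconv_pi[OF M] \<nu>_def Q_def case_prod_beta)
  then have "deconv_density h M \<xi> m = stieltjes_integral (cm_cdf \<nu>) (\<lambda>x. complex_of_real (h (\<xi> - x)))"
    by (simp add: deconv_density_def)
  also have "\<dots> = cm_integral \<nu> (\<lambda>x. complex_of_real (h (\<xi> - x)))"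
    by (rule stieltjes_integral_cm_cdf[OF \<nu>])
  also have "\<dots> = (\<Sum>i\<in>I. complex_of_real (c i) * (\<integral>x. complex_of_real (h (\<xi> - x)) \<partial>Q i))"
    unfolding \<nu>_def
  proof (rule cm_integral_weighted[OF fI Q])
    show "(\<lambda>x. complex_of_real (h (\<xi> - x))) \<in> borel_measurable borel"
      using h by measurable
    show "integrable (Q i) (\<lambda>x. complex_of_real (h (\<xi> - x)))" for i
      using int by (simp add: Q_def case_prod_beta)
  qed
  also have "\<dots> = complex_of_real (\<Sum>i\<in>I. c i * (\<lambda>k. \<integral>x. h (\<xi> - x) \<partial>conv_power M k) (snd i))"
    by (simp add: Q_def case_prod_beta)
  finally show ?thesis using sums[of "\<lambda>k. \<integral>x. h (\<xi> - x) \<partial>conv_power M k"] by simp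
qed

lemma alternating_sum_fourier_partial:
  fixes \<Phi> :: "real \<Rightarrow> complex" and r :: "real \<Rightarrow> real"
  assumes \<Phi>: "continuous_on UNIV \<Phi>" and r: "continuous_on UNIV r"
  shows "alternating_sum l (\<lambda>k. fourier_partial (\<lambda>t. \<Phi> t * complex_of_real (r t ^ k)) T y)
    = fourier_partial (\<lambda>t. \<Phi> t * complex_of_real ((1 - r t) ^ l)) T y"
proof -
  define f where "f = (\<lambda>k t. iexp (- (t * y)) * (\<Phi> t * complex_of_real (r t ^ k)))"
  have i: "(\<lambda>t. complex_of_real c * f k t) integrable_on {0..T}" for k c
    unfolding f_def
    by (intro integrable_continuous_real continuous_intros continuous_on_subset[OF \<Phi>] continuous_on_subset[OF r]) auto
  have i1: "f k integrable_on {0..T}" for k using i[of 1 k] by simp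
  have "complex_of_real ((1 - r t) ^ l) = (\<Sum>k\<le>l. complex_of_real ((-1) ^ k * real (l choose k)) * complex_of_real (r t ^ k))" for t
    unfolding alternating_sum_power[symmetric] alternating_sum_def by simp
  then have "iexp (- (t * y)) * (\<Phi> t * complex_of_real ((1 - r t) ^ l))
      = (\<Sum>k\<le>l. complex_of_real ((-1) ^ k * real (l choose k)) * f k t)" for t
    by (simp add: f_def sum_distrib_left mult_ac)
  then have "integral {0..T} (\<lambda>t. iexp (- (t * y)) * (\<Phi> t * complex_of_real ((1 - r t) ^ l)))
      = (\<Sum>k\<le>l. complex_of_real ((-1) ^ k * real (l choose k)) * integral {0..T} (f k))"
    using i i1 by (simp only:) (subst integral_sum, auto)
  then show ?thesis
    unfolding fourier_partial_def alternating_sum_def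
    by (simp add: f_def sum_divide_distrib Re_sum)
qed

section \<open>Measures dominated by Lebesgue measure on an open set\<close>

text \<open>A bounded Borel set is contained in an open set of almost the same Lebesgue measure and is covered by countably many closed
intervals with disjoint interiors inside that open set.  The hypothesis is applied to these intervals one by one.\<close>

lemma measure_le_lborel_of_intervals:
  fixes L :: "real measure"
  assumes L: "finite_measure L" "sets L = sets borel" and V: "open V" and C: "0 \<le> C"
    and ivl: "\<And>c d. c \<le> d \<Longrightarrow> {c..d} \<subseteq> V \<Longrightarrow> measure L {c..d} \<le> C * (d - c)"
    and A: "A \<in> sets borel" "A \<subseteq> V"
  shows "emeasure L A \<le> ennreal C * emeasure lborel A"
proof -
  interpret finite_measure L by fact
  have bounded_case: "emeasure L B \<le> ennreal C * emeasure lborel B"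
    if B: "B \<in> sets borel" "B \<subseteq> V" "B \<subseteq> cbox (-n) n" and n: "0 < n" for B and n :: real
  proof -
    have "measure L B \<le> C * measure lborel B + C * e" if e: "0 < e" for e :: real
    proof -
      obtain U where U: "open U" "B \<subseteq> U" "emeasure lborel (U - B) < e"
        by (rule outer_regular_lborel[OF B(1) e])
      \<comment> \<open>covering intervals must stay inside \<open>V\<close>, where the hypothesis is available\<close>
      define W where "W = U \<inter> V"
      have W: "open W" "B \<subseteq> W" using U V B by (auto simp: W_def)
      have Wb: "W \<in> sets borel" using W by simp
      have "\<exists>g. gauge g \<and> (\<forall>x\<in>B. g x \<subseteq> W)"
      proof -
        have "\<exists>e>0. x \<in> W \<longrightarrow> ball x e \<subseteq> W" for x
          using W(1) open_contains_ball by (metis zero_less_one)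
        then obtain e where e: "\<And>x. 0 < e x" "\<And>x. x \<in> W \<Longrightarrow> ball x (e x) \<subseteq> W" by metis
        then show ?thesis
          using W(2) by (intro exI[of _ "\<lambda>x. ball x (e x)"]) (auto simp: gauge_def)
      qed
      then obtain g where g: "gauge g" "\<And>x. x \<in> B \<Longrightarrow> g x \<subseteq> W" by blast
      have ne: "box (-n) n \<noteq> {}" using n by (simp add: box_ne_empty)
      obtain \<D> where D: "countable \<D>" "\<And>K. K \<in> \<D> \<Longrightarrow> interior K \<noteq> {} \<and> (\<exists>c d. K = cbox c d)"
        "pairwise (\<lambda>A B. interior A \<inter> interior B = {}) \<D>"
        "\<And>K. K \<in> \<D> \<Longrightarrow> \<exists>x \<in> B \<inter> K. K \<subseteq> g x" "B \<subseteq> \<Union>\<D>"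
        by (rule covering_lemma[OF B(3) ne g(1)]) blast
      have KW: "K \<subseteq> W" if "K \<in> \<D>" for K using D(4)[OF that] g(2) by blast
      have KI: "\<exists>c d. K = {c..d} \<and> interior K = {c<..<d} \<and> c \<le> d" if KD: "K \<in> \<D>" for K
      proof -
        obtain c d where "K = cbox c d" "interior K \<noteq> {}" using D(2)[OF KD] by blast
        then have "K = {c..d}" "interior K = {c<..<d}" "c \<le> d"
          by (auto simp: interior_cbox box_real)
        then show ?thesis by blast
      qed
      have KB: "K \<in> sets borel" if KD: "K \<in> \<D>" for K
      proof -
        obtain c d where "K = {c..d}" using KI[OF KD] by blast
        then show ?thesis by simp
      qed
      have fin: "measure L (\<Union>F) \<le> C * measure lborel B + C * e" if F: "finite F" "F \<subseteq> \<D>" for F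
      proof -
        have Kb: "K \<in> sets borel" "interior K \<in> sets borel" if "K \<in> F" for K
          using KB F that by auto
        have "measure L (\<Union>F) \<le> (\<Sum>K\<in>F. measure L K)"
          using Kb L(2) by (intro measure_Union_le[OF F(1)]) auto
        also have "\<dots> \<le> (\<Sum>K\<in>F. C * measure lborel (interior K))"
        proof (rule sum_mono)
          fix K assume "K \<in> F"
          then have K: "K \<in> \<D>" using F by auto
          obtain c d where cd: "K = {c..d}" "interior K = {c<..<d}" "c \<le> d" using KI[OF K] by blast
          have "K \<subseteq> V" using KW[OF K] by (auto simp: W_def)
          then show "measure L K \<le> C * measure lborel (interior K)"
            using ivl[of c d] cd by simp
        qed
        also have "\<dots> = C * measure lborel (\<Union>K\<in>F. interior K)"
        proof -
          have "measure lborel (\<Union>K\<in>F. interior K) = (\<Sum>K\<in>F. measure lborel (interior K))"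
          proof (rule measure_finite_Union)
            show "disjoint_family_on interior F"
              using D(3) F(2) unfolding disjoint_family_on_def pairwise_def by blast
            show "interior ` F \<subseteq> sets lborel" using Kb by auto
            show "emeasure lborel (interior K) \<noteq> \<infinity>" if KF: "K \<in> F" for K
            proof -
              obtain c d where "interior K = {c<..<d}" "c \<le> d" using KI[of K] F KF by blast
              then show ?thesis by simp
            qed
          qed (rule F(1))
          then show ?thesis by (simp add: sum_distrib_left)
        qed
        also have "measure lborel (\<Union>K\<in>F. interior K) \<le> measure lborel B + e"
        proof -
          have "emeasure lborel B \<le> emeasure lborel (cbox (-n) n)"
            using B by (intro emeasure_mono) auto
          then have Bf: "emeasure lborel B < \<infinity>"
            by (rule order_le_less_trans) (rule emeasure_lborel_cbox_finite)
          have "(\<Union>K\<in>F. interior K) \<subseteq> B \<union> (U - B)"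
            using KW F(2) interior_subset by (fastforce simp: W_def)
          then have "emeasure lborel (\<Union>K\<in>F. interior K) \<le> emeasure lborel (B \<union> (U - B))"
            using B U by (intro emeasure_mono) auto
          also have "\<dots> \<le> emeasure lborel B + emeasure lborel (U - B)"
            using B U by (intro emeasure_subadditive) auto
          also have "\<dots> \<le> ennreal (measure lborel B) + ennreal e"
            using U(3) Bf by (intro add_mono) (auto simp: emeasure_eq_ennreal_measure less_top)
          also have "\<dots> = ennreal (measure lborel B + e)"
            using e by simp
          finally show ?thesis
            unfolding measure_def using e by (intro enn2real_leI) auto
        qed
        finally show ?thesis using C by (simp add: distrib_left mult_left_mono)
      qed
      define F where "F = (\<lambda>n::nat. (from_nat_into \<D> ` {..<n}) \<inter> \<D>)"
      have F: "finite (F n)" "F n \<subseteq> \<D>" for n by (auto simp: F_def)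
      have "F m \<subseteq> F n" if "m \<le> n" for m n
        using that by (auto simp: F_def)
      then have inc: "incseq (\<lambda>n. \<Union>(F n))" unfolding incseq_def by (meson Union_mono)
      have un: "(\<Union>n. \<Union>(F n)) = \<Union>\<D>"
      proof (intro equalityI subsetI)
        fix x assume "x \<in> \<Union>\<D>"
        then obtain K where K: "K \<in> \<D>" "x \<in> K" by blast
        then obtain i where "K = from_nat_into \<D> i" using from_nat_into_surj[OF D(1)] by metis
        then have "K \<in> F (Suc i)" using K by (auto simp: F_def)
        then show "x \<in> (\<Union>n. \<Union>(F n))" using K by blast
      qed (use F in blast)
      have Db: "\<Union>(F n) \<in> sets L" for n
        using KB F(2)[of n] F(1)[of n] unfolding L(2) by (intro sets.finite_Union) auto
      have "(\<lambda>n. measure L (\<Union>(F n))) \<longlonglongrightarrow> measure L (\<Union>n. \<Union>(F n))"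
        using Db inc by (intro finite_Lim_measure_incseq) auto
      then have "measure L (\<Union>\<D>) \<le> C * measure lborel B + C * e"
        unfolding un by (rule LIMSEQ_le_const2) (use fin[OF F] in auto)
      moreover have "measure L B \<le> measure L (\<Union>\<D>)"
      proof (rule finite_measure_mono[OF D(5)])
        show "\<Union>\<D> \<in> sets L" unfolding un[symmetric] using Db by blast
      qed
      ultimately show ?thesis by simp
    qed
    then have le: "measure L B \<le> C * measure lborel B + C * e" if "0 < e" for e :: real using that .
    have "measure L B \<le> C * measure lborel B"
    proof (cases "C = 0")
      case True then show ?thesis using le[of 1] by simp
    next
      case False
      show ?thesis
      proof (rule field_le_epsilon)
        fix e :: real assume "0 < e"
        then show "measure L B \<le> C * measure lborel B + e"
          using le[of "e / C"] False C by simp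
      qed
    qed
    then have "emeasure L B \<le> ennreal (C * measure lborel B)"
      by (simp add: emeasure_eq_measure ennreal_leI)
    also have "\<dots> = ennreal C * ennreal (measure lborel B)"
      using C by (rule ennreal_mult') 
    also have "ennreal (measure lborel B) = emeasure lborel B"
    proof -
      have "emeasure lborel B \<le> emeasure lborel (cbox (-n) n)"
        using B by (intro emeasure_mono) auto
      then have "emeasure lborel B < \<infinity>"
        by (rule order_le_less_trans) (rule emeasure_lborel_cbox_finite)
      then show ?thesis by (simp add: emeasure_eq_ennreal_measure less_top)
    qed
    finally show ?thesis .
  qed
  define A' where "A' = (\<lambda>n::nat. A \<inter> cbox (- (real n + 1)) (real n + 1))"
  have inc: "incseq A'" by (fastforce simp: incseq_def A'_def)
  have un: "(\<Union>n. A' n) = A"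
  proof (intro equalityI subsetI)
    fix x assume x: "x \<in> A"
    obtain n :: nat where "\<bar>x\<bar> \<le> real n" using real_arch_simple by blast
    then have "x \<in> A' n" using x by (auto simp: A'_def)
    then show "x \<in> (\<Union>n. A' n)" by blast
  qed (auto simp: A'_def)
  have "(SUP n. emeasure L (A' n)) = emeasure L A"
  proof -
    have "range A' \<subseteq> sets L" using A L(2) by (auto simp: A'_def)
    then show ?thesis using SUP_emeasure_incseq[OF _ inc, of L] un by simp
  qed
  then have "emeasure L A = (SUP n. emeasure L (A' n))" by simp
  also have "\<dots> \<le> ennreal C * emeasure lborel A"
  proof (rule SUP_least)
    fix n
    have "emeasure L (A' n) \<le> ennreal C * emeasure lborel (A' n)"
      by (rule bounded_case[of _ "real n + 1"]) (use A in \<open>auto simp: A'_def\<close>)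
    also have "\<dots> \<le> ennreal C * emeasure lborel A"
      using A by (intro mult_left_mono emeasure_mono) (auto simp: A'_def)
    finally show "emeasure L (A' n) \<le> ennreal C * emeasure lborel A" .
  qed
  finally show ?thesis .
qed

text \<open>The inversion formula only speaks of intervals whose end points carry no mass.  There are such points arbitrarily close to
any given ones, as the atoms are countable.\<close>

lemma closed_interval_measure_le_of_continuity_points:
  fixes L :: "real measure"
  assumes L: "real_distribution L" and V: "open V" and C: "0 \<le> C"
    and ivl: "\<And>c d. c \<le> d \<Longrightarrow> {c..d} \<subseteq> V \<Longrightarrow> measure L {c} = 0 \<Longrightarrow> measure L {d} = 0 \<Longrightarrow>
        measure L {c<..d} \<le> C * (d - c)"
    and cd: "c \<le> d" "{c..d} \<subseteq> V"
  shows "measure L {c..d} \<le> C * (d - c)"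
proof -
  interpret real_distribution L by fact
  have ct: "countable {x. measure L {x} \<noteq> 0}" by (rule countable_support)
  obtain e1 where e1: "0 < e1" "ball c e1 \<subseteq> V" using V cd open_contains_ball by (metis atLeastAtMost_iff order_refl subsetD)
  obtain e2 where e2: "0 < e2" "ball d e2 \<subseteq> V" using V cd open_contains_ball by (metis atLeastAtMost_iff order_refl subsetD)
  have key: "measure L {c..d} \<le> C * (d - c) + C * (2 * s)" if s: "0 < s" "s \<le> e1" "s \<le> e2" for s
  proof -
    obtain c' where c': "c - s < c'" "c' < c" "measure L {c'} = 0"
      using open_minus_countable[OF ct, of "{c - s<..<c}"] s by auto
    obtain d' where d': "d < d'" "d' < d + s" "measure L {d'} = 0"
      using open_minus_countable[OF ct, of "{d<..<d + s}"] s by auto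
    have sub: "{c'..d'} \<subseteq> V"
    proof
      fix x assume x: "x \<in> {c'..d'}"
      consider "x < c" | "x \<in> {c..d}" | "d < x" by force
      then show "x \<in> V"
      proof cases
        case 1 then have "x \<in> ball c e1" using x c' s by (auto simp: dist_real_def)
        then show ?thesis using e1 by blast
      next
        case 2 then show ?thesis using cd by blast
      next
        case 3 then have "x \<in> ball d e2" using x d' s by (auto simp: dist_real_def)
        then show ?thesis using e2 by blast
      qed
    qed
    have "measure L {c..d} \<le> measure L {c'<..d'}"
      using c' d' by (intro finite_measure_mono) auto
    also have "\<dots> \<le> C * (d' - c')"
      using c' d' cd sub by (intro ivl) auto
    also have "\<dots> \<le> C * ((d - c) + 2 * s)"
      using c' d' C by (intro mult_left_mono) auto
    finally show ?thesis by (simp add: distrib_left)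
  qed
  have "((\<lambda>s. C * (d - c) + C * (2 * s)) \<longlongrightarrow> C * (d - c) + C * (2 * 0)) (at_right 0)"
    by (intro tendsto_intros)
  moreover have "\<forall>\<^sub>F s in at_right 0. measure L {c..d} \<le> C * (d - c) + C * (2 * s)"
    unfolding eventually_at_right_field using key e1 e2
    by (intro exI[of _ "min e1 e2"]) auto
  ultimately have "measure L {c..d} \<le> C * (d - c) + C * (2 * 0)"
    by (intro tendsto_lowerbound) auto
  then show ?thesis by simp
qed

lemma nn_integral_le_of_measure_le:
  fixes L :: "real measure"
  assumes L: "sets L = sets borel" and V: "V \<in> sets borel"
    and le: "\<And>A. A \<in> sets borel \<Longrightarrow> A \<subseteq> V \<Longrightarrow> emeasure L A \<le> ennreal C * emeasure lborel A"
    and u: "u \<in> borel_measurable borel"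
  shows "(\<integral>\<^sup>+x. u x * indicator V x \<partial>L) \<le> ennreal C * (\<integral>\<^sup>+x. u x \<partial>lborel)"
proof -
  have [measurable]: "u \<in> borel_measurable L" "u \<in> borel_measurable lborel" "V \<in> sets L"
    using u L V by (simp_all cong: measurable_cong_sets)
  have ind: "indicator V \<in> borel_measurable L" by measurable
  have "emeasure (density L (indicator V)) A \<le> emeasure (scale_measure (ennreal C) lborel) A" for A
  proof (cases "A \<in> sets borel")
    case True
    have "emeasure (density L (indicator V)) A = emeasure L (A \<inter> V)"
      using True L V ind by (subst emeasure_density)
        (auto simp: indicator_inter_arith[symmetric] Int_commute intro!: nn_integral_indicator[THEN trans])
    also have "\<dots> \<le> ennreal C * emeasure lborel (A \<inter> V)"
      using True V by (intro le) auto
    also have "\<dots> \<le> ennreal C * emeasure lborel A"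
      using True V by (intro mult_left_mono emeasure_mono) auto
    finally show ?thesis by simp
  next
    case False
    then show ?thesis using L by (simp add: emeasure_notin_sets)
  qed
  then have "density L (indicator V) \<le> scale_measure (ennreal C) lborel"
    using L by (subst le_measure) (auto simp: le_fun_def)
  then have "(\<integral>\<^sup>+x. u x \<partial>density L (indicator V)) \<le> (\<integral>\<^sup>+x. u x \<partial>scale_measure (ennreal C) lborel)"
    using L by (intro nn_integral_mono_measure) auto
  moreover have "(\<integral>\<^sup>+x. u x \<partial>density L (indicator V)) = (\<integral>\<^sup>+x. u x * indicator V x \<partial>L)"
    by (subst nn_integral_density[OF ind]) (auto simp: mult.commute)
  ultimately show ?thesis
    by (simp add: nn_integral_scale_measure)
qed

section \<open>Uniform convergence of Fourier integrals\<close>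

text \<open>The points whose distance to \<open>D\<close> modulo \<open>2 \<pi> / \<rho>\<close> is bounded below.  The chordal distance
\<open>\<bar>e^(iu) - 1\<bar>\<close> is equivalent to the distance of \<open>u\<close> from \<open>2 \<pi> \<int>\<close>; it is the quantity in the bound for geometric
sums, and it satisfies a triangle inequality under addition of the arguments.\<close>

definition gap_set :: "real set \<Rightarrow> real \<Rightarrow> real \<Rightarrow> real set" where
  "gap_set D \<rho> d = {y. \<forall>x\<in>D. d \<le> norm (iexp ((x - y) * \<rho>) - 1)}"

definition period_monotone :: "real \<Rightarrow> nat \<Rightarrow> (real \<Rightarrow> real) \<Rightarrow> bool" where
  "period_monotone \<rho> j0 b \<longleftrightarrow> continuous_on UNIV b \<and> (\<forall>t. 0 \<le> b t \<and> b t \<le> 1) \<and>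
     (\<forall>t\<in>{0..\<rho>}. mono_on {j0..} (\<lambda>j. b (t + real j * \<rho>)) \<or> antimono_on {j0..} (\<lambda>j. b (t + real j * \<rho>)))"

text \<open>The bound \<open>e\<close> is chosen before the point \<open>y\<close> and the weight \<open>b\<close>.\<close>

definition uniform_tail :: "(real \<Rightarrow> complex) \<Rightarrow> real \<Rightarrow> nat \<Rightarrow> real set \<Rightarrow> bool" where
  "uniform_tail \<Phi> \<rho> j0 S \<longleftrightarrow>
     (\<exists>e J1. e \<longlonglongrightarrow> (0 :: real) \<and>
       (\<forall>J\<ge>J1. \<forall>T\<ge>real J * \<rho>. \<forall>y\<in>S. \<forall>b. period_monotone \<rho> j0 b \<longrightarrow>
         norm (integral {real J * \<rho>..T} (\<lambda>t. iexp (- (t * y)) * (\<Phi> t * complex_of_real (b t)))) \<le> e J))"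

text \<open>The value is arbitrary where the partial integrals diverge.\<close>

definition fourier_inverse :: "(real \<Rightarrow> complex) \<Rightarrow> real \<Rightarrow> real" where
  "fourier_inverse \<Phi> y = lim (\<lambda>n. fourier_partial \<Phi> (real n) y)"

lemma period_monotone_continuous: "period_monotone \<rho> j0 b \<Longrightarrow> continuous_on A b"
  unfolding period_monotone_def using continuous_on_subset by blast

lemma period_monotone_bounds:
  assumes "period_monotone \<rho> j0 b"
  shows "0 \<le> b t" "b t \<le> 1"
  using assms unfolding period_monotone_def by auto

lemma period_monotone_shift:
  assumes "period_monotone \<rho> j0 b" "t \<in> {0..\<rho>}" "j0 \<le> J"
  shows "mono_on {J..} (\<lambda>j. b (t + real j * \<rho>)) \<or> antimono_on {J..} (\<lambda>j. b (t + real j * \<rho>))"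
proof -
  have "{J..} \<subseteq> {j0..}" using assms(3) by auto
  then show ?thesis
    using assms(1,2) monotone_on_subset unfolding period_monotone_def by blast
qed

text \<open>For each residue \<open>t\<close>, the terms \<open>e^(-i(t + j\<rho>)y) \<Phi>\<^sub>\<kappa>(t + j\<rho>)\<close> have bounded partial sums, \<open>\<phi>(t + j\<rho>)\<close> has small
variation far out, and \<open>b(t + j\<rho>)\<close> is monotone; summation by parts bounds the sum over \<open>j\<close> by \<open>3 C \<tau>\<close>.\<close>

lemma uniform_tail_char:
  fixes \<phi> :: "ereal \<Rightarrow> complex"
  assumes chi: "real_distribution chi" and \<rho>: "0 < \<rho>" and T0: "0 \<le> T0"
    and \<kappa>: "complex_measure \<kappa>" and TV: "total_variation \<kappa> UNIV = total_variation \<kappa> (atoms \<kappa>)"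
    and cont: "continuous_on {ereal T0..\<infinity>} \<phi>" and bv: "bounded_variation_on {ereal T0..\<infinity>} \<phi>"
    and lim: "((\<lambda>t. \<phi> (ereal t)) \<longlongrightarrow> 0) at_top"
    and prod: "\<And>t. t \<ge> T0 \<Longrightarrow> char chi t = cm_char \<kappa> t * \<phi> (ereal t)"
    and d: "0 < d"
  shows "uniform_tail (char chi) \<rho> j0 (gap_set (atoms \<kappa>) \<rho> d)"
proof -
  \<comment> \<open>from this index on, the weights are monotone and the factorisation of \<open>\<Phi>\<^sub>\<chi>\<close> holds\<close>
  define J1 where "J1 = max j0 (nat \<lceil>T0 / \<rho>\<rceil>)"
  have J1: "j0 \<le> J1" by (simp add: J1_def)
  have "T0 / \<rho> \<le> real (nat \<lceil>T0 / \<rho>\<rceil>)" by (rule real_nat_ceiling_ge)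
  also have "\<dots> \<le> real J1" by (simp add: J1_def)
  finally have T0J: "T0 \<le> real J1 * \<rho>" using \<rho> by (simp add: field_simps)
  define \<psi> where "\<psi> = (\<lambda>t. \<phi> (ereal t))"
  have c\<psi>: "continuous_on {real J1 * \<rho>..} \<psi>"
    unfolding \<psi>_def
    by (rule continuous_on_compose2[OF cont]) (use T0J in \<open>auto intro!: continuous_on_ereal continuous_on_id\<close>)
  obtain V where V: "\<And>(x :: nat \<Rightarrow> ereal) n. mono x \<Longrightarrow> range x \<subseteq> {ereal T0..\<infinity>} \<Longrightarrow>
        (\<Sum>i<n. norm (\<phi> (x (Suc i)) - \<phi> (x i))) \<le> V"
    using bv unfolding bounded_variation_on_def by blast
  have ge: "T0 \<le> t + real j * \<rho>" if "0 \<le> t" "J1 \<le> j" for t j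
  proof -
    have "real J1 * \<rho> \<le> real j * \<rho>" using that \<rho> by (intro mult_right_mono) auto
    then show ?thesis using T0J that by linarith
  qed
  have V': "(\<Sum>i<n. norm (\<psi> (t + real (J1 + Suc i) * \<rho>) - \<psi> (t + real (J1 + i) * \<rho>))) \<le> V"
    if t: "t \<in> {0..\<rho>}" for t n
  proof -
    define x where "x = (\<lambda>i. ereal (t + real (J1 + i) * \<rho>))"
    have "mono x" using \<rho> by (auto simp: x_def mono_def)
    moreover have "range x \<subseteq> {ereal T0..\<infinity>}" using ge t by (auto simp: x_def simp del: of_nat_add)
    ultimately show ?thesis using V[of x n] by (simp only: x_def \<psi>_def)
  qed
  show ?thesis
  proof (rule tail_variation_integral[OF \<rho> c\<psi> lim[folded \<psi>_def] V'])
    fix \<tau>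
    assume \<tau>: "\<And>J. J1 \<le> J \<Longrightarrow> \<tau> J integrable_on {0..\<rho>}"
      "(\<lambda>J. integral {0..\<rho>} (\<tau> J)) \<longlonglongrightarrow> 0"
      "\<And>J j t. J1 \<le> J \<Longrightarrow> J \<le> j \<Longrightarrow> t \<in> {0..\<rho>} \<Longrightarrow> norm (\<psi> (t + real j * \<rho>)) \<le> \<tau> J t"
      "\<And>J J' n t. J1 \<le> J \<Longrightarrow> J \<le> J' \<Longrightarrow> t \<in> {0..\<rho>} \<Longrightarrow>
         (\<Sum>j=J'..<n. norm (\<psi> (t + real (Suc j) * \<rho>) - \<psi> (t + real j * \<rho>))) \<le> \<tau> J t"
    show ?thesis
    proof (rule sum_char_atomic_bounded[OF \<kappa> TV d])
      fix C
      assume C: "0 \<le> C"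
        "\<And>y t J n. (\<And>x. x \<in> atoms \<kappa> \<Longrightarrow> d \<le> norm (iexp ((x - y) * \<rho>) - 1)) \<Longrightarrow>
          norm (\<Sum>j=J..<n. iexp (- ((t + real j * \<rho>) * y)) * cm_char \<kappa> (t + real j * \<rho>)) \<le> C"
      define e where "e = (\<lambda>J. 2 * (3 * C * integral {0..\<rho>} (\<tau> J)))"
      have "e \<longlonglongrightarrow> 2 * (3 * C * 0)" unfolding e_def by (intro tendsto_intros \<tau>(2))
      moreover have "norm (integral {real J * \<rho>..T} (\<lambda>t. iexp (- (t * y)) * (char chi t * complex_of_real (b t)))) \<le> e J"
        if J: "J1 \<le> J" and T: "real J * \<rho> \<le> T" and y: "y \<in> gap_set (atoms \<kappa>) \<rho> d" and b: "period_monotone \<rho> j0 b"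
        for J T y b
      proof -
        have "norm (integral {real J * \<rho>..T} (\<lambda>t. iexp (- (t * y)) * (char chi t * complex_of_real (b t))))
            \<le> 2 * integral {0..\<rho>} (\<lambda>t. 3 * C * \<tau> J t)"
        proof (rule norm_integral_tail_le[OF _ \<rho> _ _ T])
          show "continuous_on {0..} (\<lambda>t. iexp (- (t * y)) * (char chi t * complex_of_real (b t)))"
            by (intro continuous_intros continuous_on_char_real[OF chi] period_monotone_continuous[OF b])
          show "(\<lambda>t. 3 * C * \<tau> J t) integrable_on {0..\<rho>}"
            using \<tau>(1)[OF J] by (rule integrable_on_mult_right)
          fix t J' n assume t: "t \<in> {0..\<rho>}" and J': "J \<le> J'"
          have "(\<Sum>j=J'..<n. iexp (- ((t + real j * \<rho>) * y)) * (char chi (t + real j * \<rho>) * complex_of_real (b (t + real j * \<rho>))))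
              = (\<Sum>j=J'..<n. (iexp (- ((t + real j * \<rho>) * y)) * cm_char \<kappa> (t + real j * \<rho>)) *
                  (\<psi> (t + real j * \<rho>) * complex_of_real (b (t + real j * \<rho>))))"
          proof (rule sum.cong[OF refl])
            fix j assume "j \<in> {J'..<n}"
            then have "T0 \<le> t + real j * \<rho>" using ge[of t j] t J J' by auto
            from prod[OF this]
            show "iexp (- ((t + real j * \<rho>) * y)) * (char chi (t + real j * \<rho>) * complex_of_real (b (t + real j * \<rho>)))
              = (iexp (- ((t + real j * \<rho>) * y)) * cm_char \<kappa> (t + real j * \<rho>)) *
                  (\<psi> (t + real j * \<rho>) * complex_of_real (b (t + real j * \<rho>)))"
              by (simp only: \<psi>_def mult.assoc)
          qed
          also have "norm \<dots> \<le> 3 * C * \<tau> J t"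
          proof (rule norm_sum_bv_monotone_le)
            show "norm (\<Sum>j=J'..<n. iexp (- ((t + real j * \<rho>) * y)) * cm_char \<kappa> (t + real j * \<rho>)) \<le> C" for n
              by (rule C(2)) (use y in \<open>auto simp: gap_set_def\<close>)
            show "mono_on {J'..} (\<lambda>j. b (t + real j * \<rho>)) \<or> antimono_on {J'..} (\<lambda>j. b (t + real j * \<rho>))"
              using J J' J1 by (intro period_monotone_shift[OF b t]) auto
            show "norm (\<psi> (t + real j * \<rho>)) \<le> \<tau> J t" if "J' \<le> j" for j
              using that J' by (intro \<tau>(3)[OF J _ t]) auto
            show "(\<Sum>j=J'..<n. norm (\<psi> (t + real (Suc j) * \<rho>) - \<psi> (t + real j * \<rho>))) \<le> \<tau> J t" for n
              by (rule \<tau>(4)[OF J J' t])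
          qed (auto simp: period_monotone_bounds[OF b])
          finally show "norm (\<Sum>j=J'..<n. iexp (- ((t + real j * \<rho>) * y)) *
              (char chi (t + real j * \<rho>) * complex_of_real (b (t + real j * \<rho>)))) \<le> 3 * C * \<tau> J t" .
        qed
        then show ?thesis by (simp add: e_def)
      qed
      ultimately show ?thesis unfolding uniform_tail_def
        by (intro exI[of _ e] exI[of _ J1]) simp
    qed
  qed
qed

lemma norm_integral_le_length:
  fixes f :: "real \<Rightarrow> complex"
  assumes "continuous_on {0..T} f" "\<And>t. norm (f t) \<le> 1" "0 \<le> T"
  shows "norm (integral {0..T} f) \<le> T"
proof -
  have "norm (integral {0..T} f) \<le> integral {0..T} (\<lambda>_. 1 :: real)"
    using assms by (intro integral_norm_bound_integral integrable_continuous_real) auto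
  then show ?thesis using assms by simp
qed

lemma fourier_partial_diff_le:
  fixes \<Phi> :: "real \<Rightarrow> complex"
  assumes c: "continuous_on UNIV \<Phi>" and S: "0 \<le> S" "S \<le> T"
  shows "\<bar>fourier_partial \<Phi> T y - fourier_partial \<Phi> S y\<bar> \<le> norm (integral {S..T} (\<lambda>t. iexp (- (t * y)) * \<Phi> t)) / pi"
proof -
  define f where "f = (\<lambda>t. iexp (- (t * y)) * \<Phi> t)"
  have "f integrable_on {0..T}"
    unfolding f_def by (intro integrable_continuous_real continuous_intros continuous_on_subset[OF c]) auto
  then have comb: "integral {0..T} f = integral {0..S} f + integral {S..T} f"
    using S by (intro Henstock_Kurzweil_Integration.integral_combine[symmetric]) auto
  have "fourier_partial \<Phi> T y - fourier_partial \<Phi> S y = Re (integral {S..T} f) / pi"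
    unfolding fourier_partial_def f_def[symmetric] comb by (simp add: add_divide_distrib)
  also have "\<bar>\<dots>\<bar> \<le> norm (integral {S..T} f) / pi"
    by (simp add: abs_Re_le_cmod divide_right_mono)
  finally show ?thesis by (simp add: f_def)
qed

lemma abs_fourier_partial_le:
  fixes \<Phi> :: "real \<Rightarrow> complex"
  assumes "continuous_on UNIV \<Phi>" "\<And>t. norm (\<Phi> t) \<le> 1" "0 \<le> T"
  shows "\<bar>fourier_partial \<Phi> T y\<bar> \<le> T / pi"
proof -
  have "norm (integral {0..T} (\<lambda>t. iexp (- (t * y)) * \<Phi> t)) \<le> T"
    using assms by (intro norm_integral_le_length continuous_intros continuous_on_subset[OF assms(1)])
      (auto simp: norm_mult)
  then show ?thesis
    unfolding fourier_partial_def
    by (simp add: divide_right_mono order_trans[OF abs_Re_le_cmod])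
qed

text \<open>The same summation by parts with a single atom at 0 and with the constant 1 in place of \<open>\<phi>\<close>.  Since the constant does not
vanish at infinity, the integrals are bounded but need not converge.\<close>

lemma fourier_partial_bounded_off_lattice:
  assumes \<rho>: "0 < \<rho>" and b: "period_monotone \<rho> j0 b" and \<eta>: "0 < \<eta>"
  obtains C where "0 \<le> C" "\<And>y T. 0 \<le> T \<Longrightarrow> \<eta> \<le> norm (iexp (y * \<rho>) - 1) \<Longrightarrow>
      \<bar>fourier_partial (\<lambda>t. complex_of_real (b t)) T y\<bar> \<le> C"
proof -
  define C where "C = real j0 * \<rho> / pi + 2 * (3 * (2 / \<eta>) * 1 * \<rho>) / pi"
  have c: "continuous_on A (\<lambda>t. complex_of_real (b t))" for A
    by (intro continuous_intros period_monotone_continuous[OF b])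
  have n1: "norm (complex_of_real (b t)) \<le> 1" for t
    using period_monotone_bounds[OF b, of t] by simp
  have tail: "norm (integral {real j0 * \<rho>..T} (\<lambda>t. iexp (- (t * y)) * complex_of_real (b t)))
        \<le> 2 * integral {0..\<rho>} (\<lambda>t. 3 * (2 / \<eta>) * 1)"
    if T: "real j0 * \<rho> \<le> T" and y: "\<eta> \<le> norm (iexp (y * \<rho>) - 1)" for T y
  proof (rule norm_integral_tail_le[OF _ \<rho> _ _ T])
    show "continuous_on {0..} (\<lambda>t. iexp (- (t * y)) * complex_of_real (b t))"
      by (intro continuous_intros period_monotone_continuous[OF b])
    show "(\<lambda>t. 3 * (2 / \<eta>) * 1) integrable_on {0..\<rho>}" by (rule integrable_const_ivl)
    fix t J' n assume t: "t \<in> {0..\<rho>}" and J': "j0 \<le> J'"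
    have "norm (\<Sum>j=J'..<n. iexp (- ((t + real j * \<rho>) * y)) * (1 * complex_of_real (b (t + real j * \<rho>))))
        \<le> 3 * (2 / \<eta>) * 1"
    proof (rule norm_sum_bv_monotone_le)
      show "norm (\<Sum>j=J'..<n. iexp (- ((t + real j * \<rho>) * y))) \<le> 2 / \<eta>" for n
      proof -
        define z where "z = iexp (- (y * \<rho>))"
        have "iexp (- ((t + real j * \<rho>) * y)) = iexp (- (t * y)) * z ^ j" for j
        proof -
          have "z ^ j = exp (of_nat j * (\<i> * complex_of_real (- (y * \<rho>))))"
            unfolding z_def by (rule exp_of_nat_mult[symmetric])
          then show ?thesis by (simp add: exp_add[symmetric] algebra_simps)
        qed
        then have "norm (\<Sum>j=J'..<n. iexp (- ((t + real j * \<rho>) * y))) = norm (\<Sum>j=J'..<n. z ^ j)"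
          by (simp only: sum_distrib_left[symmetric] norm_mult norm_exp_i_times mult_1)
        also have "\<dots> \<le> 2 / \<eta>"
        proof (rule norm_geometric_sum_le[OF _ \<eta>])
          have "z - 1 = cnj (iexp (y * \<rho>) - 1)" by (simp add: z_def exp_cnj)
          then show "\<eta> \<le> norm (z - 1)" using y by (simp only: complex_mod_cnj)
        qed (simp only: z_def norm_exp_i_times)
        finally show ?thesis .
      qed
      show "mono_on {J'..} (\<lambda>j. b (t + real j * \<rho>)) \<or> antimono_on {J'..} (\<lambda>j. b (t + real j * \<rho>))"
        by (rule period_monotone_shift[OF b t J'])
    qed (auto simp: period_monotone_bounds[OF b])
    then show "norm (\<Sum>j=J'..<n. iexp (- ((t + real j * \<rho>) * y)) * complex_of_real (b (t + real j * \<rho>)))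
        \<le> 3 * (2 / \<eta>) * 1" by (simp only: mult_1)
  qed
  show thesis
  proof (rule that[of C])
    show "0 \<le> C" using \<rho> \<eta> by (simp add: C_def)
    fix y T :: real assume T: "0 \<le> T" and y: "\<eta> \<le> norm (iexp (y * \<rho>) - 1)"
    show "\<bar>fourier_partial (\<lambda>t. complex_of_real (b t)) T y\<bar> \<le> C"
    proof (cases "T \<le> real j0 * \<rho>")
      case True
      have "\<bar>fourier_partial (\<lambda>t. complex_of_real (b t)) T y\<bar> \<le> T / pi"
        by (rule abs_fourier_partial_le[OF c n1 T])
      also have "\<dots> \<le> real j0 * \<rho> / pi" using True by (simp add: divide_right_mono)
      also have "\<dots> \<le> C" using \<rho> \<eta> by (simp add: C_def)
      finally show ?thesis .
    next
      case False
      then have T': "real j0 * \<rho> \<le> T" by simp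
      have j: "0 \<le> real j0 * \<rho>" using \<rho> by simp
      have "\<bar>fourier_partial (\<lambda>t. complex_of_real (b t)) T y - fourier_partial (\<lambda>t. complex_of_real (b t)) (real j0 * \<rho>) y\<bar>
          \<le> norm (integral {real j0 * \<rho>..T} (\<lambda>t. iexp (- (t * y)) * complex_of_real (b t))) / pi"
        by (rule fourier_partial_diff_le[OF c j T'])
      also have "\<dots> \<le> 2 * (3 * (2 / \<eta>) * 1 * \<rho>) / pi"
        using tail[OF T' y] \<rho> by (intro divide_right_mono) (simp_all add: mult_ac)
      finally show ?thesis
        using abs_fourier_partial_le[OF c n1 j, of y] unfolding C_def by linarith
    qed
  qed
qed

text \<open>Consequences of uniformly small tails: the head of the integral extends over a fixed bounded interval, where \<open>\<bar>\<Phi> b\<bar> \<le> 1\<close>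
gives boundedness and dominated convergence gives the limit for weights tending to 0 almost everywhere.\<close>

lemma fourier_inverse_properties:
  assumes tail: "uniform_tail \<Phi> \<rho> j0 S" and \<rho>: "0 < \<rho>"
    and c: "continuous_on UNIV \<Phi>" and n1: "\<And>t. norm (\<Phi> t) \<le> 1"
  shows "\<And>b. period_monotone \<rho> j0 b \<Longrightarrow>
      uniform_limit S (\<lambda>n. fourier_partial (\<lambda>t. \<Phi> t * complex_of_real (b t)) (real n))
        (fourier_inverse (\<lambda>t. \<Phi> t * complex_of_real (b t))) sequentially"
    and "\<exists>C. \<forall>b y. period_monotone \<rho> j0 b \<longrightarrow> y \<in> S \<longrightarrow> \<bar>fourier_inverse (\<lambda>t. \<Phi> t * complex_of_real (b t)) y\<bar> \<le> C"
    and "\<And>b y N. (\<And>m. period_monotone \<rho> j0 (b m)) \<Longrightarrow> negligible N \<Longrightarrow>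
        (\<And>t. t \<notin> N \<Longrightarrow> (\<lambda>m. b m t) \<longlonglongrightarrow> 0) \<Longrightarrow> y \<in> S \<Longrightarrow>
        (\<lambda>m. fourier_inverse (\<lambda>t. \<Phi> t * complex_of_real (b m t)) y) \<longlonglongrightarrow> 0"
proof -
  obtain e J1 where e: "e \<longlonglongrightarrow> (0 :: real)" and
    tl0: "\<forall>J\<ge>J1. \<forall>T\<ge>real J * \<rho>. \<forall>y\<in>S. \<forall>b. period_monotone \<rho> j0 b \<longrightarrow>
         norm (integral {real J * \<rho>..T} (\<lambda>t. iexp (- (t * y)) * (\<Phi> t * complex_of_real (b t)))) \<le> e J"
    using tail unfolding uniform_tail_def by (elim exE conjE) (rule that)
  have tl: "norm (integral {real J * \<rho>..T} (\<lambda>t. iexp (- (t * y)) * (\<Phi> t * complex_of_real (b t)))) \<le> e J"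
    if "J1 \<le> J" "real J * \<rho> \<le> T" "y \<in> S" "period_monotone \<rho> j0 b" for J T y b
    using tl0[rule_format, OF that] .
  define P where "P = (\<lambda>b. fourier_partial (\<lambda>t. \<Phi> t * complex_of_real (b t)))"
  have cb: "continuous_on A (\<lambda>t. \<Phi> t * complex_of_real (b t))" if "period_monotone \<rho> j0 b" for b A
    by (intro continuous_intros period_monotone_continuous[OF that] continuous_on_subset[OF c]) simp
  have nb: "norm (\<Phi> t * complex_of_real (b t)) \<le> 1" if "period_monotone \<rho> j0 b" for b t
    using mult_mono[OF n1[of t] period_monotone_bounds(2)[OF that, of t]] period_monotone_bounds[OF that, of t]
    by (simp add: norm_mult)
  have J\<rho>: "0 \<le> real J * \<rho>" for J using \<rho> by simp
  have diff: "\<bar>P b T y - P b (real J * \<rho>) y\<bar> \<le> e J / pi"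
    if "J1 \<le> J" "real J * \<rho> \<le> T" "y \<in> S" "period_monotone \<rho> j0 b" for J T y b
  proof -
    have "\<bar>P b T y - P b (real J * \<rho>) y\<bar>
        \<le> norm (integral {real J * \<rho>..T} (\<lambda>t. iexp (- (t * y)) * (\<Phi> t * complex_of_real (b t)))) / pi"
      unfolding P_def by (rule fourier_partial_diff_le[OF cb[OF that(4)] J\<rho> that(2)])
    also have "\<dots> \<le> e J / pi" by (intro divide_right_mono tl that) simp
    finally show ?thesis .
  qed
  have ep: "(\<lambda>J. e J / pi) \<longlonglongrightarrow> 0" using tendsto_divide[OF e tendsto_const, of pi] by simp
  have ex: "\<exists>J\<ge>J1. e J / pi < r" if "0 < r" for r
  proof -
    have "\<forall>\<^sub>F J in sequentially. J1 \<le> J \<and> e J / pi < r"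
      using order_tendstoD(2)[OF ep that] eventually_ge_at_top[of J1] by eventually_elim simp
    then show ?thesis by (auto simp: eventually_sequentially)
  qed
  show ul: "uniform_limit S (\<lambda>n. fourier_partial (\<lambda>t. \<Phi> t * complex_of_real (b t)) (real n))
        (fourier_inverse (\<lambda>t. \<Phi> t * complex_of_real (b t))) sequentially"
    if b: "period_monotone \<rho> j0 b" for b
  proof -
    have "uniformly_Cauchy_on S (\<lambda>n. P b (real n))"
    proof (rule uniformly_Cauchy_onI)
      fix r :: real assume "0 < r"
      then obtain J where J: "J1 \<le> J" "e J / pi < r / 2" using ex[of "r / 2"] by auto
      show "\<exists>M. \<forall>y\<in>S. \<forall>m\<ge>M. \<forall>n\<ge>M. dist (P b (real m) y) (P b (real n) y) < r"
      proof (intro exI ballI allI impI)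
        fix y m n assume y: "y \<in> S" and mn: "nat \<lceil>real J * \<rho>\<rceil> \<le> m" "nat \<lceil>real J * \<rho>\<rceil> \<le> n"
        have "real J * \<rho> \<le> real m" "real J * \<rho> \<le> real n" using mn by linarith+
        then show "dist (P b (real m) y) (P b (real n) y) < r"
          using diff[OF J(1) _ y b, of "real m"] diff[OF J(1) _ y b, of "real n"] J(2)
          unfolding dist_real_def by linarith
      qed
    qed
    then show ?thesis
      unfolding fourier_inverse_def P_def
      using Cauchy_uniformly_convergent uniformly_convergent_uniform_limit_iff by blast
  qed
  have lim: "(\<lambda>n. P b (real n) y) \<longlonglongrightarrow> fourier_inverse (\<lambda>t. \<Phi> t * complex_of_real (b t)) y"
    if "period_monotone \<rho> j0 b" "y \<in> S" for b y
    unfolding P_def by (rule tendsto_uniform_limitI[OF ul[OF that(1)] that(2)])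
  have inv: "\<bar>fourier_inverse (\<lambda>t. \<Phi> t * complex_of_real (b t)) y - P b (real J * \<rho>) y\<bar> \<le> e J / pi"
    if "J1 \<le> J" "y \<in> S" "period_monotone \<rho> j0 b" for J y b
  proof (rule tendsto_upperbound)
    show "(\<lambda>n. \<bar>P b (real n) y - P b (real J * \<rho>) y\<bar>) \<longlonglongrightarrow>
        \<bar>fourier_inverse (\<lambda>t. \<Phi> t * complex_of_real (b t)) y - P b (real J * \<rho>) y\<bar>"
      by (intro tendsto_intros lim that)
    show "\<forall>\<^sub>F n in sequentially. \<bar>P b (real n) y - P b (real J * \<rho>) y\<bar> \<le> e J / pi"
      using eventually_ge_at_top[of "nat \<lceil>real J * \<rho>\<rceil>"]
    proof eventually_elim
      case (elim n)
      then have "real J * \<rho> \<le> real n" by linarith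
      then show ?case by (rule diff[OF that(1) _ that(2,3)])
    qed
  qed simp
  show "\<exists>C. \<forall>b y. period_monotone \<rho> j0 b \<longrightarrow> y \<in> S \<longrightarrow> \<bar>fourier_inverse (\<lambda>t. \<Phi> t * complex_of_real (b t)) y\<bar> \<le> C"
  proof (intro exI allI impI)
    fix b y assume b: "period_monotone \<rho> j0 b" and y: "y \<in> S"
    have "\<bar>P b (real J1 * \<rho>) y\<bar> \<le> real J1 * \<rho> / pi"
      unfolding P_def by (rule abs_fourier_partial_le[OF cb[OF b] nb[OF b] J\<rho>])
    then show "\<bar>fourier_inverse (\<lambda>t. \<Phi> t * complex_of_real (b t)) y\<bar> \<le> real J1 * \<rho> / pi + e J1 / pi"
      using inv[OF order_refl y b] by linarith
  qed
  show "(\<lambda>m. fourier_inverse (\<lambda>t. \<Phi> t * complex_of_real (b m t)) y) \<longlonglongrightarrow> 0"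
    if b: "\<And>m. period_monotone \<rho> j0 (b m)" and N: "negligible N"
      and b0: "\<And>t. t \<notin> N \<Longrightarrow> (\<lambda>m. b m t) \<longlonglongrightarrow> 0" and y: "y \<in> S" for b :: "nat \<Rightarrow> real \<Rightarrow> real" and y N
  proof (rule LIMSEQ_I)
    fix r :: real assume r: "0 < r"
    then obtain J where J: "J1 \<le> J" "e J / pi < r / 2" using ex[of "r / 2"] by auto
    define f where "f = (\<lambda>m t. iexp (- (t * y)) * (\<Phi> t * complex_of_real (b m t)))"
    \<comment> \<open>changed on a null set, so that the convergence holds at every point\<close>
    define f' where "f' = (\<lambda>m t. if t \<in> N then 0 else f m t)"
    have fi: "f m integrable_on {0..real J * \<rho>}" for m
      unfolding f_def by (intro integrable_continuous_real continuous_intros cb b)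
    have eq: "integral {0..real J * \<rho>} (f' m) = integral {0..real J * \<rho>} (f m)" for m
      by (rule integral_spike[OF N]) (simp add: f'_def)
    have "(\<lambda>m. integral {0..real J * \<rho>} (f' m)) \<longlonglongrightarrow> integral {0..real J * \<rho>} (\<lambda>t. 0)"
    proof (rule dominated_convergence(2))
      show "f' m integrable_on {0..real J * \<rho>}" for m
        by (rule integrable_spike[OF fi N]) (simp add: f'_def)
      show "(\<lambda>_. 1 :: real) integrable_on {0..real J * \<rho>}" by (rule integrable_const_ivl)
      show "norm (f' m t) \<le> 1" for m t
        using nb[OF b, of t m] by (simp add: f'_def f_def norm_mult)
      show "(\<lambda>m. f' m t) \<longlonglongrightarrow> 0" for t
      proof (cases "t \<in> N")
        case False
        have "(\<lambda>m. f m t) \<longlonglongrightarrow> iexp (- (t * y)) * (\<Phi> t * complex_of_real 0)"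
          unfolding f_def by (intro tendsto_intros b0[OF False])
        then show ?thesis using False by (simp add: f'_def)
      qed (simp add: f'_def)
    qed
    then have "(\<lambda>m. integral {0..real J * \<rho>} (f m)) \<longlonglongrightarrow> 0" by (simp add: eq)
    then have "(\<lambda>m. Re (integral {0..real J * \<rho>} (f m)) / pi) \<longlonglongrightarrow> Re 0 / pi"
      by (intro tendsto_intros) auto
    then have "(\<lambda>m. P (b m) (real J * \<rho>) y) \<longlonglongrightarrow> 0"
      by (simp add: P_def fourier_partial_def f_def)
    then obtain M where M: "\<And>m. M \<le> m \<Longrightarrow> \<bar>P (b m) (real J * \<rho>) y\<bar> < r / 2"
      using LIMSEQ_D[of "\<lambda>m. P (b m) (real J * \<rho>) y" 0 "r / 2"] r by auto
    show "\<exists>M. \<forall>m\<ge>M. norm (fourier_inverse (\<lambda>t. \<Phi> t * complex_of_real (b m t)) y - 0) < r"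
    proof (intro exI[of _ M] allI impI)
      fix m assume "M \<le> m"
      then show "norm (fourier_inverse (\<lambda>t. \<Phi> t * complex_of_real (b m t)) y - 0) < r"
        using M[of m] inv[OF J(1) y b, of m] J(2) unfolding diff_0_right real_norm_def by linarith
    qed
  qed
qed

section \<open>Densities and Fourier integrals\<close>

lemma nn_integral_continuous_interval:
  fixes G :: "real \<Rightarrow> real"
  assumes G: "continuous_on {c..d} G" "\<And>x. x \<in> {c..d} \<Longrightarrow> 0 \<le> G x"
  shows "(\<integral>\<^sup>+x. ennreal (G x) * indicator {c..d} x \<partial>lborel) = ennreal (integral {c..d} G)"
proof -
  have s: "set_integrable lborel {c..d} G" by (rule borel_integrable_atLeastAtMost'[OF G(1)])
  then have i: "integrable lborel (\<lambda>x. indicator {c..d} x * G x)"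
    by (simp add: set_integrable_def)
  have "(\<integral>\<^sup>+x. ennreal (G x) * indicator {c..d} x \<partial>lborel)
      = (\<integral>\<^sup>+x. ennreal (indicator {c..d} x * G x) \<partial>lborel)"
    by (intro nn_integral_cong) (auto split: split_indicator)
  also have "\<dots> = ennreal (\<integral>x. indicator {c..d} x * G x \<partial>lborel)"
    using i G(2) by (intro nn_integral_eq_integral) (auto split: split_indicator)
  also have "(\<integral>x. indicator {c..d} x * G x \<partial>lborel) = integral {c..d} G"
    using set_borel_integral_eq_integral(2)[OF s] by (simp add: set_lebesgue_integral_def)
  finally show ?thesis .
qed

lemma measure_density_singleton:
  assumes "p \<in> borel_measurable borel"
  shows "measure (density lborel p) {x :: real} = 0"
proof -
  have "{x} \<in> null_sets lborel" by (intro null_setsI) auto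
  then have "{x} \<in> null_sets (density lborel p)"
    using absolutely_continuousI_density[of p lborel] assms unfolding absolutely_continuous_def by auto
  then show ?thesis by (rule measure_eq_0_null_sets)
qed

lemma emeasure_density_interval_right:
  assumes "p \<in> borel_measurable borel"
  shows "emeasure (density lborel p) {c<..d :: real} = (\<integral>\<^sup>+x. p x * indicator {c..d} x \<partial>lborel)"
proof -
  have "emeasure (density lborel p) {c<..d} = (\<integral>\<^sup>+x. p x * indicator {c<..d} x \<partial>lborel)"
    using assms by (intro emeasure_density) auto
  also have "\<dots> = (\<integral>\<^sup>+x. p x * indicator {c..d} x \<partial>lborel)"
    by (intro nn_integral_cong_AE AE_I[of _ _ "{c}"]) (auto split: split_indicator)
  finally show ?thesis .
qed

lemma continuous_eq_of_interval_integrals_eq: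
  fixes H G :: "real \<Rightarrow> real"
  assumes H: "continuous_on {a..b} H" and G: "continuous_on {a..b} G"
    and eq: "\<And>x. x \<in> {a..b} \<Longrightarrow> integral {a..x} H = integral {a..x} G" and z: "a < z" "z < b"
  shows "H z = G z"
proof -
  have zi: "z \<in> {a..b}" "z \<in> interior {a..b}" using z by auto
  have dH: "((\<lambda>x. integral {a..x} H) has_real_derivative H z) (at z)"
    using integral_has_real_derivative[OF H zi(1)] at_within_interior[OF zi(2)] by simp
  have dG: "((\<lambda>x. integral {a..x} G) has_real_derivative G z) (at z)"
    using integral_has_real_derivative[OF G zi(1)] at_within_interior[OF zi(2)] by simp
  have "((\<lambda>x. integral {a..x} H) has_real_derivative G z) (at z)"
    by (rule has_field_derivative_transform_within_open[OF dG, of "{a<..<b}"]) (use z eq in auto)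
  then show ?thesis using dH DERIV_unique by blast
qed

text \<open>The integrals of the limit over intervals are probabilities, and the limit is continuous.\<close>

lemma fourier_limit_nonneg:
  assumes M: "real_distribution M" and na: "\<And>x. measure M {x} = 0"
    and u: "uniform_limit {a..b} (\<lambda>n. fourier_partial (char M) (real n)) G sequentially"
    and z: "a < z" "z < b"
  shows "0 \<le> G z"
proof (rule ccontr)
  assume "\<not> 0 \<le> G z"
  then have neg: "G z < 0" by simp
  interpret real_distribution M by fact
  have c: "continuous_on {a..b} G"
    by (rule uniform_limit_theorem[OF _ u])
       (auto intro!: always_eventually continuous_fourier_partial continuous_on_char_real[OF M])
  have sub: "{c..d} \<subseteq> {a..b} \<Longrightarrow> c \<le> d \<Longrightarrow> 0 \<le> integral {c..d} G" for c d
    using measure_interval_eq_of_fourier_uniform_limit[OF M _ na na uniform_limit_on_subset[OF u], of c d]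
      measure_nonneg[of M "{c<..d}"] by simp
  have "isCont G z" using c z by (simp add: continuous_on_interior)
  then have "\<forall>\<^sub>F x in at z. G x < G z / 2"
    using neg by (intro order_tendstoD(2)[of G "G z"]) (auto simp: isCont_def)
  then have "\<forall>\<^sub>F x in nhds z. G x < G z / 2"
    using neg by (simp add: eventually_at_filter) (auto elim!: eventually_mono)
  then obtain s where s: "0 < s" "\<And>x. dist x z < s \<Longrightarrow> G x < G z / 2"
    unfolding eventually_nhds_metric by blast
  define r where "r = min (s / 2) (min (z - a) (b - z))"
  have r: "0 < r" "r < s" "r \<le> z - a" "r \<le> b - z" using s(1) z by (auto simp: r_def)
  have "integral {z..z + r} G \<le> integral {z..z + r} (\<lambda>_. G z / 2)"
  proof (rule integral_le)
    show "G integrable_on {z..z + r}"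
      using r z by (intro integrable_continuous_real continuous_on_subset[OF c]) auto
    show "G x \<le> G z / 2" if "x \<in> {z..z + r}" for x
      using s(2)[of x] that r by (auto simp: dist_real_def)
  qed (rule integrable_const_ivl)
  also have "\<dots> < 0" using r neg by (simp add: mult_pos_neg)
  finally show False using sub[of z "z + r"] r z by auto
qed

lemma density_eq_fourier_limit:
  fixes H :: "real \<Rightarrow> real"
  assumes M: "real_distribution M" "M = density lborel p" "p \<in> borel_measurable borel"
    and H: "continuous_on {a..b} H" "\<And>y. y \<in> {a..b} \<Longrightarrow> 0 \<le> H y" "\<And>y. y \<in> {a..b} \<Longrightarrow> p y = ennreal (H y)"
    and u: "uniform_limit {a..b} (\<lambda>n. fourier_partial (char M) (real n)) G sequentially"
    and z: "a < z" "z < b"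
  shows "H z = G z"
proof (rule continuous_eq_of_interval_integrals_eq[OF H(1) _ _ z])
  interpret real_distribution M by (rule M(1))
  have na: "measure M {x} = 0" for x unfolding M(2) by (rule measure_density_singleton[OF M(3)])
  show "continuous_on {a..b} G"
    by (rule uniform_limit_theorem[OF _ u])
       (auto intro!: always_eventually continuous_fourier_partial continuous_on_char_real[OF M(1)])
  fix x assume x: "x \<in> {a..b}"
  have Hx: "continuous_on {a..x} H" using x by (intro continuous_on_subset[OF H(1)]) auto
  have "emeasure M {a<..x} = (\<integral>\<^sup>+y. p y * indicator {a..x} y \<partial>lborel)"
    unfolding M(2) by (rule emeasure_density_interval_right[OF M(3)])
  also have "\<dots> = (\<integral>\<^sup>+y. ennreal (H y) * indicator {a..x} y \<partial>lborel)"
    using H(3) x by (intro nn_integral_cong) (auto split: split_indicator)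
  also have "\<dots> = ennreal (integral {a..x} H)"
    using Hx H(2) x by (intro nn_integral_continuous_interval) auto
  finally have em: "emeasure M {a<..x} = ennreal (integral {a..x} H)" .
  have "0 \<le> integral {a..x} H"
    using H(2) x by (intro integral_nonneg integrable_continuous_real Hx) auto
  with em have "measure M {a<..x} = integral {a..x} H"
    by (simp add: measure_def)
  moreover have "measure M {a<..x} = integral {a..x} G"
    using x by (intro measure_interval_eq_of_fourier_uniform_limit[OF M(1) _ na na] uniform_limit_on_subset[OF u]) auto
  ultimately show "integral {a..x} H = integral {a..x} G" by simp
qed

text \<open>Restricted to \<open>[p, q]\<close>, the measures with densities \<open>f\<close> and \<open>G\<close> have the same distribution function.\<close>

lemma AE_density_eq_fourier_limit:
  fixes f :: "real \<Rightarrow> real"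
  assumes M: "real_distribution M" "M = density lborel (\<lambda>x. ennreal (f x))"
    and f: "f \<in> borel_measurable borel" "AE x in lborel. 0 \<le> f x"
    and u: "uniform_limit {a..b} (\<lambda>n. fourier_partial (char M) (real n)) G sequentially"
    and pq: "a < p" "p \<le> q" "q < b"
  shows "AE x in lborel. x \<in> {p..q} \<longrightarrow> f x = G x"
proof -
  interpret real_distribution M by (rule M(1))
  have fm: "(\<lambda>x. ennreal (f x)) \<in> borel_measurable borel" using f(1) by measurable
  have na: "measure M {x} = 0" for x unfolding M(2) by (rule measure_density_singleton[OF fm])
  have cG: "continuous_on {a..b} G"
    by (rule uniform_limit_theorem[OF _ u])
       (auto intro!: always_eventually continuous_fourier_partial continuous_on_char_real[OF M(1)])
  have G0: "0 \<le> G x" if "x \<in> {p..q}" for x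
    using that pq by (intro fourier_limit_nonneg[OF M(1) na u]) auto
  have cG': "continuous_on {p..q} G" using pq by (intro continuous_on_subset[OF cG]) auto
  define k1 where "k1 = (\<lambda>x. ennreal (f x) * indicator {p..q} x)"
  define k2 where "k2 = (\<lambda>x. ennreal (indicator {p..q} x *\<^sub>R G x))"
  have m1: "k1 \<in> borel_measurable borel" unfolding k1_def using fm by measurable
  have m2: "k2 \<in> borel_measurable borel"
    unfolding k2_def using borel_measurable_continuous_on_indicator[OF _ cG'] by measurable
  have k2: "k2 x = ennreal (G x) * indicator {p..q} x" for x
    by (auto simp: k2_def split: split_indicator)
  have ivl: "(\<integral>\<^sup>+x. ennreal (f x) * indicator {p..d} x \<partial>lborel) = (\<integral>\<^sup>+x. ennreal (G x) * indicator {p..d} x \<partial>lborel)"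
    if d: "d \<le> q" for d
  proof (cases "p \<le> d")
    case True
    have "(\<integral>\<^sup>+x. ennreal (f x) * indicator {p..d} x \<partial>lborel) = emeasure M {p<..d}"
      unfolding M(2) by (rule emeasure_density_interval_right[OF fm, symmetric])
    also have "\<dots> = ennreal (integral {p..d} G)"
      using True d pq
      by (simp add: emeasure_eq_measure
          measure_interval_eq_of_fourier_uniform_limit[OF M(1) _ na na uniform_limit_on_subset[OF u], of p d])
    also have "\<dots> = (\<integral>\<^sup>+x. ennreal (G x) * indicator {p..d} x \<partial>lborel)"
      using d G0 by (intro nn_integral_continuous_interval[symmetric] continuous_on_subset[OF cG']) auto
    finally show ?thesis .
  qed simp
  have cd: "emeasure (density lborel k1) {..x} = emeasure (density lborel k2) {..x}" for x
  proof -
    have e: "indicator {p..q} y * indicator {..x} y = (indicator {p..min q x} y :: ennreal)" for y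
      by (auto split: split_indicator)
    have "emeasure (density lborel k1) {..x} = (\<integral>\<^sup>+y. ennreal (f y) * indicator {p..min q x} y \<partial>lborel)"
      using m1 by (subst emeasure_density) (auto simp: k1_def mult.assoc e)
    also have "\<dots> = (\<integral>\<^sup>+y. ennreal (G y) * indicator {p..min q x} y \<partial>lborel)"
      by (rule ivl) simp
    also have "\<dots> = emeasure (density lborel k2) {..x}"
      using m2 by (subst emeasure_density) (auto simp: k2 mult.assoc e)
    finally show ?thesis .
  qed
  have tot: "emeasure (density lborel k1) UNIV = (\<integral>\<^sup>+x. ennreal (f x) * indicator {p..q} x \<partial>lborel)"
      "emeasure (density lborel k2) UNIV = (\<integral>\<^sup>+x. ennreal (G x) * indicator {p..q} x \<partial>lborel)"
    using m1 m2 by (auto simp: emeasure_density k1_def k2)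
  have "emeasure (density lborel k2) UNIV = ennreal (integral {p..q} G)"
    unfolding tot using G0 cG' by (intro nn_integral_continuous_interval) auto
  then have fin2: "emeasure (density lborel k2) UNIV \<noteq> \<infinity>" by simp
  then have fin1: "emeasure (density lborel k1) UNIV \<noteq> \<infinity>" unfolding tot ivl[OF order_refl] .
  have "finite_borel_measure (density lborel k1)" "finite_borel_measure (density lborel k2)"
    using fin1 fin2 by (auto simp: finite_borel_measure_def finite_borel_measure_axioms_def intro!: finite_measureI)
  moreover have "cdf (density lborel k1) = cdf (density lborel k2)"
    using cd by (simp add: cdf_def measure_def fun_eq_iff)
  ultimately have "density lborel k1 = density lborel k2" by (rule cdf_unique')
  moreover have "integral\<^sup>N lborel k1 \<noteq> \<infinity>"
    using fin1 m1 by (simp add: emeasure_density)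
  ultimately have "AE x in lborel. k1 x = k2 x"
    using m1 m2 by (subst finite_density_unique[symmetric]) auto
  with f(2) show ?thesis
  proof eventually_elim
    case (elim x)
    then show ?case using G0[of x] by (auto simp: k1_def k2)
  qed
qed

text \<open>A one-sided neighbourhood has positive Lebesgue measure, so \<open>f\<close> and \<open>G\<close> agree at points arbitrarily close to \<open>\<xi>\<close> on
either side.\<close>

lemma limit_eq_of_AE_eq:
  fixes f G :: "real \<Rightarrow> real"
  assumes U: "open U" "\<xi> \<in> U" and ae: "AE x in lborel. x \<in> U \<longrightarrow> f x = G x"
    and G: "isCont G \<xi>" and side: "F = at_right \<xi> \<or> F = at_left \<xi>" and f: "(f \<longlongrightarrow> L) F"
  shows "L = G \<xi>"
proof -
  have GF: "(G \<longlongrightarrow> G \<xi>) F"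
    using side G unfolding isCont_def by (auto simp: filterlim_at_split)
  have lim: "((\<lambda>x. f x - G x) \<longlongrightarrow> L - G \<xi>) F" by (intro tendsto_intros f GF)
  have nz: "\<not> (\<forall>\<^sub>F x in F. f x - G x \<noteq> 0)"
  proof
    assume ev: "\<forall>\<^sub>F x in F. f x - G x \<noteq> 0"
    have "\<forall>\<^sub>F x in F. x \<in> U"
      using side eventually_nhds_in_open[OF U]
      by (auto simp: eventually_at_filter elim!: eventually_mono)
    with ev have ev2: "\<forall>\<^sub>F x in F. x \<in> U \<and> f x \<noteq> G x" by eventually_elim auto
    obtain c d where cd: "c < d" "\<And>x. c < x \<Longrightarrow> x < d \<Longrightarrow> x \<in> U \<and> f x \<noteq> G x"
    proof -
      show thesis
        using side
      proof
        assume F: "F = at_right \<xi>"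
        have "\<exists>d>\<xi>. \<forall>y>\<xi>. y < d \<longrightarrow> y \<in> U \<and> f y \<noteq> G y"
          using ev2 unfolding F eventually_at_right_field .
        then show thesis by (elim exE conjE) (rule that, auto)
      next
        assume F: "F = at_left \<xi>"
        have "\<exists>c<\<xi>. \<forall>y>c. y < \<xi> \<longrightarrow> y \<in> U \<and> f y \<noteq> G y"
          using ev2 unfolding F eventually_at_left_field .
        then show thesis by (elim exE conjE) (rule that, auto)
      qed
    qed
    have "AE x in lborel. x \<notin> {c<..<d}"
      using ae by eventually_elim (use cd(2) in auto)
    then have "emeasure lborel {c<..<d} = 0"
      by (subst (asm) AE_iff_measurable[of "{c<..<d}"]) auto
    then show False using cd(1) by simp
  qed
  show ?thesis
  proof (rule ccontr)
    assume "L \<noteq> G \<xi>"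
    then have "\<forall>\<^sub>F x in F. f x - G x \<noteq> 0" by (intro tendsto_imp_eventually_ne[OF lim]) simp
    then show False using nz by simp
  qed
qed

lemma convolution_density_left:
  fixes h :: "real \<Rightarrow> real"
  assumes h: "h \<in> borel_measurable borel" and fin: "finite_measure (density lborel (\<lambda>x. ennreal (h x)))"
    and L: "finite_measure L" "sets L = sets borel"
  shows "(\<lambda>y. \<integral>\<^sup>+x. ennreal (h (y - x)) \<partial>L) \<in> borel_measurable borel"
    and "convolution (density lborel (\<lambda>x. ennreal (h x))) L = density lborel (\<lambda>y. \<integral>\<^sup>+x. ennreal (h (y - x)) \<partial>L)"
proof -
  interpret L: finite_measure L by (rule L(1))
  interpret pair_sigma_finite lborel L ..
  note [measurable_cong] = L(2)
  note [measurable] = h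
  have m: "(\<lambda>y. \<integral>\<^sup>+x. ennreal (h (y - x)) \<partial>L) \<in> borel_measurable lborel"
    by measurable
  then show m': "(\<lambda>y. \<integral>\<^sup>+x. ennreal (h (y - x)) \<partial>L) \<in> borel_measurable borel" by simp
  show "convolution (density lborel (\<lambda>x. ennreal (h x))) L = density lborel (\<lambda>y. \<integral>\<^sup>+x. ennreal (h (y - x)) \<partial>L)"
  proof (rule measure_eqI)
    fix A assume "A \<in> sets (convolution (density lborel (\<lambda>x. ennreal (h x))) L)"
    then have A [measurable]: "A \<in> sets borel" by simp
    have "emeasure (convolution (density lborel (\<lambda>x. ennreal (h x))) L) A
        = (\<integral>\<^sup>+x. \<integral>\<^sup>+y. indicator A (x + y) \<partial>L \<partial>density lborel (\<lambda>x. ennreal (h x)))"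
      using fin L by (intro convolution_emeasure') auto
    also have "\<dots> = (\<integral>\<^sup>+x. ennreal (h x) * (\<integral>\<^sup>+y. indicator A (x + y) \<partial>L) \<partial>lborel)"
      by (subst nn_integral_density) auto
    also have "\<dots> = (\<integral>\<^sup>+x. \<integral>\<^sup>+y. ennreal (h x) * indicator A (x + y) \<partial>L \<partial>lborel)"
      by (intro nn_integral_cong nn_integral_cmult[symmetric]) measurable
    also have "\<dots> = (\<integral>\<^sup>+y. \<integral>\<^sup>+x. ennreal (h x) * indicator A (x + y) \<partial>lborel \<partial>L)"
      by (subst Fubini'[symmetric]) (auto simp: case_prod_beta)
    also have "\<dots> = (\<integral>\<^sup>+y. \<integral>\<^sup>+z. ennreal (h (z - y)) * indicator A z \<partial>lborel \<partial>L)"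
    proof (rule nn_integral_cong)
      fix y
      show "(\<integral>\<^sup>+x. ennreal (h x) * indicator A (x + y) \<partial>lborel) = (\<integral>\<^sup>+z. ennreal (h (z - y)) * indicator A z \<partial>lborel)"
        using nn_integral_real_affine[of "\<lambda>z. ennreal (h (z - y)) * indicator A z" 1 y]
        by (simp add: add.commute)
    qed
    also have "\<dots> = (\<integral>\<^sup>+z. \<integral>\<^sup>+y. ennreal (h (z - y)) * indicator A z \<partial>L \<partial>lborel)"
      by (subst Fubini') (auto simp: case_prod_beta)
    also have "\<dots> = (\<integral>\<^sup>+z. (\<integral>\<^sup>+y. ennreal (h (z - y)) \<partial>L) * indicator A z \<partial>lborel)"
      by (intro nn_integral_cong nn_integral_multc) measurable
    also have "\<dots> = emeasure (density lborel (\<lambda>y. \<integral>\<^sup>+x. ennreal (h (y - x)) \<partial>L)) A"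
      using m' by (subst emeasure_density) auto
    finally show "emeasure (convolution (density lborel (\<lambda>x. ennreal (h x))) L) A
        = emeasure (density lborel (\<lambda>y. \<integral>\<^sup>+x. ennreal (h (y - x)) \<partial>L)) A" .
  qed simp
qed

section \<open>Points away from the atoms modulo the period\<close>

lemma norm_unit_minus_one_le:
  fixes u v w :: complex
  assumes "norm u = 1" "norm v = 1"
  shows "norm (u - 1) \<le> norm (u * v * w - 1) + norm (v - 1) + norm (w - 1)"
proof -
  have "u - 1 = (u * v * w - 1) - (u * v * (w - 1) + u * (v - 1))" by (simp add: algebra_simps)
  also have "norm \<dots> \<le> norm (u * v * w - 1) + norm (u * v * (w - 1) + u * (v - 1))"
    by (rule norm_triangle_ineq4)
  also have "norm (u * v * (w - 1) + u * (v - 1)) \<le> norm (u * v * (w - 1)) + norm (u * (v - 1))"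
    by (rule norm_triangle_ineq)
  also have "\<dots> = norm (w - 1) + norm (v - 1)" using assms by (simp add: norm_mult)
  finally show ?thesis by simp
qed

text \<open>In chordal distance, moving from \<open>\<xi>\<close> to \<open>z\<close> costs at most the distances of \<open>\<xi> - (z + x)\<close> and of \<open>x\<close> from the
lattice.  With \<open>z = y - x\<close> this says that a translation by a point near the lattice hardly changes the gap.\<close>

lemma gap_set_shift:
  assumes y: "\<xi> \<in> gap_set D \<rho> d"
  shows "z \<in> gap_set D \<rho> (d - norm (iexp ((\<xi> - (z + x)) * \<rho>) - 1) - norm (iexp (x * \<rho>) - 1))"
  unfolding gap_set_def
proof (intro CollectI ballI)
  fix p assume p: "p \<in> D"
  have e: "iexp ((p - z) * \<rho>) = iexp ((p - \<xi>) * \<rho>) * iexp ((\<xi> - (z + x)) * \<rho>) * iexp (x * \<rho>)"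
    by (simp add: exp_add[symmetric] algebra_simps)
  have "d \<le> norm (iexp ((p - \<xi>) * \<rho>) - 1)" using y p by (simp add: gap_set_def)
  also have "\<dots> \<le> norm (iexp ((p - \<xi>) * \<rho>) * iexp ((\<xi> - (z + x)) * \<rho>) * iexp (x * \<rho>) - 1)
      + norm (iexp ((\<xi> - (z + x)) * \<rho>) - 1) + norm (iexp (x * \<rho>) - 1)"
    by (rule norm_unit_minus_one_le) (rule norm_exp_i_times)+
  finally show "d - norm (iexp ((\<xi> - (z + x)) * \<rho>) - 1) - norm (iexp (x * \<rho>) - 1) \<le> norm (iexp ((p - z) * \<rho>) - 1)"
    unfolding e by linarith
qed

lemma gap_set_mono: "y \<in> gap_set D \<rho> d \<Longrightarrow> d' \<le> d \<Longrightarrow> y \<in> gap_set D \<rho> d'"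
  unfolding gap_set_def by force

lemma gap_set_neighbourhood:
  assumes y: "\<xi> \<in> gap_set D \<rho> d" and d: "0 < d"
  obtains s where "0 < s" "{\<xi> - s..\<xi> + s} \<subseteq> gap_set D \<rho> (d / 2)"
    "\<And>z. z \<in> {\<xi> - s..\<xi> + s} \<Longrightarrow> norm (iexp ((\<xi> - z) * \<rho>) - 1) \<le> d / 3"
proof -
  have "isCont (\<lambda>z. norm (iexp ((\<xi> - z) * \<rho>) - 1)) \<xi>"
    by (intro continuous_intros)
  then have "(\<lambda>z. norm (iexp ((\<xi> - z) * \<rho>) - 1)) \<midarrow>\<xi>\<rightarrow> 0"
    by (simp add: isCont_def)
  then have "\<forall>\<^sub>F z in at \<xi>. norm (iexp ((\<xi> - z) * \<rho>) - 1) < d / 3"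
    using d by (intro order_tendstoD(2)) auto
  then obtain r where r: "0 < r" "\<And>z. z \<noteq> \<xi> \<Longrightarrow> dist z \<xi> < r \<Longrightarrow> norm (iexp ((\<xi> - z) * \<rho>) - 1) < d / 3"
    unfolding eventually_at by blast
  have le: "norm (iexp ((\<xi> - z) * \<rho>) - 1) \<le> d / 3" if "z \<in> {\<xi> - r / 2..\<xi> + r / 2}" for z
  proof (cases "z = \<xi>")
    case False
    have "dist z \<xi> < r" using that r(1) by (auto simp: dist_real_def)
    then show ?thesis using r(2)[OF False] by linarith
  qed (use d in simp)
  show thesis
  proof (rule that[of "r / 2"])
    show "{\<xi> - r / 2..\<xi> + r / 2} \<subseteq> gap_set D \<rho> (d / 2)"
    proof
      fix z assume z: "z \<in> {\<xi> - r / 2..\<xi> + r / 2}"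
      show "z \<in> gap_set D \<rho> (d / 2)"
      proof (rule gap_set_mono[OF gap_set_shift[OF y, of z 0]])
        have "norm (iexp ((\<xi> - (z + 0)) * \<rho>) - 1) \<le> d / 3" using le[OF z] by simp
        moreover have "norm (iexp (0 * \<rho>) - 1) = 0" by simp
        ultimately show "d / 2 \<le> d - norm (iexp ((\<xi> - (z + 0)) * \<rho>) - 1) - norm (iexp (0 * \<rho>) - 1)"
          using d by linarith
      qed
    qed
  qed (use r le in auto)
qed

lemma open_Union_gap_set: "open (\<Union>d\<in>{0<..}. gap_set D \<rho> d)"
  unfolding open_dist
proof (intro ballI)
  fix y assume "y \<in> (\<Union>d\<in>{0<..}. gap_set D \<rho> d)"
  then obtain d where d: "0 < d" "y \<in> gap_set D \<rho> d" by auto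
  obtain s where s: "0 < s" "{y - s..y + s} \<subseteq> gap_set D \<rho> (d / 2)"
    by (rule gap_set_neighbourhood[OF d(2,1)]) blast
  show "\<exists>e>0. \<forall>z. dist z y < e \<longrightarrow> z \<in> (\<Union>d\<in>{0<..}. gap_set D \<rho> d)"
  proof (intro exI conjI allI impI)
    fix z assume "dist z y < s"
    then have "z \<in> {y - s..y + s}" by (auto simp: dist_real_def)
    then have "z \<in> gap_set D \<rho> (d / 2)" using s(2) by blast
    then show "z \<in> (\<Union>d\<in>{0<..}. gap_set D \<rho> d)" using d(1) by (intro UN_I[of "d / 2"]) auto
  qed (rule s(1))
qed

text \<open>Subtracting the nearest multiple of \<open>2 \<pi>\<close> from the argument leaves a number \<open>v\<close> with \<open>d \<le> \<bar>v\<bar> \<le> \<pi>\<close>, and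
\<open>\<bar>e^(iv) - 1\<bar> = 2 sin (\<bar>v\<bar> / 2)\<close> is increasing in this range.\<close>

lemma set_gap_positive_gap_set:
  assumes "0 < set_gap (shifted_atoms \<kappa> \<rho> \<xi>) (range (\<lambda>k::int. 2 * pi * real_of_int k))"
  obtains d where "0 < d" "\<xi> \<in> gap_set (atoms \<kappa>) \<rho> d"
proof -
  obtain e where e: "0 < ereal e" "ereal e < set_gap (shifted_atoms \<kappa> \<rho> \<xi>) (range (\<lambda>k::int. 2 * pi * real_of_int k))"
    using ereal_dense2[OF assms] by (auto simp: zero_ereal_def)
  \<comment> \<open>the gap may be infinite or larger than \<open>\<pi>\<close>, but no number is further than \<open>\<pi>\<close> from \<open>2 \<pi> \<int>\<close>\<close>
  define d where "d = min e pi"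
  have d: "0 < d" "d \<le> pi" "d \<le> e" using e(1) by (auto simp: d_def)
  have s: "0 < sin (d / 2)" using d by (intro sin_gt_zero) auto
  have "\<xi> \<in> gap_set (atoms \<kappa>) \<rho> (2 * sin (d / 2))"
    unfolding gap_set_def
  proof (intro CollectI ballI)
    fix x assume x: "x \<in> atoms \<kappa>"
    define u where "u = (x - \<xi>) * \<rho>"
    define k where "k = round (u / (2 * pi))"
    define v where "v = u - 2 * pi * real_of_int k"
    have "set_gap (shifted_atoms \<kappa> \<rho> \<xi>) (range (\<lambda>k::int. 2 * pi * real_of_int k)) \<le> ereal \<bar>u - 2 * pi * real_of_int k\<bar>"
      unfolding set_gap_def
      by (rule INF_lower2[of "(u, 2 * pi * real_of_int k)"]) (use x in \<open>auto simp: shifted_atoms_def u_def\<close>)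
    then have "ereal e < ereal \<bar>v\<bar>" using e(2) unfolding v_def by (rule order_less_le_trans[rotated])
    then have v1: "d \<le> \<bar>v\<bar>" using d(3) by simp
    have "\<bar>of_int k - u / (2 * pi)\<bar> \<le> 1 / 2" unfolding k_def by (rule of_int_round_abs_le)
    then have "\<bar>u / (2 * pi) - of_int k\<bar> * (2 * pi) \<le> 1 / 2 * (2 * pi)"
      by (intro mult_right_mono) (auto simp: abs_minus_commute)
    moreover have "\<bar>u / (2 * pi) - of_int k\<bar> * (2 * pi) = \<bar>(u / (2 * pi) - of_int k) * (2 * pi)\<bar>"
      by (simp add: abs_mult)
    moreover have "(u / (2 * pi) - of_int k) * (2 * pi) = v" by (simp add: v_def field_simps)
    ultimately have v2: "\<bar>v\<bar> \<le> pi" by simp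
    have "iexp u = iexp v"
    proof -
      have "iexp u = iexp v * exp (\<i> * complex_of_real (2 * pi * real_of_int k))"
        unfolding exp_add[symmetric] by (rule arg_cong[where f = exp]) (simp add: v_def algebra_simps)
      moreover have "exp (\<i> * complex_of_real (2 * pi * real_of_int k)) = 1"
        by (rule exp_eq_1[THEN iffD2]) (auto intro!: exI[of _ k])
      ultimately show ?thesis by simp
    qed
    then have "norm (iexp u - 1) = norm (iexp v - 1)" by simp
    also have "\<dots> = 2 * \<bar>sin (v / 2)\<bar>"
    proof -
      have "(norm (iexp v - 1))\<^sup>2 = (2 * \<bar>sin (v / 2)\<bar>)\<^sup>2"
      proof -
        have "(norm (iexp v - 1))\<^sup>2 = (cos v - 1)\<^sup>2 + (sin v)\<^sup>2"
          by (simp add: cmod_power2 Re_exp Im_exp)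
        also have "\<dots> = 2 - 2 * cos v"
          using sin_cos_squared_add[of v] by (simp add: power2_eq_square algebra_simps)
        also have "cos v = 1 - 2 * (sin (v / 2))\<^sup>2"
          using cos_double_sin[of "v / 2"] by simp
        finally show ?thesis by (simp add: power_mult_distrib)
      qed
      then show ?thesis by (rule power2_eq_imp_eq) auto
    qed
    also have "\<bar>sin (v / 2)\<bar> = sin (\<bar>v\<bar> / 2)"
    proof (cases "0 \<le> v")
      case True
      then have "0 \<le> sin (v / 2)" using v2 by (intro sin_ge_zero) auto
      then show ?thesis using True by simp
    next
      case False
      then have "0 \<le> sin (- v / 2)" using v2 by (intro sin_ge_zero) auto
      then show ?thesis using False by simp
    qed
    finally have n: "norm (iexp u - 1) = 2 * sin (\<bar>v\<bar> / 2)" .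
    have "sin (d / 2) \<le> sin (\<bar>v\<bar> / 2)"
      using v1 v2 d by (intro sin_monotone_2pi_le) auto
    then show "2 * sin (d / 2) \<le> norm (iexp ((x - \<xi>) * \<rho>) - 1)"
      using n unfolding u_def by simp
  qed
  then show thesis using s by (intro that[of "2 * sin (d / 2)"]) auto
qed

lemma nn_integral_shift_reflect:
  fixes h :: "real \<Rightarrow> real"
  assumes "h \<in> borel_measurable borel"
  shows "(\<integral>\<^sup>+x. ennreal (h (y - x)) \<partial>lborel) = (\<integral>\<^sup>+x. ennreal (h x) \<partial>lborel)"
  using nn_integral_real_affine[of "\<lambda>x. ennreal (h x)" "-1" y] assms by simp

text \<open>Outside \<open>V\<close> the translates of \<open>h\<close> are bounded and \<open>L\<close> is finite.  On \<open>V\<close> the measure \<open>L\<close> is dominated by Lebesgue measure,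
and translation is continuous in \<open>L\<^sup>1\<close>: the translates converge pointwise and have the same integral, so
Scheffe's lemma applies.\<close>

lemma convolution_integral_continuous:
  fixes h :: "real \<Rightarrow> real"
  assumes h: "continuous_on UNIV h" "\<And>x. 0 \<le> h x" "(\<integral>\<^sup>+x. ennreal (h x) \<partial>lborel) = 1"
    and L: "finite_measure L" "sets L = sets borel" and V: "V \<in> sets borel"
    and le: "\<And>A. A \<in> sets borel \<Longrightarrow> A \<subseteq> V \<Longrightarrow> emeasure L A \<le> ennreal C * emeasure lborel A"
    and bd: "\<And>y x. y \<in> S \<Longrightarrow> x \<notin> V \<Longrightarrow> h (y - x) \<le> B"
  shows "\<And>y. y \<in> S \<Longrightarrow> integrable L (\<lambda>x. h (y - x))"
    and "continuous_on S (\<lambda>y. \<integral>x. h (y - x) \<partial>L)"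
proof -
  interpret finite_measure L by (rule L(1))
  note [measurable_cong] = L(2)
  have hm [measurable]: "h \<in> borel_measurable borel" by (rule borel_measurable_continuous_onI[OF h(1)])
  have [measurable]: "V \<in> sets L" using V L(2) by simp
  have vm: "(\<lambda>x. indicator V x * h (y - x)) \<in> borel_measurable L"
     "(\<lambda>x. indicator (- V) x * h (y - x)) \<in> borel_measurable L" for y
    by measurable
  have iC: "integrable L (\<lambda>x. indicator (- V) x * h (y - x))" if "y \<in> S" for y
  proof (rule integrable_const_bound[where B = "\<bar>B\<bar>"])
    show "AE x in L. norm (indicator (- V) x * h (y - x)) \<le> \<bar>B\<bar>"
      using bd[OF that] h(2) by (auto split: split_indicator intro!: AE_I2 order_trans[OF _ abs_ge_self])
  qed (rule vm)
  have iV: "integrable L (\<lambda>x. indicator V x * h (y - x))" for y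
  proof (rule integrableI_bounded[OF vm(1)])
    have "(\<integral>\<^sup>+x. ennreal (norm (indicator V x * h (y - x))) \<partial>L) = (\<integral>\<^sup>+x. ennreal (h (y - x)) * indicator V x \<partial>L)"
      using h(2) by (intro nn_integral_cong) (auto split: split_indicator)
    also have "\<dots> \<le> ennreal C * (\<integral>\<^sup>+x. ennreal (h (y - x)) \<partial>lborel)"
      by (rule nn_integral_le_of_measure_le[OF L(2) V le]; (assumption | measurable))
    also have "\<dots> = ennreal C"
      using h(3) by (simp add: nn_integral_shift_reflect)
    finally show "(\<integral>\<^sup>+x. ennreal (norm (indicator V x * h (y - x))) \<partial>L) < \<infinity>"
      by (simp add: order_le_less_trans)
  qed
  have split: "h (y - x) = indicator V x * h (y - x) + indicator (- V) x * h (y - x)" for x y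
    by (auto split: split_indicator)
  show int: "integrable L (\<lambda>x. h (y - x))" if "y \<in> S" for y
    by (subst split) (intro Bochner_Integration.integrable_add iV iC[OF that])
  show "continuous_on S (\<lambda>y. \<integral>x. h (y - x) \<partial>L)"
    unfolding continuous_on_sequentially comp_def
  proof (intro allI ballI impI, elim conjE)
    fix u :: "nat \<Rightarrow> real" and y
    assume y: "y \<in> S" and uS: "\<forall>n. u n \<in> S" and u: "u \<longlonglongrightarrow> y"
    have hlim: "(\<lambda>n. h (u n - x)) \<longlonglongrightarrow> h (y - x)" for x
    proof -
      have "isCont h (y - x)" using h(1) by (simp add: continuous_on_eq_continuous_at)
      then show ?thesis by (rule isCont_tendsto_compose) (intro tendsto_intros u)
    qed
    have 1: "(\<lambda>n. \<integral>x. indicator (- V) x * h (u n - x) \<partial>L) \<longlonglongrightarrow> (\<integral>x. indicator (- V) x * h (y - x) \<partial>L)"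
    proof (rule integral_dominated_convergence[where w = "\<lambda>_. \<bar>B\<bar>"])
      show "AE x in L. norm (indicator (- V) x * h (u n - x)) \<le> \<bar>B\<bar>" for n
        using bd[OF uS[rule_format, of n]] h(2) by (auto split: split_indicator intro!: AE_I2 order_trans[OF _ abs_ge_self])
      show "AE x in L. (\<lambda>n. indicator (- V) x * h (u n - x)) \<longlonglongrightarrow> indicator (- V) x * h (y - x)"
        by (intro AE_I2 tendsto_intros hlim)
    qed (use vm in auto)
    have "(\<lambda>n. \<integral>\<^sup>+x. norm (h (u n - x) - h (y - x)) \<partial>lborel) \<longlonglongrightarrow> 0"
    proof (rule Scheffe_lemma2)
      show "integrable lborel (\<lambda>x. h (y - x))"
        using h(2,3) nn_integral_shift_reflect[OF hm, of y]
        by (intro integrableI_bounded) auto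
      show "(\<integral>\<^sup>+x. norm (h (u n - x)) \<partial>lborel) \<le> (\<integral>\<^sup>+x. norm (h (y - x)) \<partial>lborel)" for n
        using h(2) nn_integral_shift_reflect[OF hm] by simp
    qed (use hlim in auto)
    then have lim0: "(\<lambda>n. ennreal C * (\<integral>\<^sup>+x. norm (h (u n - x) - h (y - x)) \<partial>lborel)) \<longlonglongrightarrow> ennreal C * 0"
      by (intro ennreal_tendsto_cmult) auto
    have "(\<lambda>n. \<integral>\<^sup>+x. norm (indicator V x * h (u n - x) - indicator V x * h (y - x)) \<partial>L) \<longlonglongrightarrow> 0"
    proof (rule tendsto_sandwich[OF always_eventually always_eventually tendsto_const])
      show "(\<lambda>n. ennreal C * (\<integral>\<^sup>+x. norm (h (u n - x) - h (y - x)) \<partial>lborel)) \<longlonglongrightarrow> 0"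
        using lim0 by simp
      show "\<forall>n. (\<integral>\<^sup>+x. norm (indicator V x * h (u n - x) - indicator V x * h (y - x)) \<partial>L)
          \<le> ennreal C * (\<integral>\<^sup>+x. norm (h (u n - x) - h (y - x)) \<partial>lborel)"
      proof
        fix n
        have "(\<integral>\<^sup>+x. norm (indicator V x * h (u n - x) - indicator V x * h (y - x)) \<partial>L)
            = (\<integral>\<^sup>+x. ennreal (norm (h (u n - x) - h (y - x))) * indicator V x \<partial>L)"
          by (intro nn_integral_cong) (auto split: split_indicator)
        also have "\<dots> \<le> ennreal C * (\<integral>\<^sup>+x. ennreal (norm (h (u n - x) - h (y - x))) \<partial>lborel)"
          by (rule nn_integral_le_of_measure_le[OF L(2) V le]; (assumption | measurable))
        finally show "(\<integral>\<^sup>+x. norm (indicator V x * h (u n - x) - indicator V x * h (y - x)) \<partial>L)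
          \<le> ennreal C * (\<integral>\<^sup>+x. norm (h (u n - x) - h (y - x)) \<partial>lborel)" .
      qed
    qed simp
    then have 2: "(\<lambda>n. \<integral>x. indicator V x * h (u n - x) \<partial>L) \<longlonglongrightarrow> (\<integral>x. indicator V x * h (y - x) \<partial>L)"
      using iV by (intro tendsto_L1_int) auto
    have eq: "(\<integral>x. h (z - x) \<partial>L) = (\<integral>x. indicator V x * h (z - x) \<partial>L) + (\<integral>x. indicator (- V) x * h (z - x) \<partial>L)"
      if "z \<in> S" for z
      by (subst split) (rule Bochner_Integration.integral_add[OF iV iC[OF that]])
    show "(\<lambda>n. \<integral>x. h (u n - x) \<partial>L) \<longlonglongrightarrow> (\<integral>x. h (y - x) \<partial>L)"
      using tendsto_add[OF 2 1] eq y uS by simp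
  qed
qed

section \<open>The deconvolution density as a Fourier integral\<close>

lemma period_monotone_power:
  assumes "period_monotone \<rho> j0 r"
  shows "period_monotone \<rho> j0 (\<lambda>t. r t ^ k)"
  unfolding period_monotone_def
proof (intro conjI allI ballI)
  note b = period_monotone_bounds[OF assms]
  show "continuous_on UNIV (\<lambda>t. r t ^ k)"
    by (intro continuous_intros period_monotone_continuous[OF assms])
  show "0 \<le> r t ^ k" "r t ^ k \<le> 1" for t using b by (auto intro: power_le_one)
  fix t assume "t \<in> {0..\<rho>}"
  from period_monotone_shift[OF assms this order_refl]
  show "mono_on {j0..} (\<lambda>j. r (t + real j * \<rho>) ^ k) \<or> antimono_on {j0..} (\<lambda>j. r (t + real j * \<rho>) ^ k)"
    using b by (auto simp: monotone_on_def intro!: power_mono)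
qed

lemma period_monotone_one_minus:
  assumes "period_monotone \<rho> j0 r"
  shows "period_monotone \<rho> j0 (\<lambda>t. 1 - r t)"
  unfolding period_monotone_def
proof (intro conjI allI ballI)
  note b = period_monotone_bounds[OF assms]
  show "continuous_on UNIV (\<lambda>t. 1 - r t)"
    by (intro continuous_intros period_monotone_continuous[OF assms])
  show "0 \<le> 1 - r t" "1 - r t \<le> 1" for t using b[of t] by auto
  fix t assume "t \<in> {0..\<rho>}"
  from period_monotone_shift[OF assms this order_refl]
  show "mono_on {j0..} (\<lambda>j. 1 - r (t + real j * \<rho>)) \<or> antimono_on {j0..} (\<lambda>j. 1 - r (t + real j * \<rho>))"
    by (auto simp: monotone_on_def)
qed

text \<open>The data of the convergence argument: the densities \<open>f\<close> of \<open>\<chi>\<close> and \<open>h\<close> of \<open>\<chi> * M\<close>, the real characteristic function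
\<open>r\<close> of \<open>M\<close>, and the uniform tails on the sets of points at positive distance from the set \<open>D\<close> of atoms.\<close>

locale deconvolution =
  fixes chi M :: "real measure" and f h r :: "real \<Rightarrow> real" and D :: "real set" and \<rho> :: real and j0 :: nat
  assumes chi: "real_distribution chi" and M: "real_distribution M"
    and chi_density: "chi = density lborel (\<lambda>x. ennreal (f x))"
    and f_meas: "f \<in> borel_measurable borel" and f_nonneg: "AE x in lborel. 0 \<le> f x"
    and h_density: "convolution chi M = density lborel (\<lambda>x. ennreal (h x))"
    and h_cont: "continuous_on UNIV h" and h_AE: "AE x in lborel. 0 \<le> h x"
    and \<rho>: "0 < \<rho>"
    and char_M: "\<And>t. char M t = complex_of_real (r t)"
    and mono_r: "period_monotone \<rho> j0 r"
    and tail: "\<And>d. 0 < d \<Longrightarrow> uniform_tail (char chi) \<rho> j0 (gap_set D \<rho> d)"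
begin

text \<open>The continuous density of \<open>\<chi> * M^(*k)\<close> on the gap sets.\<close>

definition G :: "nat \<Rightarrow> real \<Rightarrow> real" where
  "G k = fourier_inverse (\<lambda>t. char chi t * complex_of_real (r t ^ k))"

lemma norm_char_chi: "norm (char chi t) \<le> 1"
  by (rule real_distribution.cmod_char_le_1[OF chi])

lemmas inverse_properties =
  fourier_inverse_properties[OF tail \<rho> continuous_on_char_real[OF chi] norm_char_chi]

lemma uniform_limit_G:
  assumes d: "0 < d" and A: "A \<subseteq> gap_set D \<rho> d"
    and \<theta>: "\<And>t. char \<theta> t = char chi t * complex_of_real (r t ^ k)"
  shows "uniform_limit A (\<lambda>n. fourier_partial (char \<theta>) (real n)) (G k) sequentially"
proof -
  have e: "char \<theta> = (\<lambda>t. char chi t * complex_of_real (r t ^ k))" using \<theta> by blast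
  show ?thesis
    unfolding e G_def
    by (rule uniform_limit_on_subset[OF inverse_properties(1)[OF d period_monotone_power[OF mono_r]] A])
qed

text \<open>The density is nonnegative almost everywhere and continuous; in other words, it coincides almost everywhere, hence
everywhere, with its positive part.\<close>

lemma h_nonneg: "0 \<le> h x"
proof -
  have c: "isCont h x" using h_cont by (simp add: continuous_on_eq_continuous_at)
  have "h x = max 0 (h x)"
  proof (rule limit_eq_of_AE_eq[where U = UNIV and F = "at_right x" and f = h
        and G = "\<lambda>x. max 0 (h x)" and \<xi> = x and L = "h x"])
    show "AE x in lborel. x \<in> UNIV \<longrightarrow> h x = max 0 (h x)"
      using h_AE by eventually_elim auto
    show "isCont (\<lambda>x. max 0 (h x)) x" using c by (intro continuous_intros)
    show "(h \<longlongrightarrow> h x) (at_right x)"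
      using c unfolding isCont_def by (auto simp: filterlim_at_split)
  qed auto
  then show ?thesis by linarith
qed

lemma h_meas: "h \<in> borel_measurable borel"
  by (rule borel_measurable_continuous_onI[OF h_cont])

lemma h_integral: "(\<integral>\<^sup>+x. ennreal (h x) \<partial>lborel) = 1"
proof -
  interpret real_distribution "convolution chi M" by (rule real_distribution_convolution[OF chi M])
  have "emeasure (convolution chi M) UNIV = 1" using emeasure_space_1 by simp
  then show ?thesis unfolding h_density using h_meas by (simp add: emeasure_density)
qed

lemma h_eq_G:
  assumes d: "0 < d" and z: "z \<in> gap_set D \<rho> d"
  shows "h z = G 1 z"
proof -
  obtain s where s: "0 < s" "{z - s..z + s} \<subseteq> gap_set D \<rho> (d / 2)"
    by (rule gap_set_neighbourhood[OF z d]) blast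
  show ?thesis
  proof (rule density_eq_fourier_limit[where a = "z - s" and b = "z + s" and H = h and G = "G 1",
        OF real_distribution_convolution[OF chi M] h_density])
    show "(\<lambda>x. ennreal (h x)) \<in> borel_measurable borel" using h_meas by measurable
    show "continuous_on {z - s..z + s} h" by (rule continuous_on_subset[OF h_cont]) simp
    show "uniform_limit {z - s..z + s} (\<lambda>n. fourier_partial (char (convolution chi M)) (real n)) (G 1) sequentially"
      by (rule uniform_limit_G[OF _ s(2)]) (use d in \<open>auto simp: char_convolution[OF chi M] char_M\<close>)
  qed (use s(1) h_nonneg in auto)
qed

lemma h_bounded_on_gap_set:
  assumes d: "0 < d"
  obtains B where "\<And>z. z \<in> gap_set D \<rho> d \<Longrightarrow> h z \<le> B"
proof -
  obtain B where B: "\<forall>b y. period_monotone \<rho> j0 b \<longrightarrow> y \<in> gap_set D \<rho> d \<longrightarrow>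
      \<bar>fourier_inverse (\<lambda>t. char chi t * complex_of_real (b t)) y\<bar> \<le> B"
    using inverse_properties(2)[OF d] by (elim exE) (rule that)
  have "h z \<le> B" if z: "z \<in> gap_set D \<rho> d" for z
    using B[rule_format, OF period_monotone_power[OF mono_r, of 1] z] h_eq_G[OF d z]
    unfolding G_def by linarith
  then show thesis by (rule that)
qed

text \<open>Off the lattice \<open>(2 \<pi> / \<rho>) \<int>\<close> the inversion integrals of \<open>M^(*k)\<close> are bounded.\<close>

lemma conv_power_le_lborel:
  assumes \<eta>: "0 < \<eta>"
  obtains C where "\<And>A. A \<in> sets borel \<Longrightarrow> A \<subseteq> {x. \<eta> < norm (iexp (x * \<rho>) - 1)} \<Longrightarrow>
      emeasure (conv_power M k) A \<le> ennreal C * emeasure lborel A"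
proof -
  note L = real_distribution_conv_power[OF M, of k]
  interpret L: real_distribution "conv_power M k" by (rule L)
  have ch: "char (conv_power M k) = (\<lambda>t. complex_of_real (r t ^ k))"
    by (simp add: fun_eq_iff char_conv_power[OF M] char_M)
  define V where "V = {x. \<eta> < norm (iexp (x * \<rho>) - 1)}"
  have V: "open V"
    unfolding V_def by (intro open_Collect_less continuous_intros)
  show thesis
  proof (rule fourier_partial_bounded_off_lattice[OF \<rho> period_monotone_power[OF mono_r, of k] \<eta>])
    fix C assume C: "0 \<le> C" "\<And>y T. 0 \<le> T \<Longrightarrow> \<eta> \<le> norm (iexp (y * \<rho>) - 1) \<Longrightarrow>
      \<bar>fourier_partial (\<lambda>t. complex_of_real (r t ^ k)) T y\<bar> \<le> C"
    have open_ivl: "measure (conv_power M k) {c<..d} \<le> C * (d - c)"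
      if "c \<le> d" "{c..d} \<subseteq> V" "measure (conv_power M k) {c} = 0" "measure (conv_power M k) {d} = 0" for c d
    proof (rule measure_interval_le_of_fourier_bound[OF L that(1,3,4)])
      fix n y assume "y \<in> {c..d}"
      then have "\<eta> \<le> norm (iexp (y * \<rho>) - 1)" using that(2) by (auto simp: V_def)
      then show "\<bar>fourier_partial (char (conv_power M k)) (real n) y\<bar> \<le> C"
        unfolding ch by (intro C(2)) auto
    qed
    have closed_ivl: "measure (conv_power M k) {c..d} \<le> C * (d - c)" if "c \<le> d" "{c..d} \<subseteq> V" for c d
      by (rule closed_interval_measure_le_of_continuity_points[OF L V C(1) open_ivl that])
    show thesis
    proof (rule that[of C])
      fix A :: "real set"
      assume "A \<in> sets borel" "A \<subseteq> {x. \<eta> < norm (iexp (x * \<rho>) - 1)}"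
      then show "emeasure (conv_power M k) A \<le> ennreal C * emeasure lborel A"
        unfolding V_def[symmetric]
        by (intro measure_le_lborel_of_intervals[OF L.finite_measure_axioms _ V C(1) closed_ivl]) auto
    qed
  qed
qed

text \<open>The left-hand side of the equation is a version of the density of \<open>\<chi> * M^(*(k+1))\<close> that is continuous near \<open>\<xi>\<close>, by the splitting
into points near the lattice and away from it.\<close>

lemma convolution_integral_eq_G:
  assumes d: "0 < d" and \<xi>: "\<xi> \<in> gap_set D \<rho> d"
  shows "integrable (conv_power M k) (\<lambda>x. h (\<xi> - x))"
    and "(\<integral>x. h (\<xi> - x) \<partial>conv_power M k) = G (Suc k) \<xi>"
proof -
  note L = real_distribution_conv_power[OF M, of k]
  interpret L: real_distribution "conv_power M k" by (rule L)
  have Ls: "sets (conv_power M k) = sets borel" by simp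
  define H where "H = (\<lambda>y. \<integral>x. h (y - x) \<partial>conv_power M k)"
  obtain s where s: "0 < s" "{\<xi> - s..\<xi> + s} \<subseteq> gap_set D \<rho> (d / 2)"
    "\<And>z. z \<in> {\<xi> - s..\<xi> + s} \<Longrightarrow> norm (iexp ((\<xi> - z) * \<rho>) - 1) \<le> d / 3"
    by (rule gap_set_neighbourhood[OF \<xi> d]) blast
  \<comment> \<open>a third of the gap is spent on the move from \<open>\<xi>\<close> to \<open>y\<close> and a third on the translation by \<open>x\<close>\<close>
  define V where "V = {x. d / 3 < norm (iexp (x * \<rho>) - 1)}"
  have V: "V \<in> sets borel"
    unfolding V_def by (intro borel_open open_Collect_less continuous_intros)
  have d3: "0 < d / 3" using d by simp
  obtain C where C: "\<And>A. A \<in> sets borel \<Longrightarrow> A \<subseteq> V \<Longrightarrow> emeasure (conv_power M k) A \<le> ennreal C * emeasure lborel A"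
    unfolding V_def by (rule conv_power_le_lborel[OF d3]) blast
  obtain B where B: "\<And>z. z \<in> gap_set D \<rho> (d / 3) \<Longrightarrow> h z \<le> B"
    by (rule h_bounded_on_gap_set[OF d3]) blast
  have bd: "h (y - x) \<le> B" if y: "y \<in> {\<xi> - s..\<xi> + s}" and x: "x \<notin> V" for y x
  proof (rule B, rule gap_set_mono[OF gap_set_shift[OF \<xi>, of "y - x" x]])
    show "d / 3 \<le> d - norm (iexp ((\<xi> - (y - x + x)) * \<rho>) - 1) - norm (iexp (x * \<rho>) - 1)"
      using s(3)[OF y] x by (simp add: V_def)
  qed
  note cc = convolution_integral_continuous[OF h_cont h_nonneg h_integral L.finite_measure_axioms Ls V C bd]
  have int: "integrable (conv_power M k) (\<lambda>x. h (y - x))" if "y \<in> {\<xi> - s..\<xi> + s}" for y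
    by (rule cc(1)[OF _ _ _ _ that])
  show "integrable (conv_power M k) (\<lambda>x. h (\<xi> - x))" by (rule int) (use s(1) in auto)
  have Hc: "continuous_on {\<xi> - s..\<xi> + s} H" unfolding H_def by (rule cc(2))
  interpret chiM: real_distribution "convolution chi M" by (rule real_distribution_convolution[OF chi M])
  have fm: "finite_measure (density lborel (\<lambda>x. ennreal (h x)))"
    using chiM.finite_measure_axioms unfolding h_density .
  note cd = convolution_density_left[OF h_meas fm L.finite_measure_axioms Ls]
  have \<theta>: "real_distribution (convolution (convolution chi M) (conv_power M k))"
    by (intro real_distribution_convolution chi M L)
  have "H \<xi> = G (Suc k) \<xi>"
  proof (rule density_eq_fourier_limit[OF \<theta> _ cd(1) Hc])
    show "convolution (convolution chi M) (conv_power M k) = density lborel (\<lambda>y. \<integral>\<^sup>+x. ennreal (h (y - x)) \<partial>conv_power M k)"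
      unfolding h_density by (rule cd(2))
    show "0 \<le> H y" for y unfolding H_def using h_nonneg by simp
    show "(\<integral>\<^sup>+x. ennreal (h (y - x)) \<partial>conv_power M k) = ennreal (H y)" if "y \<in> {\<xi> - s..\<xi> + s}" for y
      unfolding H_def using h_nonneg by (intro nn_integral_eq_integral int[OF that]) auto
    show "uniform_limit {\<xi> - s..\<xi> + s} (\<lambda>n. fourier_partial (char (convolution (convolution chi M) (conv_power M k))) (real n))
        (G (Suc k)) sequentially"
      by (rule uniform_limit_G[OF _ s(2)])
         (use d in \<open>auto simp: char_convolution[OF chi M] char_convolution[OF real_distribution_convolution[OF chi M] L]
            char_conv_power[OF M] char_M mult_ac\<close>)
  qed (use s(1) in auto)
  then show "(\<integral>x. h (\<xi> - x) \<partial>conv_power M k) = G (Suc k) \<xi>" by (simp add: H_def)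
qed

lemma alternating_sum_G:
  assumes d: "0 < d" and \<xi>: "\<xi> \<in> gap_set D \<rho> d"
  shows "alternating_sum l (\<lambda>k. G k \<xi>) = fourier_inverse (\<lambda>t. char chi t * complex_of_real ((1 - r t) ^ l)) \<xi>"
proof (rule LIMSEQ_unique)
  define P where "P = (\<lambda>b n. fourier_partial (\<lambda>t. char chi t * complex_of_real (b t)) (real n) \<xi>)"
  have lim: "P b \<longlonglongrightarrow> fourier_inverse (\<lambda>t. char chi t * complex_of_real (b t)) \<xi>" if "period_monotone \<rho> j0 b" for b
    unfolding P_def by (rule tendsto_uniform_limitI[OF inverse_properties(1)[OF d that] \<xi>])
  have eq: "alternating_sum l (\<lambda>k. P (\<lambda>t. r t ^ k) n) = P (\<lambda>t. (1 - r t) ^ l) n" for n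
    unfolding P_def
    by (rule alternating_sum_fourier_partial[OF continuous_on_char_real[OF chi] period_monotone_continuous[OF mono_r]])
  have "(\<lambda>n. alternating_sum l (\<lambda>k. P (\<lambda>t. r t ^ k) n)) \<longlonglongrightarrow> alternating_sum l (\<lambda>k. G k \<xi>)"
    unfolding alternating_sum_def G_def
    by (intro tendsto_intros lim period_monotone_power mono_r)
  then show "P (\<lambda>t. (1 - r t) ^ l) \<longlonglongrightarrow> alternating_sum l (\<lambda>k. G k \<xi>)"
    unfolding eq .
  show "P (\<lambda>t. (1 - r t) ^ l) \<longlonglongrightarrow> fourier_inverse (\<lambda>t. char chi t * complex_of_real ((1 - r t) ^ l)) \<xi>"
    by (intro lim period_monotone_power period_monotone_one_minus mono_r)
qed

lemma deconv_density_tendsto_G: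
  assumes d: "0 < d" and \<xi>: "\<xi> \<in> gap_set D \<rho> d" and null: "{t. r t = 0} \<in> null_sets lborel"
  shows "(\<lambda>m. deconv_density h M \<xi> m) \<longlonglongrightarrow> complex_of_real (G 0 \<xi>)"
proof -
  have eq: "deconv_density h M \<xi> m
      = complex_of_real (G 0 \<xi> - fourier_inverse (\<lambda>t. char chi t * complex_of_real ((1 - r t) ^ Suc m)) \<xi>)" for m
    unfolding deconv_density_eq_alternating_sums[OF M h_meas convolution_integral_eq_G(1)[OF d \<xi>]]
      convolution_integral_eq_G(2)[OF d \<xi>] sum_alternating_sum_shift[of "\<lambda>k. G k \<xi>"] alternating_sum_G[OF d \<xi>] ..
  have "(\<lambda>m. fourier_inverse (\<lambda>t. char chi t * complex_of_real ((1 - r t) ^ Suc m)) \<xi>) \<longlonglongrightarrow> 0"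
  proof (rule inverse_properties(3)[OF d _ _ _ \<xi>])
    show "period_monotone \<rho> j0 (\<lambda>t. (1 - r t) ^ Suc m)" for m
      by (intro period_monotone_power period_monotone_one_minus mono_r)
    show "negligible {t. r t = 0}"
      using null by (simp add: negligible_iff_null_sets null_sets_completionI)
    show "(\<lambda>m. (1 - r t) ^ Suc m) \<longlonglongrightarrow> 0" if "t \<notin> {t. r t = 0}" for t
      using that period_monotone_bounds[OF mono_r, of t]
      by (intro LIMSEQ_Suc LIMSEQ_power_zero) auto
  qed
  then have "(\<lambda>m. complex_of_real (G 0 \<xi> - fourier_inverse (\<lambda>t. char chi t * complex_of_real ((1 - r t) ^ Suc m)) \<xi>))
      \<longlonglongrightarrow> complex_of_real (G 0 \<xi> - 0)"
    by (intro tendsto_intros)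
  then show ?thesis unfolding eq by simp
qed

lemma uniform_limit_G0:
  assumes "0 < d" "A \<subseteq> gap_set D \<rho> d"
  shows "uniform_limit A (\<lambda>n. fourier_partial (char chi) (real n)) (G 0) sequentially"
  by (rule uniform_limit_G[OF assms]) simp

lemma isCont_G0:
  assumes d: "0 < d" and \<xi>: "\<xi> \<in> gap_set D \<rho> d"
  shows "isCont (G 0) \<xi>"
proof -
  obtain s where s: "0 < s" "{\<xi> - s..\<xi> + s} \<subseteq> gap_set D \<rho> (d / 2)"
    by (rule gap_set_neighbourhood[OF \<xi> d]) blast
  have "uniform_limit {\<xi> - s..\<xi> + s} (\<lambda>n. fourier_partial (char chi) (real n)) (G 0) sequentially"
    by (rule uniform_limit_G0[OF _ s(2)]) (use d in simp)
  then have "continuous_on {\<xi> - s..\<xi> + s} (G 0)"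
    by (rule uniform_limit_theorem[rotated])
       (auto intro!: always_eventually continuous_fourier_partial continuous_on_char_real[OF chi])
  then show ?thesis using s(1) by (simp add: continuous_on_interior)
qed

text \<open>The gap sets are covered by countably many rational intervals on which the inversion integrals converge uniformly.\<close>

lemma AE_f_eq_G0: "AE x in lborel. x \<in> (\<Union>d\<in>{0<..}. gap_set D \<rho> d) \<longrightarrow> f x = G 0 x"
proof -
  define ok where "ok = (\<lambda>(a :: rat, p :: rat, q :: rat, b :: rat, n :: nat).
      a < p \<and> p \<le> q \<and> q < b \<and> {real_of_rat a..real_of_rat b} \<subseteq> gap_set D \<rho> (1 / (real n + 1)))"
  define I where "I = (\<lambda>(a :: rat, p :: rat, q :: rat, b :: rat, n :: nat). {real_of_rat p..real_of_rat q})"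
  have "AE x in lborel. ok i \<longrightarrow> x \<in> I i \<longrightarrow> f x = G 0 x" for i
  proof (cases "ok i")
    case True
    obtain a p q b n where i: "i = (a, p, q, b, n)" by (cases i) auto
    have o: "a < p" "p \<le> q" "q < b" "{real_of_rat a..real_of_rat b} \<subseteq> gap_set D \<rho> (1 / (real n + 1))"
      using True by (auto simp: ok_def i)
    have "AE x in lborel. x \<in> {real_of_rat p..real_of_rat q} \<longrightarrow> f x = G 0 x"
      by (rule AE_density_eq_fourier_limit[OF chi chi_density f_meas f_nonneg uniform_limit_G0[OF _ o(4)]])
         (use o in \<open>auto simp: of_rat_less of_rat_less_eq\<close>)
    then show ?thesis by (simp add: I_def i)
  qed simp
  then have "AE x in lborel. \<forall>i. ok i \<longrightarrow> x \<in> I i \<longrightarrow> f x = G 0 x"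
    unfolding AE_all_countable by blast
  then show ?thesis
  proof eventually_elim
    case (elim x)
    show ?case
    proof
      assume "x \<in> (\<Union>d\<in>{0<..}. gap_set D \<rho> d)"
      then obtain d where d: "0 < d" "x \<in> gap_set D \<rho> d" by auto
      obtain s where s: "0 < s" "{x - s..x + s} \<subseteq> gap_set D \<rho> (d / 2)"
        by (rule gap_set_neighbourhood[OF d(2,1)]) blast
      obtain n where n: "inverse (real (Suc n)) < d / 2"
        using reals_Archimedean[of "d / 2"] d by auto
      obtain a where a: "x - s < real_of_rat a" "real_of_rat a < x"
        using of_rat_dense[of "x - s" x] s by auto
      obtain p where p: "real_of_rat a < real_of_rat p" "real_of_rat p < x"
        using of_rat_dense[OF a(2)] by auto
      obtain b where b: "x < real_of_rat b" "real_of_rat b < x + s"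
        using of_rat_dense[of x "x + s"] s by auto
      obtain q where q: "x < real_of_rat q" "real_of_rat q < real_of_rat b"
        using of_rat_dense[OF b(1)] by auto
      have "{real_of_rat a..real_of_rat b} \<subseteq> gap_set D \<rho> (1 / (real n + 1))"
      proof
        fix y assume "y \<in> {real_of_rat a..real_of_rat b}"
        then have "y \<in> {x - s..x + s}" using a b by auto
        then have "y \<in> gap_set D \<rho> (d / 2)" using s(2) by blast
        then show "y \<in> gap_set D \<rho> (1 / (real n + 1))"
          by (rule gap_set_mono) (use n in \<open>simp add: inverse_eq_divide add.commute\<close>)
      qed
      moreover have "real_of_rat p < real_of_rat q" using p q by linarith
      ultimately have "ok (a, p, q, b, n)"
        using p q by (simp add: ok_def of_rat_less)
      moreover have "x \<in> I (a, p, q, b, n)" using p q by (simp add: I_def)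
      ultimately show "f x = G 0 x" using elim by blast
    qed
  qed
qed

end

section \<open>Convergence of the deconvolution density\<close>

text \<open>The monotonicity for \<open>m = 0\<close> is that of \<open>1 - r\<close>, and it carries over to \<open>r\<close> and to all powers of both.\<close>

lemma deconvolution_from_symmetrization:
  fixes chi mu mu_sym :: "real measure"
    and f_chi h :: "real \<Rightarrow> real"
    and \<kappa> :: cmeasure
    and \<phi> :: "ereal \<Rightarrow> complex"
    and T0 \<rho> :: real
    and j0 :: nat
  assumes chi: "real_distribution chi"
    and sym: "symmetrization mu mu_sym"
    and f: "lebesgue_density chi f_chi"
    and h: "lebesgue_density (convolution chi mu_sym) h" "continuous_on UNIV h"
    and T0: "T0 \<ge> 0"
    and \<kappa>: "complex_measure \<kappa>" "total_variation \<kappa> UNIV = total_variation \<kappa> (atoms \<kappa>)"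
    and \<phi>: "continuous_on {ereal T0..\<infinity>} \<phi>" "bounded_variation_on {ereal T0..\<infinity>} \<phi>"
      "((\<lambda>t. \<phi> (ereal t)) \<longlongrightarrow> 0) at_top"
    and prod: "\<And>t. t \<ge> T0 \<Longrightarrow> char chi t = cm_char \<kappa> t * \<phi> (ereal t)"
    and \<rho>: "\<rho> > 0"
    and mono: "\<And>t. 0 \<le> t \<Longrightarrow> t \<le> \<rho> \<Longrightarrow>
           mono_on {j0..} (\<lambda>j. deconv_P mu_sym (t + real j * \<rho>) 0) \<or>
           antimono_on {j0..} (\<lambda>j. deconv_P mu_sym (t + real j * \<rho>) 0)"
  shows "deconvolution chi mu_sym f_chi h (\<lambda>t. Re (char mu_sym t)) (atoms \<kappa>) \<rho> j0"
proof (rule deconvolution.intro)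
  show M: "real_distribution mu_sym" using sym by (simp add: symmetrization_def)
  have ex: "\<exists>s. 0 \<le> s \<and> s \<le> 1 \<and> char mu_sym t = complex_of_real s" for t
    using sym by (simp add: symmetrization_def)
  have bounds: "0 \<le> Re (char mu_sym t) \<and> Re (char mu_sym t) \<le> 1" for t
    using ex[of t] by auto
  show "char mu_sym t = complex_of_real (Re (char mu_sym t))" for t
    using ex[of t] by auto
  show "period_monotone \<rho> j0 (\<lambda>t. Re (char mu_sym t))"
    unfolding period_monotone_def
  proof (intro conjI allI ballI)
    show "continuous_on UNIV (\<lambda>t. Re (char mu_sym t))"
      by (intro continuous_intros continuous_on_char_real[OF M])
    fix t assume "t \<in> {0..\<rho>}"
    then show "mono_on {j0..} (\<lambda>j. Re (char mu_sym (t + real j * \<rho>))) \<or>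
        antimono_on {j0..} (\<lambda>j. Re (char mu_sym (t + real j * \<rho>)))"
      using mono[of t] by (auto simp: deconv_P_def monotone_on_def)
  qed (use bounds in auto)
  show "uniform_tail (char chi) \<rho> j0 (gap_set (atoms \<kappa>) \<rho> d)" if "0 < d" for d
    by (rule uniform_tail_char[OF chi \<rho> T0 \<kappa> \<phi> prod that])
qed (use assms in \<open>auto simp: lebesgue_density_def\<close>)

theorem theorem6p7:
  fixes chi mu mu_sym iota :: "real measure"
    and f_chi h f_iota :: "real \<Rightarrow> real"
    and d_iota :: "real \<Rightarrow> complex"
    and \<kappa> :: cmeasure
    and \<phi> :: "ereal \<Rightarrow> complex"
    and a T0 \<rho> :: real
    and j0 :: nat
  assumes "real_distribution chi" and "real_distribution mu"
    and "symmetrization mu mu_sym"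
    and "lebesgue_density chi f_chi"
    and "lebesgue_density (convolution chi mu_sym) h" and "continuous_on UNIV h"
    and "real_distribution iota" and "lebesgue_density iota f_iota"
    and "f_iota \<in> O[at_top](\<lambda>x. 1 / x ^ 2)" and "f_iota \<in> O[at_bot](\<lambda>x. 1 / x ^ 2)"
    and "integrable lborel (char iota)"
    and "\<And>t. t \<noteq> 0 \<Longrightarrow> (char iota has_vector_derivative d_iota t) (at t)"
    and "continuous_on (- {0}) d_iota"
    and "a > 2"
    and "(\<lambda>t. norm (d_iota t)) \<in> O[at_top](\<lambda>t. \<bar>t\<bar> powr (- a))"
    and "(\<lambda>t. norm (d_iota t)) \<in> O[at_bot](\<lambda>t. \<bar>t\<bar> powr (- a))"
    and "T0 \<ge> 0"
    and "complex_measure \<kappa>" and "total_variation \<kappa> UNIV = total_variation \<kappa> (atoms \<kappa>)"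
    and "continuous_on {ereal T0..\<infinity>} \<phi>" and "bounded_variation_on {ereal T0..\<infinity>} \<phi>"
    and "((\<lambda>t. \<phi> (ereal t)) \<longlongrightarrow> 0) at_top"
    and "\<And>t. t \<ge> T0 \<Longrightarrow> char chi t = cm_char \<kappa> t * \<phi> (ereal t)"
    and "\<rho> > 0"
    and "\<And>m t. 0 \<le> t \<Longrightarrow> t \<le> \<rho> \<Longrightarrow>
           mono_on {j0..} (\<lambda>j. deconv_P mu_sym (t + real j * \<rho>) m) \<or>
           antimono_on {j0..} (\<lambda>j. deconv_P mu_sym (t + real j * \<rho>) m)"
    and "{t. ereal t \<in> char_zeros mu} \<in> null_sets lborel"
  shows
    \<comment> \<open>convergence, for any version of the density that has one-sided limits at the point\<close>
    "(\<forall>\<xi> Lr Ll. set_gap (shifted_atoms \<kappa> \<rho> \<xi>) (range (\<lambda>k::int. 2 * pi * real_of_int k)) > 0 \<longrightarrow>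
        (f_chi \<longlongrightarrow> Lr) (at_right \<xi>) \<longrightarrow> (f_chi \<longlongrightarrow> Ll) (at_left \<xi>) \<longrightarrow>
        (\<lambda>m. deconv_density h mu_sym \<xi> m) \<longlonglongrightarrow> complex_of_real ((Lr + Ll) / 2)) \<and>
     \<comment> \<open>some version of the density does have them, at all of the points in question\<close>
     (\<exists>g. lebesgue_density chi g \<and>
        (\<forall>\<xi>. set_gap (shifted_atoms \<kappa> \<rho> \<xi>) (range (\<lambda>k::int. 2 * pi * real_of_int k)) > 0 \<longrightarrow>
           (\<exists>Lr Ll. (g \<longlongrightarrow> Lr) (at_right \<xi>) \<and> (g \<longlongrightarrow> Ll) (at_left \<xi>))))"
proof -
  interpret deconvolution chi mu_sym f_chi h "\<lambda>t. Re (char mu_sym t)" "atoms \<kappa>" \<rho> j0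
    using assms(25) by (intro deconvolution_from_symmetrization[OF assms(1,3-6,17-24)]) auto
  define U where "U = (\<Union>d\<in>{0<..}. gap_set (atoms \<kappa>) \<rho> d)"
  have U: "open U" unfolding U_def by (rule open_Union_gap_set)
  have ae: "AE x in lborel. x \<in> U \<longrightarrow> f_chi x = G 0 x" unfolding U_def by (rule AE_f_eq_G0)
  have inU: "\<xi> \<in> U" if "0 < d" "\<xi> \<in> gap_set (atoms \<kappa>) \<rho> d" for \<xi> d
    using that by (auto simp: U_def)
  have null: "{t. Re (char mu_sym t) = 0} \<in> null_sets lborel"
  proof -
    have "char_zeros mu_sym = char_zeros mu" using assms(3) by (simp add: symmetrization_def)
    moreover have "{t. ereal t \<in> char_zeros mu_sym} = {t. Re (char mu_sym t) = 0}"
      unfolding char_zeros_def using char_M by (auto simp: complex_eq_iff)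
    ultimately show ?thesis using assms(26) by simp
  qed
  show ?thesis
  proof (intro conjI allI impI)
    fix \<xi> Lr Ll
    assume gap: "0 < set_gap (shifted_atoms \<kappa> \<rho> \<xi>) (range (\<lambda>k::int. 2 * pi * real_of_int k))"
      and Lr: "(f_chi \<longlongrightarrow> Lr) (at_right \<xi>)" and Ll: "(f_chi \<longlongrightarrow> Ll) (at_left \<xi>)"
    obtain d where d: "0 < d" "\<xi> \<in> gap_set (atoms \<kappa>) \<rho> d"
      by (rule set_gap_positive_gap_set[OF gap])
    have "Lr = G 0 \<xi>"
      by (rule limit_eq_of_AE_eq[OF U inU[OF d] ae isCont_G0[OF d] _ Lr]) simp
    moreover have "Ll = G 0 \<xi>"
      by (rule limit_eq_of_AE_eq[OF U inU[OF d] ae isCont_G0[OF d] _ Ll]) simp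
    ultimately show "(\<lambda>m. deconv_density h mu_sym \<xi> m) \<longlonglongrightarrow> complex_of_real ((Lr + Ll) / 2)"
      using deconv_density_tendsto_G[OF d null] by simp
  next
    \<comment> \<open>the continuous density where it is available, the given version elsewhere\<close>
    define g where "g = (\<lambda>x. if x \<in> U then G 0 x else f_chi x)"
    have fg: "AE x in lborel. f_chi x = g x"
      using ae by eventually_elim (simp add: g_def)
    have cU: "continuous_on U (G 0)"
      unfolding continuous_on_eq_continuous_at[OF U] using isCont_G0 by (auto simp: U_def)
    have g: "g \<in> borel_measurable borel"
    proof -
      have "(\<lambda>x. indicator U x *\<^sub>R G 0 x + indicator (- U) x *\<^sub>R f_chi x) \<in> borel_measurable borel"
        using U f_meas by (intro borel_measurable_add borel_measurable_continuous_on_indicator[OF _ cU]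
          borel_measurable_scaleR borel_measurable_indicator) auto
      also have "(\<lambda>x. indicator U x *\<^sub>R G 0 x + indicator (- U) x *\<^sub>R f_chi x) = g"
        by (auto simp: g_def fun_eq_iff split: split_indicator)
      finally show ?thesis .
    qed
    have "AE x in lborel. 0 \<le> g x" using fg f_nonneg by eventually_elim simp
    moreover have "chi = density lborel (\<lambda>x. ennreal (g x))"
      unfolding chi_density using f_meas g fg
      by (intro density_cong) (auto elim: eventually_mono)
    ultimately have "lebesgue_density chi g" using g by (simp add: lebesgue_density_def)
    moreover have "\<exists>Lr Ll. (g \<longlongrightarrow> Lr) (at_right \<xi>) \<and> (g \<longlongrightarrow> Ll) (at_left \<xi>)"
      if gap: "0 < set_gap (shifted_atoms \<kappa> \<rho> \<xi>) (range (\<lambda>k::int. 2 * pi * real_of_int k))" for \<xi>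
    proof -
      obtain d where d: "0 < d" "\<xi> \<in> gap_set (atoms \<kappa>) \<rho> d"
        by (rule set_gap_positive_gap_set[OF gap])
      have "\<forall>\<^sub>F x in at \<xi>. G 0 x = g x"
        using eventually_at_in_open'[OF U inU[OF d]] by eventually_elim (simp add: g_def)
      moreover have "(G 0 \<longlongrightarrow> G 0 \<xi>) (at \<xi>)" using isCont_G0[OF d] by (simp add: isCont_def)
      ultimately have "(g \<longlongrightarrow> G 0 \<xi>) (at \<xi>)" by (rule Lim_transform_eventually[rotated])
      then show ?thesis by (auto simp: filterlim_at_split)
    qed
    ultimately show "\<exists>g. lebesgue_density chi g \<and>
        (\<forall>\<xi>. set_gap (shifted_atoms \<kappa> \<rho> \<xi>) (range (\<lambda>k::int. 2 * pi * real_of_int k)) > 0 \<longrightarrow>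
           (\<exists>Lr Ll. (g \<longlongrightarrow> Lr) (at_right \<xi>) \<and> (g \<longlongrightarrow> Ll) (at_left \<xi>)))"
      by blast
  qed
qed

end
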